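(* Let $d\ge 2$ and, for every $n\in\mathbb N$, let $\sigma_n$ be a random $d$-dimensional permutation of size $n$. Then the following are equivalent: (1) $\mu_{\sigma_n}$ converges weakly (i.e. in distribution, as random elements of the space of $d$-dimensional permutons with the weak topology) to a (possibly random) $d$-dimensional permuton $\mu$. (2) The vector $(\mathrm{freq}(\tau,\sigma_n))_\tau$, indexed by $d$-dimensional permutations $\tau$ of all sizes, converges in distribution in the product topology to some random vector $(v_\tau)_\tau$. (3) For every $d$-dimensional permutation $\tau$, $\mathbb E[\mathrm{freq}(\tau,\sigma_n)]$ converges to some constant $c_\tau$. (4) For each $k$, the random $d$-dimensional permutation $\mathrm{pat}_{I_{n,k}}(\sigma_n)$, where $I_{n,k}$ is a uniform subset of $[n]$ of size $k$ independent of $\sigma_n$, converges in distribution to a random $d$-dimensional permutation $\rho_k$; that is, for all $d$-dimensional permutations $\tau$ of size $k$, $\lim_{n\to\infty}\mathbb P(\mathrm{pat}_{I_{n,k}}(\sigma_n)=\tau)=\mathbb P(\rho_k=\tau)$. When these conditions hold, for every $k$ and every $d$-dimensional permutation $\tau$ of size $k$, $$\mathbb E[\mathrm{freq}(\tau,\mu)]=\mathbb E[v_\tau]=c_\tau=\mathbb P(\rho_k=\tau),$$ and furthermore the vector $(v_\tau)_\tau$ has the same distribution as $(\mathrm{freq}(\tau,\mu))_\tau$, and $\rho_k=P_\mu[k]$ in distribution.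
   Context: Let $[n]=\{1,\dots,n\}$. A $d$-dimensional permutation of size $n$ is a function $\sigma:[n]\to[n]^{d-1}$, $\sigma(i)=(\sigma(i)^{(1)},\dots,\sigma(i)^{(d-1)})$, such that each coordinate $i\mapsto\sigma(i)^{(j)}$ is a permutation of $[n]$; the set of these is $\mathcal S_{d,n}$ and $|\sigma|$ denotes the size. A $d$-dimensional permuton is a Borel probability measure on $[0,1]^d$ all of whose $d$ one-dimensional marginals are uniform on $[0,1]$; the space of $d$-permutons carries the weak topology, and a random permuton is a random element of it. To $\sigma\in\mathcal S_{d,n}$ is associated the permuton $\mu_\sigma$ with density $n^{d-1}\mathbf 1\{\sigma(\lceil nx_1\rceil)=(\lceil nx_2\rceil,\dots,\lceil nx_d\rceil)\}$ with respect to Lebesgue measure on $[0,1]^d$. Patterns: for $\tau\in\mathcal S_{d,k}$, $\sigma\in\mathcal S_{d,n}$, $1\le k\le n$, and $I=\{i_1<\dots<i_k\}\subset[n]$, $\tau=\mathrm{pat}_I(\sigma)$ means $\tau(a)^{(j)}<\tau(b)^{(j)}\iff\sigma(i_a)^{(j)}<\sigma(i_b)^{(j)}$ for all $a,b\in[k]$, $1\le j\le d-1$. Set $\mathrm{freq}(\tau,\sigma)=\binom nk^{-1}\#\{I\subset[n]:|I|=k,\ \tau=\mathrm{pat}_I(\sigma)\}$, and $\mathrm{freq}(\tau,\sigma)=0$ if $|\tau|>|\sigma|$. For a permuton $\mu$, let $\vec x_1,\dots,\vec x_k$ be iid points sampled from $\mu$ (conditionally on $\mu$ if $\mu$ is random),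 and let $f(i)$ be the rank of $\vec x_i$ when the $k$ points are sorted by increasing first coordinate. $P_\mu[k]=\mathrm{Perm}(\vec x_1,\dots,\vec x_k)$ is the (a.s. unique) element of $\mathcal S_{d,k}$ with $P_\mu[k](f(a))^{(j)}<P_\mu[k](f(b))^{(j)}\iff\vec x_a^{(j+1)}<\vec x_b^{(j+1)}$ for all $a,b\in[k]$, $1\le j\le d-1$. For $\tau\in\mathcal S_{d,k}$, $\mathrm{freq}(\tau,\mu)=\int_{([0,1]^d)^k}\mathbf 1\{\mathrm{Perm}(\vec x_1,\dots,\vec x_k)=\tau\}\,\mu(d\vec x_1)\cdots\mu(d\vec x_k)$, a random variable when $\mu$ is random. *)

theory Defs
  imports "HOL-Probability.Probability" "HOL-Combinatorics.Permutations"
begin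

section \<open>Multidimensional permutations\<close>

text \<open>
  The dimension is \<open>d = CARD('e) + 1\<close> for a nonempty finite type \<open>'e\<close> that indexes the
  \<open>d - 1\<close> coordinates of \<open>\<sigma>(i)\<close>; letting \<open>'e\<close> range over all finite types gives exactly
  \<open>d \<ge> 2\<close>. Points of \<open>[0,1]\<^sup>d\<close> live in \<open>real ^ 'e option\<close>: the index \<open>None\<close> is the first
  coordinate, and \<open>Some j\<close> is the coordinate that is matched with \<open>\<sigma>(i)\<^sup>(\<^sup>j\<^sup>)\<close>.

  A permutation is stored together with its size, because \<open>permutes\<close> extends each coordinate
  by the identity outside \<open>{1..n}\<close>. Sizes start at 1.
\<close>

typedef ('e::finite) dperm =
  "{(n, s). 1 \<le> n \<and> (\<forall>j. (\<lambda>i. s i $ j) permutes {1..n})} :: (nat \<times> (nat \<Rightarrow> nat ^ 'e)) set"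
proof -
  have "(\<lambda>i. (\<chi> j. i) $ j) permutes {1..1::nat}" for j :: 'e
    using permutes_id[of "{1..1::nat}"] by (simp add: id_def)
  then show ?thesis
    by (intro exI[of _ "(1, \<lambda>i. \<chi> j. i)"] CollectI case_prodI conjI allI) simp_all
qed

definition psize :: "'e::finite dperm \<Rightarrow> nat" where
  "psize \<sigma> = fst (Rep_dperm \<sigma>)"

definition papp :: "'e::finite dperm \<Rightarrow> nat \<Rightarrow> nat ^ 'e" where
  "papp \<sigma> = snd (Rep_dperm \<sigma>)"

lemma psize_ge_1: "1 \<le> psize \<sigma>"
  using Rep_dperm[of \<sigma>] by (simp add: psize_def case_prod_beta)

lemma papp_permutes: "(\<lambda>i. papp \<sigma> i $ j) permutes {1..psize \<sigma>}"
  using Rep_dperm[of \<sigma>] by (simp add: psize_def papp_def case_prod_beta)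

lemma dperm_eqI:
  assumes "psize \<sigma> = psize \<tau>"
    and "\<And>i j. i \<in> {1..psize \<sigma>} \<Longrightarrow> papp \<sigma> i $ j = papp \<tau> i $ j"
  shows "\<sigma> = \<tau>"
proof -
  have "papp \<sigma> i $ j = papp \<tau> i $ j" for i j
  proof (cases "i \<in> {1..psize \<sigma>}")
    case True
    then show ?thesis by (rule assms(2))
  next
    case False
    then have "i \<notin> {1..psize \<tau>}" unfolding assms(1) .
    with False show ?thesis
      by (metis papp_permutes permutes_not_in)
  qed
  then have "papp \<sigma> = papp \<tau>"
    by (intro ext) (simp only: vec_eq_iff, blast)
  with assms(1) have "Rep_dperm \<sigma> = Rep_dperm \<tau>"
    unfolding psize_def papp_def by (rule prod_eqI)
  then show ?thesis unfolding Rep_dperm_inject .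
qed

text \<open>
  For \<open>I = {i\<^sub>1 < \<dots> < i\<^sub>k}\<close>, \<open>sorted_list_of_set I ! (a - 1)\<close> is \<open>i\<^sub>a\<close>. The description is meant
  for nonempty \<open>I \<subseteq> {1..psize \<sigma>}\<close>.
\<close>

definition pat :: "nat set \<Rightarrow> 'e::finite dperm \<Rightarrow> 'e dperm" where
  "pat I \<sigma> = (THE \<tau>. psize \<tau> = card I \<and>
     (\<forall>a\<in>{1..card I}. \<forall>b\<in>{1..card I}. \<forall>j.
        papp \<tau> a $ j < papp \<tau> b $ j \<longleftrightarrow>
        papp \<sigma> (sorted_list_of_set I ! (a - 1)) $ j < papp \<sigma> (sorted_list_of_set I ! (b - 1)) $ j))"

definition freq :: "'e::finite dperm \<Rightarrow> 'e dperm \<Rightarrow> real" where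
  "freq \<tau> \<sigma> =
     (if psize \<tau> > psize \<sigma> then 0
      else real (card {I. I \<subseteq> {1..psize \<sigma>} \<and> card I = psize \<tau> \<and> \<tau> = pat I \<sigma>})
             / real (psize \<sigma> choose psize \<tau>))"


section \<open>Permutons\<close>

definition permutons :: "(real ^ 'd) measure set" where
  "permutons = {\<mu>. prob_space \<mu> \<and> sets \<mu> = sets (restrict_space borel (cbox 0 1)) \<and>
     (\<forall>i. distr \<mu> borel (\<lambda>x. x $ i) = uniform_measure lborel {0..1})}"

text \<open>
  The weak topology is the coarsest one for which \<open>\<mu> \<mapsto> \<integral> f d\<mu>\<close> is continuous for every
  continuous \<open>f\<close> on the (compact) unit cube.
\<close>

definition permuton_topology :: "(real ^ 'd) measure topology" where
  "permuton_topology = topology_generated_by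
     {{\<mu> \<in> permutons. (LINT x|\<mu>. f x) \<in> U} | f U. continuous_on (cbox 0 1) f \<and> open (U :: real set)}"

lemma topspace_permuton_topology:
  "topspace permuton_topology = (permutons :: (real ^ 'd) measure set)"
proof -
  have "permutons \<in> {{\<mu> \<in> permutons. (LINT x|\<mu>. f x) \<in> U} | (f :: real ^ 'd \<Rightarrow> real) U.
      continuous_on (cbox 0 1) f \<and> open (U :: real set)}"
    by (intro CollectI exI[of _ "\<lambda>_. 0"] exI[of _ "UNIV"]) simp
  moreover have "\<Union>{{\<mu> \<in> permutons. (LINT x|\<mu>. f x) \<in> U} | (f :: real ^ 'd \<Rightarrow> real) U.
      continuous_on (cbox 0 1) f \<and> open (U :: real set)} \<subseteq> permutons"
    by (rule Union_least) (elim CollectE exE conjE, simp)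
  ultimately show ?thesis
    unfolding permuton_topology_def topology_generated_by_topspace
    by (intro subset_antisym Union_upper)
qed

definition permuton_of :: "'e::finite dperm \<Rightarrow> (real ^ 'e option) measure" where
  "permuton_of \<sigma> = density (restrict_space lborel (cbox 0 1))
     (\<lambda>x. ennreal (real (psize \<sigma>) ^ CARD('e)) *
       indicator {x. \<forall>j. papp \<sigma> (nat \<lceil>real (psize \<sigma>) * x $ None\<rceil>) $ j
                          = nat \<lceil>real (psize \<sigma>) * x $ Some j\<rceil>} x)"

text \<open>
  \<open>coord_rank k x i\<close> is the rank \<open>f(i)\<close> of \<open>x\<^sub>i\<close> among \<open>x\<^sub>1, \<dots>, x\<^sub>k\<close> with respect to the first
  coordinate. If the points have ties in some coordinate, the description in \<open>perm_of\<close> need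
  not determine a permutation; under a permuton this is a null event.
\<close>

definition coord_rank :: "nat \<Rightarrow> (nat \<Rightarrow> real ^ 'e::finite option) \<Rightarrow> nat \<Rightarrow> nat" where
  "coord_rank k x i = card {l \<in> {1..k}. x l $ None \<le> x i $ None}"

definition perm_of :: "nat \<Rightarrow> (nat \<Rightarrow> real ^ 'e::finite option) \<Rightarrow> 'e dperm" where
  "perm_of k x = (THE \<tau>. psize \<tau> = k \<and>
     (\<forall>a\<in>{1..k}. \<forall>b\<in>{1..k}. \<forall>j.
        papp \<tau> (coord_rank k x a) $ j < papp \<tau> (coord_rank k x b) $ j \<longleftrightarrow>
        x a $ Some j < x b $ Some j))"

definition freq_permuton :: "'e::finite dperm \<Rightarrow> (real ^ 'e option) measure \<Rightarrow> real" where
  "freq_permuton \<tau> \<mu> =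
     (LINT x|PiM {1..psize \<tau>} (\<lambda>_. \<mu>). of_bool (perm_of (psize \<tau>) x = \<tau>))"

text \<open>The law of \<open>P\<^sub>\<mu>[k]\<close> for a deterministic permuton \<open>\<mu>\<close>.\<close>

definition perm_law :: "nat \<Rightarrow> (real ^ 'e::finite option) measure \<Rightarrow> 'e dperm measure" where
  "perm_law k \<mu> = distr (PiM {1..k} (\<lambda>_. \<mu>)) (count_space UNIV) (perm_of k)"


section \<open>Convergence in distribution\<close>

definition borel_of :: "'a topology \<Rightarrow> 'a measure" where
  "borel_of T = sigma (topspace T) {U. openin T U}"

definition random_element :: "'b topology \<Rightarrow> 'a measure \<Rightarrow> ('a \<Rightarrow> 'b) \<Rightarrow> bool" where
  "random_element T N Y \<longleftrightarrow> prob_space N \<and> Y \<in> N \<rightarrow>\<^sub>M borel_of T"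

definition conv_in_distr ::
  "'b topology \<Rightarrow> (nat \<Rightarrow> 'a measure) \<Rightarrow> (nat \<Rightarrow> 'a \<Rightarrow> 'b) \<Rightarrow> 'c measure \<Rightarrow> ('c \<Rightarrow> 'b) \<Rightarrow> bool" where
  "conv_in_distr T M X N Y \<longleftrightarrow>
     (\<forall>f. continuous_map T euclideanreal f \<and> bounded (f ` topspace T) \<longrightarrow>
        (\<lambda>n. LINT \<omega>|M n. f (X n \<omega>)) \<longlonglongrightarrow> (LINT \<omega>|N. f (Y \<omega>)))"

abbreviation vec_topology :: "('e::finite dperm \<Rightarrow> real) topology" where
  "vec_topology \<equiv> product_topology (\<lambda>_. euclideanreal) UNIV"


section \<open>The four modes of convergence of random permutations\<close>

text \<open>The random permutation \<open>\<sigma> n\<close> is defined on the probability space \<open>M n\<close>.\<close>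

definition permuton_limit ::
  "(nat \<Rightarrow> 'a measure) \<Rightarrow> (nat \<Rightarrow> 'a \<Rightarrow> 'e::finite dperm) \<Rightarrow>
   'b measure \<Rightarrow> ('b \<Rightarrow> (real ^ 'e option) measure) \<Rightarrow> bool" where
  "permuton_limit M \<sigma> N \<mu> \<longleftrightarrow>
     random_element permuton_topology N \<mu> \<and>
     conv_in_distr permuton_topology M (\<lambda>n \<omega>. permuton_of (\<sigma> n \<omega>)) N \<mu>"

definition freq_limit ::
  "(nat \<Rightarrow> 'a measure) \<Rightarrow> (nat \<Rightarrow> 'a \<Rightarrow> 'e::finite dperm) \<Rightarrow>
   'b measure \<Rightarrow> ('b \<Rightarrow> 'e dperm \<Rightarrow> real) \<Rightarrow> bool" where
  "freq_limit M \<sigma> N v \<longleftrightarrow>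
     random_element vec_topology N v \<and>
     conv_in_distr vec_topology M (\<lambda>n \<omega> \<tau>. freq \<tau> (\<sigma> n \<omega>)) N v"

definition mean_freq_limit ::
  "(nat \<Rightarrow> 'a measure) \<Rightarrow> (nat \<Rightarrow> 'a \<Rightarrow> 'e::finite dperm) \<Rightarrow> ('e dperm \<Rightarrow> real) \<Rightarrow> bool" where
  "mean_freq_limit M \<sigma> c \<longleftrightarrow> (\<forall>\<tau>. (\<lambda>n. LINT \<omega>|M n. freq \<tau> (\<sigma> n \<omega>)) \<longlonglongrightarrow> c \<tau>)"

text \<open>
  The uniform subset \<open>I\<close> of size \<open>k\<close> is made independent of \<open>\<sigma> n\<close> by taking the product space.
  The finitely many \<open>n < k\<close>, for which there is no such subset, do not affect the limit.
\<close>

definition pattern_limit ::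
  "(nat \<Rightarrow> 'a measure) \<Rightarrow> (nat \<Rightarrow> 'a \<Rightarrow> 'e::finite dperm) \<Rightarrow> nat \<Rightarrow>
   'b measure \<Rightarrow> ('b \<Rightarrow> 'e dperm) \<Rightarrow> bool" where
  "pattern_limit M \<sigma> k N \<rho> \<longleftrightarrow>
     prob_space N \<and> \<rho> \<in> N \<rightarrow>\<^sub>M count_space UNIV \<and> (\<forall>\<omega>\<in>space N. psize (\<rho> \<omega>) = k) \<and>
     (\<forall>\<tau>. psize \<tau> = k \<longrightarrow>
        (\<lambda>n. \<P>(p in M n \<Otimes>\<^sub>M uniform_count_measure {I. I \<subseteq> {1..n} \<and> card I = k}.
                 pat (snd p) (\<sigma> n (fst p)) = \<tau>))
          \<longlonglongrightarrow> \<P>(\<omega> in N. \<rho> \<omega> = \<tau>))"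

end

theory Submission
  imports Defs
begin

text \<open>
  Write \<open>\<Phi>(\<mu>) = (freq \<tau> \<mu>)\<^sub>\<tau>\<close> for the vector of pattern densities of a permuton. The expectation of any
  function of finitely many sample points that depends only on the order of their coordinates is a
  linear combination of pattern densities. Therefore a product of pattern densities is again such a
  combination, so convergence of the means \<open>\<bbbE>[freq \<tau> \<sigma>\<^sub>n]\<close> forces convergence of the expectation of every
  polynomial in the entries of \<open>\<Phi>(\<mu>\<^bsub>\<sigma>\<^sub>n\<^esub>)\<close>. Likewise, as the marginals are uniform, the integral of
  a continuous function against \<open>\<mu>\<close> is a uniform limit of combinations of pattern densities; since
  the pattern densities are themselves weakly continuous and the space of permutons is compact,
  \<open>\<Phi>\<close> is a homeomorphism onto a compact subset of a countable product of unit intervals. Laws on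
  such a product are sequentially compact, and by the Stone-Weierstrass theorem polynomials identify
  the limit. Finally the frequencies in \<open>\<sigma>\<close> and the densities in \<open>\<mu>\<^sub>\<sigma>\<close> differ by \<open>O(1/|\<sigma>|)\<close>,
  because sampling from \<open>\<mu>\<^sub>\<sigma>\<close> rarely hits the same cell twice.
\<close>

section \<open>Compactness of laws on a countable product of intervals\<close>

text \<open>Two obstacles shape the argument. The pattern of a sample is not a continuous function
  of its points: it jumps at ties. Uniform marginals bound the probability that two points come
  within \<delta> in some coordinate by twice \<delta>, whatever the permuton. This one estimate
  yields the absence of ties, the continuity of the densities and the rate at which frequencies
  approach densities. Secondly, compactness yields a limit law along a subsequence only.
  Expectations of polynomials converge along the whole sequence, so the subsequence merely
  identifies their limits.

  One compactness statement serves twice: with the d coordinates as index set it produces limit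
  permutons, with the countable set of patterns as index set it produces limit laws of density
  vectors. These laws live on the compact image of \<Phi>, and the inverse of \<Phi> carries them
  back to random permutons.

  Sizes start at 1, so nothing is known about the space \<open>M 0\<close>; where every member of a
  sequence of laws must be a probability, the index is shifted to \<open>Suc n\<close>.\<close>

lemma prob_space_eqI_continuous:
  fixes M N :: "'a::metric_space measure"
  assumes M: "prob_space M" "sets M = sets borel" and N: "prob_space N" "sets N = sets borel"
    and eq: "\<And>f :: 'a \<Rightarrow> real. continuous_on UNIV f \<Longrightarrow> (\<And>x. 0 \<le> f x \<and> f x \<le> 1) \<Longrightarrow>
      (LINT x|M. f x) = (LINT x|N. f x)"
  shows "M = N"
proof (rule measure_eqI_generator_eq[where \<Omega> = UNIV and E = "Collect closed" and A = "\<lambda>_. UNIV"])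
  interpret M: prob_space M by fact
  interpret N: prob_space N by fact
  \<comment> \<open>These tent functions are continuous with values in [0,1] and decrease to the
    indicator of the closed set \<open>A\<close>. So the hypothesis fixes the measure of closed
    sets, an intersection-stable generator. \<open>A\<close> has to be nonempty because
    \<open>infdist\<close> to the empty set is 0.\<close>
  have conv: "(\<lambda>n. LINT x|K. max 0 (1 - real n * infdist x A)) \<longlonglongrightarrow> measure K A"
    if K: "prob_space K" "sets K = sets borel" and A: "closed A" "A \<noteq> {}" for K :: "'a measure" and A
  proof -
    interpret K: prob_space K by fact
    have *: "(\<lambda>n. LINT x|K. max 0 (1 - real n * infdist x A)) \<longlonglongrightarrow> (LINT x|K. indicator A x)"
    proof (rule integral_dominated_convergence[where w = "\<lambda>_. 1"])
      show "AE x in K. (\<lambda>n. max 0 (1 - real n * infdist x A)) \<longlonglongrightarrow> indicator A x"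
      proof (intro always_eventually allI)
        fix x
        show "(\<lambda>n. max 0 (1 - real n * infdist x A)) \<longlonglongrightarrow> indicator A x"
        proof (cases "x \<in> A")
          case True then show ?thesis by (simp add: infdist_zero)
        next
          case False
          then have pos: "infdist x A > 0"
            using A by (metis in_closed_iff_infdist_zero infdist_nonneg less_eq_real_def)
          obtain m :: nat where m: "1 / infdist x A < real m" using reals_Archimedean2 by blast
          have "\<forall>\<^sub>F n in sequentially. max 0 (1 - real n * infdist x A) = 0"
          proof (rule eventually_sequentiallyI[of m])
            fix n assume "m \<le> n"
            then have "1 / infdist x A \<le> real n" using m by linarith
            then show "max 0 (1 - real n * infdist x A) = 0" using pos by (simp add: field_simps)
          qed
          then show ?thesis using False by (simp add: tendsto_eventually)
        qed
      qed
      show "AE x in K. norm (max 0 (1 - real n * infdist x A)) \<le> 1" for n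
        by (intro always_eventually allI) (simp add: infdist_nonneg)
      have "A \<in> sets borel" using A by (intro borel_closed)
      then show "indicat_real A \<in> borel_measurable K"
        using K(2) by simp
      show "(\<lambda>x. max 0 (1 - real n * infdist x A)) \<in> borel_measurable K" for n
        unfolding measurable_cong_sets[OF K(2) refl]
        by (intro borel_measurable_continuous_onI continuous_intros)
    qed auto
    then show ?thesis
      using K(2) A(1) by (simp add: sets_eq_imp_space_eq)
  qed
  have meas: "measure M A = measure N A" if "closed A" for A
  proof (cases "A = {}")
    case False
    have "(LINT x|M. max 0 (1 - real n * infdist x A)) = (LINT x|N. max 0 (1 - real n * infdist x A))" for n
      by (rule eq) (auto intro!: continuous_intros simp: infdist_nonneg)
    with conv[OF M that False] conv[OF N that False] show ?thesis
      using LIMSEQ_unique by auto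
  qed simp
  show "emeasure M X = emeasure N X" if "X \<in> Collect closed" for X
    using meas[of X] that by (simp add: M.emeasure_eq_measure N.emeasure_eq_measure)
  show "Int_stable (Collect closed)" by (auto simp: Int_stable_def)
  show "sets M = sigma_sets UNIV (Collect closed)" "sets N = sigma_sets UNIV (Collect closed)"
    using M N by (simp_all add: borel_eq_closed)
  show "emeasure M UNIV \<noteq> \<infinity>" by (simp add: M.emeasure_eq_measure)
qed auto

text \<open>The truncated distance to \<open>F\<close> is bounded and continuous and integrates to 0
  under every \<open>M n\<close>, hence also under \<open>N\<close>; a nonnegative function with
  integral 0 vanishes almost everywhere.\<close>

lemma AE_closed_weak_limit:
  fixes M :: "nat \<Rightarrow> 'a::metric_space measure"
  assumes N: "prob_space N" "sets N = sets borel" and F: "closed F"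
    and M: "\<And>n. AE x in M n. x \<in> F"
    and conv: "\<And>f :: 'a \<Rightarrow> real. continuous_on UNIV f \<Longrightarrow> bounded (range f) \<Longrightarrow>
      (\<lambda>n. LINT x|M n. f x) \<longlonglongrightarrow> (LINT x|N. f x)"
  shows "AE x in N. x \<in> F"
proof -
  interpret N: prob_space N by fact
  \<comment> \<open>For empty \<open>F\<close> the distance is 0 by convention and would detect
    nothing, so the constant 1 takes its place.\<close>
  define f where "f x = (if F = {} then 1 else min 1 (infdist x F))" for x
  have cont: "continuous_on UNIV f"
    unfolding f_def by (cases "F = {}") (auto intro!: continuous_intros)
  have f01: "0 \<le> f x" "f x \<le> 1" for x unfolding f_def by (auto simp: infdist_nonneg)
  then have bdd: "bounded (range f)" by (intro boundedI[where B = 1]) auto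
  have "(LINT x|M n. f x) = 0" for n
  proof (rule integral_eq_zero_AE)
    show "AE x in M n. f x = 0" using M[of n]
      by eventually_elim (auto simp: f_def infdist_zero)
  qed
  then have "(LINT x|N. f x) = 0"
    using conv[OF cont bdd] by (simp add: LIMSEQ_const_iff)
  moreover have "integrable N f"
    using f01 cont N(2)
    by (intro N.integrable_const_bound[where B = 1])
      (auto simp: measurable_cong_sets[OF N(2) refl] intro: borel_measurable_continuous_onI)
  ultimately have "AE x in N. f x = 0"
    using f01 by (subst (asm) integral_nonneg_eq_0_iff_AE) auto
  then show ?thesis
  proof eventually_elim
    case (elim x)
    then show ?case using F
      by (auto simp: f_def min_def in_closed_iff_infdist_zero split: if_splits)
  qed
qed

text \<open>Tychonoff, transferred to the type class topology on functions.\<close>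

lemma compact_PiE_UNIV:
  fixes S :: "'i \<Rightarrow> 'a::topological_space set"
  assumes "\<And>i. compact (S i)"
  shows "compact (Pi\<^sub>E UNIV S)"
proof -
  have "compactin (product_topology (\<lambda>_. euclidean) UNIV) (Pi\<^sub>E UNIV S)"
    using assms by (auto simp: compactin_PiE)
  then show ?thesis by (simp add: euclidean_product_topology)
qed

lemma continuous_on_suminf_bounded:
  fixes f :: "nat \<Rightarrow> 'a::topological_space \<Rightarrow> real"
  assumes "\<And>n. continuous_on S (f n)" "\<And>n x. x \<in> S \<Longrightarrow> \<bar>f n x\<bar> \<le> M n" "summable M"
  shows "continuous_on S (\<lambda>x. \<Sum>n. f n x)"
proof (rule uniform_limit_theorem)
  show "uniform_limit S (\<lambda>n x. \<Sum>i<n. f i x) (\<lambda>x. \<Sum>n. f n x) sequentially"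
    using assms(2,3) by (intro Weierstrass_m_test) auto
  show "\<forall>\<^sub>F n in sequentially. continuous_on S (\<lambda>x. \<Sum>i<n. f i x)"
    using assms(1) by (intro always_eventually allI continuous_on_sum)
qed simp

text \<open>The partial sums are the dyadic truncations
  \<open>\<lfloor>2 ^ n * t\<rfloor> / 2 ^ n\<close>. Digit 0 is the integer part, so that the right
  end t = 1 of the unit interval is covered as well.\<close>

lemma binary_digits_sums:
  fixes t :: real
  assumes "0 \<le> t" "t < 2"
  shows "(\<lambda>j. of_int (\<lfloor>2 ^ j * t\<rfloor> mod 2) / 2 ^ j) sums t"
proof -
  have partial: "(\<Sum>j\<le>n. of_int (\<lfloor>2 ^ j * t\<rfloor> mod 2) / 2 ^ j) = of_int \<lfloor>2 ^ n * t\<rfloor> / (2 ^ n :: real)" for n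
  proof (induction n)
    case 0
    have "\<lfloor>t\<rfloor> = 0 \<or> \<lfloor>t\<rfloor> = 1" using assms by linarith
    then show ?case by auto
  next
    case (Suc n)
    define X where "X = \<lfloor>2 ^ Suc n * t\<rfloor>"
    define Y where "Y = \<lfloor>2 ^ n * t\<rfloor>"
    have "\<lfloor>(2 ^ Suc n * t) / of_int 2\<rfloor> = X div 2"
      unfolding X_def by (rule floor_divide_real_eq_div) simp
    moreover have "(2 ^ Suc n * t) / of_int 2 = 2 ^ n * t" by simp
    ultimately have "X = 2 * Y + X mod 2"
      unfolding Y_def by (metis mult_div_mod_eq)
    then have "real_of_int X = 2 * of_int Y + of_int (X mod 2)"
      by (metis of_int_add of_int_mult of_int_numeral)
    then have "of_int Y / 2 ^ n + of_int (X mod 2) / 2 ^ Suc n = of_int X / (2 ^ Suc n :: real)"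
      by (simp add: add_divide_distrib)
    then show ?case
      using Suc.IH unfolding X_def Y_def sum.atMost_Suc by simp
  qed
  have "(\<lambda>n. of_int \<lfloor>2 ^ n * t\<rfloor> / (2 ^ n :: real)) \<longlonglongrightarrow> t"
  proof (rule Lim_transform[of "\<lambda>_. t"])
    have *: "\<bar>of_int \<lfloor>2 ^ n * t\<rfloor> / (2 ^ n :: real) - t\<bar> \<le> (1 / 2) ^ n" for n
    proof -
      define y where "y = 2 ^ n * t"
      have "\<bar>of_int \<lfloor>y\<rfloor> - y\<bar> \<le> 1" by linarith
      then have "\<bar>of_int \<lfloor>y\<rfloor> - y\<bar> / 2 ^ n \<le> 1 / 2 ^ n"
        by (rule divide_right_mono) simp
      moreover have "of_int \<lfloor>y\<rfloor> / 2 ^ n - t = (of_int \<lfloor>y\<rfloor> - y) / 2 ^ n"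
        by (simp add: y_def diff_divide_distrib)
      moreover have "\<bar>(of_int \<lfloor>y\<rfloor> - y) / 2 ^ n\<bar> = \<bar>of_int \<lfloor>y\<rfloor> - y\<bar> / 2 ^ n"
        unfolding abs_divide by simp
      ultimately show ?thesis by (simp only: y_def power_one_over)
    qed
    show "(\<lambda>n. of_int \<lfloor>2 ^ n * t\<rfloor> / (2 ^ n :: real) - t) \<longlonglongrightarrow> 0"
    proof (rule Lim_null_comparison)
      show "\<forall>\<^sub>F n in sequentially. norm (of_int \<lfloor>2 ^ n * t\<rfloor> / (2 ^ n :: real) - t) \<le> (1 / 2) ^ n"
        unfolding real_norm_def by (intro always_eventually allI *)
      show "(\<lambda>n. (1 / 2 :: real) ^ n) \<longlonglongrightarrow> 0" by (rule LIMSEQ_realpow_zero) auto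
    qed
  qed simp
  then have "(\<lambda>n. \<Sum>j\<le>n. of_int (\<lfloor>2 ^ j * t\<rfloor> mod 2) / (2 ^ j :: real)) \<longlonglongrightarrow> t"
    unfolding partial .
  then show ?thesis unfolding sums_def_le .
qed

section \<open>Coding points of a countable cube by a Cantor set\<close>

abbreviation bit_seqs :: "(nat \<Rightarrow> real) set" where
  "bit_seqs \<equiv> Pi\<^sub>E UNIV (\<lambda>_. {0, 1})"

definition cantor_code :: "(nat \<Rightarrow> real) \<Rightarrow> real" where
  "cantor_code b = (\<Sum>n. b n / 4 ^ n)"

lemma summable_quarter: "summable (\<lambda>n. 1 / 4 ^ n :: real)"
  using summable_geometric[of "1/4 :: real"] by (simp add: power_one_over)

lemma summable_cantor_code:
  assumes "\<And>n. \<bar>b n\<bar> \<le> (1::real)"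
  shows "summable (\<lambda>n. b n / 4 ^ n)"
  by (rule summable_comparison_test[OF _ summable_quarter])
    (use assms in \<open>auto simp: abs_mult divide_right_mono intro!: exI[of _ 0]\<close>)

lemma continuous_on_cantor_code: "continuous_on bit_seqs cantor_code"
  unfolding cantor_code_def
proof (rule continuous_on_suminf_bounded[OF _ _ summable_quarter])
  show "continuous_on bit_seqs (\<lambda>b. b n / 4 ^ n)" for n :: nat
    by (intro continuous_intros continuous_on_subset[OF continuous_on_product_coordinates]) auto
  show "\<bar>x n / 4 ^ n\<bar> \<le> 1 / 4 ^ n" if "x \<in> bit_seqs" for n x
    using PiE_mem[OF that, of n] by (auto simp: divide_right_mono)
qed

text \<open>At the first index n where two sequences differ, the term has size 1/4^n, while all
  later terms together contribute at most a third of that. In base 2 the tail could cancel the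
  leading term.\<close>

lemma inj_on_cantor_code: "inj_on cantor_code bit_seqs"
proof (rule inj_onI, rule ccontr)
  fix b b' :: "nat \<Rightarrow> real"
  assume b: "b \<in> bit_seqs" and b': "b' \<in> bit_seqs" and eq: "cantor_code b = cantor_code b'" and "b \<noteq> b'"
  define D where "D n = b n - b' n" for n
  have D: "D n \<in> {-1, 0, 1}" for n
    using PiE_mem[OF b, of n] PiE_mem[OF b', of n] by (auto simp: D_def)
  have D1: "\<bar>D n\<bar> \<le> 1" for n using D[of n] by auto
  define n where "n = (LEAST n. D n \<noteq> 0)"
  have "\<exists>n. D n \<noteq> 0" using \<open>b \<noteq> b'\<close> by (auto simp: D_def fun_eq_iff)
  then have Dn: "D n \<noteq> 0" unfolding n_def by (rule LeastI_ex)
  have less: "D i = 0" if "i < n" for i using not_less_Least[OF that[unfolded n_def]] by simp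
  have s: "summable (\<lambda>n. D n / 4 ^ n)" by (rule summable_cantor_code[OF D1])
  have "cantor_code b - cantor_code b' = (\<Sum>n. D n / 4 ^ n)"
  proof -
    have "\<bar>b n\<bar> \<le> 1" "\<bar>b' n\<bar> \<le> 1" for n
      using PiE_mem[OF b, of n] PiE_mem[OF b', of n] by auto
    then have "summable (\<lambda>n. b n / 4 ^ n)" "summable (\<lambda>n. b' n / 4 ^ n)"
      by (simp_all add: summable_cantor_code)
    from suminf_diff[OF this] show ?thesis
      by (simp add: cantor_code_def D_def diff_divide_distrib)
  qed
  with eq have "0 = (\<Sum>n. D n / 4 ^ n)" by simp
  also have "\<dots> = (\<Sum>i. D (i + Suc n) / 4 ^ (i + Suc n)) + (\<Sum>i<Suc n. D i / 4 ^ i)"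
    by (rule suminf_split_initial_segment[OF s])
  also have "(\<Sum>i<Suc n. D i / 4 ^ i) = D n / 4 ^ n" using less by simp
  finally have "D n / 4 ^ n = - (\<Sum>i. D (i + Suc n) / 4 ^ (i + Suc n))"
    by (metis add.commute eq_neg_iff_add_eq_0)
  moreover have "\<bar>D n\<bar> = 1" using D[of n] Dn by auto
  ultimately have "1 / 4 ^ n = \<bar>\<Sum>i. D (i + Suc n) / 4 ^ (i + Suc n)\<bar>"
    by (metis abs_divide abs_minus_cancel abs_numeral power_abs)
  also have "\<dots> \<le> (\<Sum>i. 1 / 4 ^ (i + Suc n))"
  proof (rule order.trans[OF summable_rabs])
    have le: "\<bar>D (i + Suc n) / 4 ^ (i + Suc n)\<bar> \<le> 1 / 4 ^ (i + Suc n)" for i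
      unfolding abs_divide using D1[of "i + Suc n"] by (simp add: divide_right_mono)
    have s4: "summable (\<lambda>i. 1 / 4 ^ (i + Suc n) :: real)"
      by (rule summable_ignore_initial_segment[OF summable_quarter])
    show sa: "summable (\<lambda>i. \<bar>D (i + Suc n) / 4 ^ (i + Suc n)\<bar>)"
      by (rule summable_comparison_test[OF _ s4]) (use le in auto)
    show "(\<Sum>i. \<bar>D (i + Suc n) / 4 ^ (i + Suc n)\<bar>) \<le> (\<Sum>i. 1 / 4 ^ (i + Suc n))"
      by (rule suminf_le[OF le sa s4])
  qed
  also have "\<dots> = (1 / 3) / 4 ^ n"
  proof -
    have "(\<lambda>i. (1/4) ^ i * (1 / 4 ^ Suc n)) sums (1 / (1 - 1/4) * (1 / 4 ^ Suc n) :: real)"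
      by (intro sums_mult2 geometric_sums) simp
    moreover have "(1/4) ^ i * (1 / 4 ^ Suc n) = (1 / 4 ^ (i + Suc n) :: real)" for i
      by (simp only: power_one_over power_add times_divide_times_eq mult_1)
    moreover have "1 / (1 - 1/4) * (1 / 4 ^ Suc n) = ((1 / 3) / 4 ^ n :: real)" by simp
    ultimately have "(\<lambda>i. 1 / 4 ^ (i + Suc n)) sums ((1 / 3) / 4 ^ n :: real)" by simp
    then show ?thesis by (rule sums_unique[symmetric])
  qed
  finally show False by (simp add: divide_simps)
qed

definition bit_decode :: "(nat \<Rightarrow> real) \<Rightarrow> 'i::countable \<Rightarrow> real" where
  "bit_decode b i = (\<Sum>j. b (prod_encode (to_nat i, j)) / 2 ^ j)"

text \<open>All coordinates share one bit sequence through the pairing function. The encoding jumps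
  at dyadic values and only has to be measurable; continuity is required of
  \<open>bit_decode\<close> alone.\<close>

definition bit_encode :: "('i::countable \<Rightarrow> real) \<Rightarrow> nat \<Rightarrow> real" where
  "bit_encode x n = of_int (\<lfloor>2 ^ snd (prod_decode n) * x (from_nat (fst (prod_decode n)))\<rfloor> mod 2)"

lemma continuous_on_bit_decode: "continuous_on bit_seqs (bit_decode :: _ \<Rightarrow> 'i::countable \<Rightarrow> real)"
proof (rule continuous_on_coordinatewise_then_product)
  fix i :: 'i
  have s: "summable (\<lambda>j. 1 / 2 ^ j :: real)"
    using summable_geometric[of "1/2 :: real"] by (simp add: power_one_over)
  show "continuous_on bit_seqs (\<lambda>b. bit_decode b i)"
    unfolding bit_decode_def
  proof (rule continuous_on_suminf_bounded[OF _ _ s])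
    show "continuous_on bit_seqs (\<lambda>b. b (prod_encode (to_nat i, j)) / 2 ^ j)" for j :: nat
      by (intro continuous_intros continuous_on_subset[OF continuous_on_product_coordinates]) auto
    show "\<bar>x (prod_encode (to_nat i, j)) / 2 ^ j\<bar> \<le> 1 / 2 ^ j" if "x \<in> bit_seqs" for j x
      using PiE_mem[OF that, of "prod_encode (to_nat i, j)"] by (auto simp: divide_right_mono)
  qed
qed

lemma bit_encode_in: "bit_encode x \<in> bit_seqs"
proof (rule PiE_I)
  show "bit_encode x n \<in> {0, 1}" for n
    unfolding bit_encode_def by (simp add: mod2_eq_if)
qed simp

lemma bit_decode_encode:
  assumes "\<And>i. x i \<in> {0..1}"
  shows "bit_decode (bit_encode x) = x"
proof
  fix i
  have "(\<lambda>j. of_int (\<lfloor>2 ^ j * x i\<rfloor> mod 2) / 2 ^ j) sums x i"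
    using assms[of i] by (intro binary_digits_sums) auto
  then show "bit_decode (bit_encode x) i = x i"
    unfolding bit_decode_def bit_encode_def by (simp add: sums_iff)
qed

lemma borel_measurable_product_coordinate:
  "(\<lambda>x. x i) \<in> borel_measurable (borel :: ('i::countable \<Rightarrow> 'a::second_countable_topology) measure)"
  by (intro borel_measurable_continuous_onI continuous_on_product_coordinates)

lemma measurable_cantor_bit_encode:
  "(\<lambda>x. cantor_code (bit_encode x)) \<in> borel_measurable (borel :: ('i::countable \<Rightarrow> real) measure)"
  unfolding cantor_code_def bit_encode_def
proof (rule borel_measurable_suminf)
  fix n :: nat
  let ?g = "\<lambda>t :: real. real_of_int (\<lfloor>2 ^ snd (prod_decode n) * t\<rfloor> mod 2) / 4 ^ n :: real"
  have "?g \<in> borel_measurable borel" by measurable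
  from measurable_compose[OF borel_measurable_product_coordinate this]
  show "(\<lambda>x. real_of_int (\<lfloor>2 ^ snd (prod_decode n) * x (from_nat (fst (prod_decode n)))\<rfloor> mod 2) / 4 ^ n)
    \<in> borel_measurable (borel :: ('i \<Rightarrow> real) measure)" .
qed

text \<open>
  Points of the cube are encoded in the Cantor-like compact set \<open>cantor_code ` bit_seqs\<close> of real
  numbers, from which they can be decoded continuously; Helly's theorem on the real line then
  yields compactness for laws on a countable product of unit intervals.
\<close>

theorem compact_laws_on_cube:
  fixes M :: "nat \<Rightarrow> ('i::countable \<Rightarrow> real) measure"
  assumes M: "\<And>n. prob_space (M n)" "\<And>n. sets (M n) = sets borel"
    and cube: "\<And>n. AE x in M n. \<forall>i. x i \<in> {0..1}"
  obtains r N where "strict_mono r" "prob_space N" "sets N = sets borel"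
    "\<And>f :: ('i \<Rightarrow> real) \<Rightarrow> real. continuous_on UNIV f \<Longrightarrow> bounded (range f) \<Longrightarrow>
      (\<lambda>n. LINT x|M (r n). f x) \<longlonglongrightarrow> (LINT x|N. f x)"
proof -
  define e :: "('i \<Rightarrow> real) \<Rightarrow> real" where "e x = cantor_code (bit_encode x)" for x
  define C where "C = cantor_code ` bit_seqs"
  define dec :: "real \<Rightarrow> 'i \<Rightarrow> real" where "dec t = bit_decode (the_inv_into bit_seqs cantor_code t)" for t
  \<comment> \<open>\<open>dec\<close> is continuous only on the compact set \<open>C\<close>. The
    constant off \<open>C\<close> makes it a Borel function on the line, and all laws involved live
    on \<open>C\<close>.\<close>
  define dec' where "dec' t = (if t \<in> C then dec t else (\<lambda>_. 0))" for t
  have compact_bits: "compact bit_seqs" by (rule compact_PiE_UNIV) simp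
  have compC: "compact C"
    unfolding C_def by (rule compact_continuous_image[OF continuous_on_cantor_code compact_bits])
  have closedC: "closed C" by (rule compact_imp_closed[OF compC])
  have inv: "the_inv_into bit_seqs cantor_code (cantor_code b) = b" if "b \<in> bit_seqs" for b
    by (rule the_inv_into_f_f[OF inj_on_cantor_code that])
  have cont_inv: "continuous_on C (the_inv_into bit_seqs cantor_code)"
    unfolding C_def
    by (rule continuous_on_inv[OF continuous_on_cantor_code compact_bits]) (intro ballI inv)
  have cont_dec: "continuous_on C dec"
    unfolding dec_def
    by (rule continuous_on_compose2[OF continuous_on_bit_decode cont_inv])
      (unfold C_def image_image, rule image_subsetI, simp only: inv)
  have e_in: "e x \<in> C" for x unfolding e_def C_def using bit_encode_in by blast
  have dec_e: "dec (e x) = x" if "\<And>i. x i \<in> {0..1}" for x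
    unfolding dec_def e_def inv[OF bit_encode_in] by (rule bit_decode_encode[OF that])
  have meas_e: "e \<in> borel_measurable borel" unfolding e_def by (rule measurable_cantor_bit_encode)
  then have meas_e': "e \<in> borel_measurable (M n)" for n
    by (simp add: measurable_cong_sets[OF M(2) refl])
  have meas_dec: "dec' \<in> borel_measurable borel"
    unfolding dec'_def
    by (rule borel_measurable_continuous_on_if) (simp_all add: closedC borel_closed cont_dec continuous_on_const)

  define L where "L n = distr (M n) borel e" for n
  have L: "real_distribution (L n)" for n
    unfolding L_def real_distribution_def real_distribution_axioms_def
    using prob_space.prob_space_distr[OF M(1) meas_e'] by simp
  interpret L: real_distribution "L n" for n by (rule L)
  have AE_L: "AE t in L n. t \<in> C" for n
    unfolding L_def by (subst AE_distr_iff[OF meas_e']) (simp_all add: closedC borel_closed e_in)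
  obtain K where K: "K > 0" "\<And>t. t \<in> C \<Longrightarrow> \<bar>t\<bar> \<le> K"
    using compact_imp_bounded[OF compC] bounded_pos by (metis real_norm_def)
  have "tight L"
    unfolding tight_def
  proof (intro conjI allI impI L)
    fix \<epsilon> :: real assume "\<epsilon> > 0"
    \<comment> \<open>All \<open>L n\<close> live in \<open>{-K..K}\<close>, so one interval serves
      every \<open>\<epsilon>\<close>; the margin 1 accommodates the open left end.\<close>
    have "measure (L n) {-(K+1)<..K+1} = 1" for n
    proof (subst L.prob_eq_1)
      show "AE t in L n. t \<in> {-(K+1)<..K+1}"
        using AE_L[of n] by eventually_elim (use K in fastforce)
    qed simp
    then show "\<exists>a b. a < b \<and> (\<forall>n. 1 - \<epsilon> < measure (L n) {a<..b})"
      using \<open>\<epsilon> > 0\<close> K(1) by (intro exI[of _ "-(K+1)"] exI[of _ "K+1"]) auto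
  qed
  from tight_imp_convergent_subsubsequence[OF this strict_mono_id]
  obtain r L' where r: "strict_mono r" and L': "real_distribution L'" and weak: "weak_conv_m (L \<circ> r) L'"
    by auto
  interpret L': real_distribution L' by fact
  have conv: "(\<lambda>n. LINT t|L (r n). f t) \<longlonglongrightarrow> (LINT t|L'. f t)"
    if f: "continuous_on UNIV f" "bounded (range f)" for f :: "real \<Rightarrow> real"
  proof -
    obtain B where "\<And>x. norm (f x) \<le> B" using f(2) by (auto simp: bounded_iff)
    moreover have "isCont f x" for x using f(1) by (simp add: continuous_on_eq_continuous_at)
    ultimately show ?thesis
      using weak_conv_imp_integral_bdd_continuous_conv[OF _ L' weak, of f B] L by simp
  qed
  have AE_L': "AE t in L'. t \<in> C"
    by (rule AE_closed_weak_limit[where M = "\<lambda>n. L (r n)"])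
      (use L'.prob_space_axioms closedC AE_L conv in auto)

  define N where "N = distr L' borel dec'"
  have meas_dec': "dec' \<in> borel_measurable L'" using meas_dec by simp
  show thesis
  proof (rule that[OF r])
    show "prob_space N" unfolding N_def by (rule L'.prob_space_distr[OF meas_dec'])
    show "sets N = sets borel" by (simp add: N_def)
    fix f :: "('i \<Rightarrow> real) \<Rightarrow> real"
    assume f: "continuous_on UNIV f" "bounded (range f)"
    then obtain B where B: "\<And>x. \<bar>f x\<bar> \<le> B" by (auto simp: bounded_iff)
    have fdec: "continuous_on C (f \<circ> dec)"
      by (intro continuous_on_compose cont_dec continuous_on_subset[OF f(1)]) auto
    \<comment> \<open>\<open>f \<circ> dec\<close> is defined on \<open>C\<close> only, whereas weak
      convergence on the line needs a test function that is continuous and bounded everywhere;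
      Tietze extends it within the same bound.\<close>
    obtain g where g: "continuous_on UNIV g" "\<And>t. t \<in> C \<Longrightarrow> g t = f (dec t)" "range g \<subseteq> {-B..B}"
    proof (rule Tietze_extension_closed_real_interval[of euclidean C "f \<circ> dec" "-B" B])
      show "normal_space (euclidean :: real topology)"
        by (simp add: metrizable_imp_normal_space metrizable_space_euclidean)
      show "(f \<circ> dec) ` C \<subseteq> {-B..B}" using B by (auto simp: abs_le_iff minus_le_iff)
      show "- B \<le> B" using B[of undefined] by linarith
    qed (use closedC fdec that in auto)
    have bg: "bounded (range g)" using g(3) by (rule bounded_subset[rotated]) simp
    have meas_f: "f \<in> borel_measurable borel" by (rule borel_measurable_continuous_onI[OF f(1)])
    have meas_g: "g \<in> borel_measurable borel" by (rule borel_measurable_continuous_onI[OF g(1)])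
    have "(LINT t|L n. g t) = (LINT x|M n. f x)" for n
    proof -
      have "(LINT t|L n. g t) = (LINT x|M n. g (e x))"
        unfolding L_def by (rule integral_distr[OF meas_e' meas_g])
      also have "\<dots> = (LINT x|M n. f x)"
      proof (rule integral_cong_AE)
        show "AE x in M n. g (e x) = f x"
          using cube[of n] by eventually_elim (simp add: g(2)[OF e_in] dec_e)
        show "f \<in> borel_measurable (M n)"
          using meas_f by (simp add: measurable_cong_sets[OF M(2) refl])
        show "(\<lambda>x. g (e x)) \<in> borel_measurable (M n)"
          by (rule measurable_compose[OF meas_e' meas_g])
      qed
      finally show ?thesis .
    qed
    moreover have "(LINT t|L'. g t) = (LINT x|N. f x)"
    proof -
      have "(LINT x|N. f x) = (LINT t|L'. f (dec' t))"
        unfolding N_def by (rule integral_distr[OF meas_dec' meas_f])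
      also have "\<dots> = (LINT t|L'. g t)"
      proof (rule integral_cong_AE)
        show "AE t in L'. f (dec' t) = g t"
          using AE_L' by eventually_elim (simp add: dec'_def g(2))
      qed (use meas_g measurable_compose[OF meas_dec' meas_f] in auto)
      finally show ?thesis ..
    qed
    ultimately show "(\<lambda>n. LINT x|M (r n). f x) \<longlonglongrightarrow> (LINT x|N. f x)"
      using conv[OF g(1) bg] by simp
  qed
qed

section \<open>Standardisation and patterns\<close>

text \<open>\<open>p\<close> maps the indices with value at most \<open>p a\<close> bijectively onto
  \<open>{1..p a}\<close>. A permutation is thus its own rank function and is determined by its
  order relation.\<close>

lemma permutes_eq_card_le:
  assumes "p permutes {1..k::nat}" "a \<in> {1..k}"
  shows "card {b \<in> {1..k}. p b \<le> p a} = p a"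
proof -
  have "p ` {b \<in> {1..k}. p b \<le> p a} = {1..p a}"
  proof (rule set_eqI, rule iffI)
    fix y assume "y \<in> {1..p a}"
    moreover have "p a \<in> {1..k}" using permutes_in_image[OF assms(1)] assms(2) by blast
    ultimately have y: "y \<in> {1..k}" "y \<le> p a" by auto
    then obtain b where "b \<in> {1..k}" "y = p b"
      using permutes_image[OF assms(1)] by blast
    with y show "y \<in> p ` {b \<in> {1..k}. p b \<le> p a}" by blast
  next
    fix y assume "y \<in> p ` {b \<in> {1..k}. p b \<le> p a}"
    then show "y \<in> {1..p a}"
      using permutes_in_image[OF assms(1)] by fastforce
  qed
  moreover have "inj_on p {b \<in> {1..k}. p b \<le> p a}"
    using permutes_inj[OF assms(1)] by (rule inj_on_subset) simp
  ultimately show ?thesis by (metis card_image card_atLeastAtMost diff_Suc_1)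
qed

text \<open>The common core of the descriptions in \<open>pat\<close> and \<open>perm_of\<close>:
  the former has this shape outright, the latter after relabelling the points by rank in the first
  coordinate.\<close>

definition same_order :: "nat \<Rightarrow> 'e::finite dperm \<Rightarrow> (nat \<Rightarrow> 'e \<Rightarrow> 'b::linorder) \<Rightarrow> bool" where
  "same_order k \<tau> w \<longleftrightarrow> psize \<tau> = k \<and>
     (\<forall>a\<in>{1..k}. \<forall>b\<in>{1..k}. \<forall>j. papp \<tau> a $ j < papp \<tau> b $ j \<longleftrightarrow> w a j < w b j)"

lemma same_order_unique:
  assumes "same_order k \<tau> w" "same_order k \<tau>' w"
  shows "\<tau> = \<tau>'"
proof (rule dperm_eqI)
  show "psize \<tau> = psize \<tau>'" using assms by (simp add: same_order_def)
  fix a j assume a: "a \<in> {1..psize \<tau>}"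
  have "{b \<in> {1..k}. papp \<tau> b $ j \<le> papp \<tau> a $ j} = {b \<in> {1..k}. papp \<tau>' b $ j \<le> papp \<tau>' a $ j}"
    using assms a unfolding same_order_def by (auto simp: not_less[symmetric])
  then show "papp \<tau> a $ j = papp \<tau>' a $ j"
    using permutes_eq_card_le[OF papp_permutes, of a \<tau> j] permutes_eq_card_le[OF papp_permutes, of a \<tau>' j]
      assms a unfolding same_order_def by simp
qed

lemma rank_bij:
  fixes w :: "nat \<Rightarrow> 'b::linorder"
  assumes "inj_on w {1..k}"
  defines "r \<equiv> \<lambda>a. card {b \<in> {1..k}. w b \<le> w a}"
  shows "bij_betw r {1..k} {1..k}"
    and "\<And>a b. a \<in> {1..k} \<Longrightarrow> b \<in> {1..k} \<Longrightarrow> r a < r b \<longleftrightarrow> w a < w b"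
proof -
  have mono: "r a < r b" if "a \<in> {1..k}" "b \<in> {1..k}" "w a < w b" for a b
  proof -
    have "b \<in> {b' \<in> {1..k}. w b' \<le> w b} - {b' \<in> {1..k}. w b' \<le> w a}" using that by auto
    moreover have "{b' \<in> {1..k}. w b' \<le> w a} \<subseteq> {b' \<in> {1..k}. w b' \<le> w b}" using that by auto
    ultimately show ?thesis unfolding r_def by (intro psubset_card_mono) auto
  qed
  show iff: "r a < r b \<longleftrightarrow> w a < w b" if "a \<in> {1..k}" "b \<in> {1..k}" for a b
    using mono[OF that] mono[OF that(2,1)] inj_onD[OF assms(1), of a b] that
    by (metis less_asym' linorder_less_linear)
  have "inj_on r {1..k}"
    using iff assms(1) by (intro inj_onI) (metis inj_onD linorder_less_linear less_irrefl)
  moreover have "r a \<in> {1..k}" if "a \<in> {1..k}" for a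
  proof -
    have "card {a} \<le> r a" unfolding r_def using that by (intro card_mono) auto
    moreover have "r a \<le> card {1..k}" unfolding r_def by (intro card_mono) auto
    ultimately show ?thesis by simp
  qed
  ultimately show "bij_betw r {1..k} {1..k}"
    using endo_inj_surj[of "{1..k}" r] by (metis bij_betw_def finite_atLeastAtMost image_subsetI)
qed

lemma same_order_exists:
  fixes w :: "nat \<Rightarrow> 'e::finite \<Rightarrow> 'b::linorder"
  assumes "k \<ge> 1" "\<And>j. inj_on (\<lambda>a. w a j) {1..k}"
  shows "\<exists>\<tau>. same_order k \<tau> w"
proof -
  define r where "r a j = card {b \<in> {1..k}. w b j \<le> w a j}" for a j
  \<comment> \<open>The ranks are the only possible values inside \<open>{1..k}\<close>; outside,
    \<open>permutes\<close> demands the identity.\<close>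
  define s :: "nat \<Rightarrow> nat ^ 'e" where "s i = (\<chi> j. if i \<in> {1..k} then r i j else i)" for i
  note r = rank_bij[OF assms(2), folded r_def]
  have "(\<lambda>i. s i $ j) permutes {1..k}" for j
  proof (rule bij_imp_permutes)
    have "bij_betw (\<lambda>i. s i $ j) {1..k} {1..k} \<longleftrightarrow> bij_betw (\<lambda>i. r i j) {1..k} {1..k}"
      by (rule bij_betw_cong) (simp add: s_def)
    then show "bij_betw (\<lambda>i. s i $ j) {1..k} {1..k}" using r(1) by simp
  qed (auto simp: s_def)
  then have "(k, s) \<in> {(n, s). 1 \<le> n \<and> (\<forall>j. (\<lambda>i. s i $ j) permutes {1..n})}"
    using assms(1) by simp
  from Abs_dperm_inverse[OF this] have "psize (Abs_dperm (k, s)) = k" "papp (Abs_dperm (k, s)) = s"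
    by (simp_all add: psize_def papp_def)
  then have "same_order k (Abs_dperm (k, s)) w"
    using r(2) unfolding same_order_def s_def by simp
  then show ?thesis ..
qed

lemma The_same_order:
  assumes "same_order k \<tau> w"
  shows "(THE \<tau>. same_order k \<tau> w) = \<tau>"
  using assms same_order_unique by blast

lemma finite_dperms: "finite {\<sigma> :: 'e::finite dperm. psize \<sigma> = k}"
proof (rule finite_imageD)
  let ?f = "\<lambda>(\<sigma> :: 'e dperm) j i. papp \<sigma> i $ j"
  have "?f ` {\<sigma>. psize \<sigma> = k} \<subseteq> Pi\<^sub>E UNIV (\<lambda>_. {p. p permutes {1..k}})"
    using papp_permutes by fastforce
  then show "finite (?f ` {\<sigma>. psize \<sigma> = k})"
    by (rule finite_subset) (auto intro!: finite_PiE finite_permutations)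
  show "inj_on ?f {\<sigma>. psize \<sigma> = k}"
    by (rule inj_onI, rule dperm_eqI) (simp, metis)
qed

lemma countable_UNIV_dperm: "countable (UNIV :: 'e::finite dperm set)"
proof -
  have "UNIV = (\<Union>k. {\<sigma> :: 'e dperm. psize \<sigma> = k})" by auto
  then show ?thesis
    by (metis countable_UN countable_finite countableI_type finite_dperms)
qed

text \<open>Countability turns \<open>'e dperm \<Rightarrow> real\<close> into a countable product,
  a metric space to which \<open>compact_laws_on_cube\<close> applies.\<close>

instance dperm :: (finite) countable
  by standard (use countable_UNIV_dperm in \<open>auto simp: countable_def\<close>)

text \<open>Distinct elements of \<open>I\<close> have distinct values in every coordinate, so
  exactly one permutation meets the description in \<open>pat\<close>.\<close>

lemma pat_same_order:
  assumes "I \<subseteq> {1..psize \<sigma>}" "card I \<ge> 1"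
  shows "same_order (card I) (pat I \<sigma>) (\<lambda>a j. papp \<sigma> (sorted_list_of_set I ! (a - 1)) $ j)"
proof -
  let ?w = "\<lambda>a j. papp \<sigma> (sorted_list_of_set I ! (a - 1)) $ j"
  have fin: "finite I" using assms(1) by (rule finite_subset) simp
  have "inj_on (\<lambda>a. ?w a j) {1..card I}" for j
  proof (rule inj_onI)
    fix a b assume ab: "a \<in> {1..card I}" "b \<in> {1..card I}" and "?w a j = ?w b j"
    then have "sorted_list_of_set I ! (a - 1) = sorted_list_of_set I ! (b - 1)"
      using permutes_inj[OF papp_permutes, of \<sigma> j] by (metis injD)
    moreover have "a - 1 < length (sorted_list_of_set I)" "b - 1 < length (sorted_list_of_set I)"
      using ab fin by auto
    ultimately have "a - 1 = b - 1"
      using nth_eq_iff_index_eq[OF distinct_sorted_list_of_set] by metis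
    then show "a = b" using ab by auto
  qed
  from same_order_exists[OF assms(2), of ?w, OF this] obtain \<tau> where "same_order (card I) \<tau> ?w" by blast
  moreover from this have "pat I \<sigma> = \<tau>"
    unfolding pat_def by (subst same_order_def[symmetric]) (rule The_same_order)
  ultimately show ?thesis by simp
qed

section \<open>Samples without ties\<close>

definition tie_free :: "nat \<Rightarrow> (nat \<Rightarrow> real ^ 'd::finite) \<Rightarrow> bool" where
  "tie_free k x \<longleftrightarrow> (\<forall>a\<in>{1..k}. \<forall>b\<in>{1..k}. \<forall>c. a \<noteq> b \<longrightarrow> x a $ c \<noteq> x b $ c)"

lemma coord_rank_bij:
  assumes "tie_free k x"
  shows "bij_betw (coord_rank k x) {1..k} {1..k}"
    and "\<And>a b. a \<in> {1..k} \<Longrightarrow> b \<in> {1..k} \<Longrightarrow>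
      coord_rank k x a < coord_rank k x b \<longleftrightarrow> x a $ None < x b $ None"
proof -
  have "inj_on (\<lambda>a. x a $ None) {1..k}"
    using assms unfolding tie_free_def inj_on_def by blast
  note r = rank_bij[OF this]
  show "bij_betw (coord_rank k x) {1..k} {1..k}"
    using r(1) unfolding coord_rank_def[abs_def] .
  show "coord_rank k x a < coord_rank k x b \<longleftrightarrow> x a $ None < x b $ None"
    if "a \<in> {1..k}" "b \<in> {1..k}" for a b
    using r(2)[OF that] unfolding coord_rank_def .
qed

lemma perm_of_eqI:
  assumes x: "tie_free k x" and \<tau>: "psize \<tau> = k"
    and "\<And>a b j. a \<in> {1..k} \<Longrightarrow> b \<in> {1..k} \<Longrightarrow>
      papp \<tau> (coord_rank k x a) $ j < papp \<tau> (coord_rank k x b) $ j \<longleftrightarrow> x a $ Some j < x b $ Some j"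
  shows "perm_of k x = \<tau>"
  unfolding perm_of_def
proof (rule the_equality)
  \<comment> \<open>\<open>g a\<close> is the label of the point with the \<open>a\<close>-th
    smallest first coordinate. Composing with it turns the description of \<open>perm_of\<close>
    into a \<open>same_order\<close> condition, which has a unique solution.\<close>
  define g where "g = inv_into {1..k} (coord_rank k x)"
  have g: "coord_rank k x (g a) = a" "g a \<in> {1..k}" if "a \<in> {1..k}" for a
    using that bij_betw_inv_into_right[OF coord_rank_bij(1)[OF x]]
      bij_betw_apply[OF bij_betw_inv_into[OF coord_rank_bij(1)[OF x]]]
    unfolding g_def by auto
  have so: "same_order k \<rho> (\<lambda>a j. x (g a) $ Some j)"
    if "psize \<rho> = k" "\<And>a b j. a \<in> {1..k} \<Longrightarrow> b \<in> {1..k} \<Longrightarrow>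
      papp \<rho> (coord_rank k x a) $ j < papp \<rho> (coord_rank k x b) $ j \<longleftrightarrow> x a $ Some j < x b $ Some j"
    for \<rho> :: "'a dperm"
    unfolding same_order_def using that(1) that(2)[OF g(2) g(2)] g(1) by simp
  show "psize \<tau> = k \<and> (\<forall>a\<in>{1..k}. \<forall>b\<in>{1..k}. \<forall>j.
      papp \<tau> (coord_rank k x a) $ j < papp \<tau> (coord_rank k x b) $ j \<longleftrightarrow> x a $ Some j < x b $ Some j)"
    using assms(2,3) by blast
  show "\<rho> = \<tau>" if "psize \<rho> = k \<and> (\<forall>a\<in>{1..k}. \<forall>b\<in>{1..k}. \<forall>j.
      papp \<rho> (coord_rank k x a) $ j < papp \<rho> (coord_rank k x b) $ j \<longleftrightarrow> x a $ Some j < x b $ Some j)" for \<rho>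
    by (rule same_order_unique[OF so so]) (use that assms(2,3) in auto)
qed

lemma perm_of_spec:
  fixes x :: "nat \<Rightarrow> real ^ 'e::finite option"
  assumes x: "tie_free k x" and k: "k \<ge> 1"
  shows "psize (perm_of k x) = k"
    and "\<And>a b j. a \<in> {1..k} \<Longrightarrow> b \<in> {1..k} \<Longrightarrow>
      papp (perm_of k x) (coord_rank k x a) $ j < papp (perm_of k x) (coord_rank k x b) $ j
        \<longleftrightarrow> x a $ Some j < x b $ Some j"
proof -
  define f where "f = coord_rank k x"
  define g where "g = inv_into {1..k} f"
  note bij = coord_rank_bij(1)[OF x, folded f_def]
  have gf: "g (f a) = a" if "a \<in> {1..k}" for a
    unfolding g_def by (rule bij_betw_inv_into_left[OF bij that])
  have bij_g: "bij_betw g {1..k} {1..k}" unfolding g_def by (rule bij_betw_inv_into[OF bij])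
  have "inj_on (\<lambda>a. x (g a) $ Some j) {1..k}" for j
  proof (rule inj_onI)
    fix a b assume ab: "a \<in> {1..k}" "b \<in> {1..k}" "x (g a) $ Some j = x (g b) $ Some j"
    then have "g a = g b"
      using x bij_betw_apply[OF bij_g] unfolding tie_free_def by blast
    then show "a = b" using ab bij_g by (meson bij_betw_imp_inj_on inj_onD)
  qed
  from same_order_exists[OF k, of "\<lambda>a j. x (g a) $ Some j", OF this] obtain \<tau> :: "'e dperm"
    where \<tau>: "same_order k \<tau> (\<lambda>a j. x (g a) $ Some j)" by blast
  have spec: "psize \<tau> = k" "papp \<tau> (f a) $ j < papp \<tau> (f b) $ j \<longleftrightarrow> x a $ Some j < x b $ Some j"
    if "a \<in> {1..k}" "b \<in> {1..k}" for a b j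
    using \<tau> bij_betw_apply[OF bij that(1)] bij_betw_apply[OF bij that(2)] gf that
    unfolding same_order_def by auto
  have "psize \<tau> = k" using \<tau> by (simp add: same_order_def)
  then have "perm_of k x = \<tau>"
    by (rule perm_of_eqI[OF x]) (use spec(2) in \<open>simp add: f_def\<close>)
  with spec(2) \<open>psize \<tau> = k\<close> show "psize (perm_of k x) = k"
    "\<And>a b j. a \<in> {1..k} \<Longrightarrow> b \<in> {1..k} \<Longrightarrow>
      papp (perm_of k x) (coord_rank k x a) $ j < papp (perm_of k x) (coord_rank k x b) $ j
        \<longleftrightarrow> x a $ Some j < x b $ Some j"
    by (simp_all add: f_def)
qed

text \<open>Integer points that realise \<open>\<tau>\<close> and are already sorted by first
  coordinate. Order invariant functions are evaluated here to obtain their coefficient at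
  \<open>\<tau>\<close>.\<close>

definition canonical_points :: "'e::finite dperm \<Rightarrow> nat \<Rightarrow> real ^ 'e option" where
  "canonical_points \<tau> a = (\<chi> c. case c of None \<Rightarrow> real a | Some j \<Rightarrow> real (papp \<tau> a $ j))"

lemma tie_free_less_iff:
  assumes "tie_free k x" "k \<ge> 1" "a \<in> {1..k}" "b \<in> {1..k}"
  shows "x a $ c < x b $ c \<longleftrightarrow> canonical_points (perm_of k x) (coord_rank k x a) $ c
    < canonical_points (perm_of k x) (coord_rank k x b) $ c"
  using coord_rank_bij(2)[OF assms(1,3,4)] perm_of_spec(2)[OF assms]
  by (cases c) (simp_all add: canonical_points_def)

section \<open>Sampling from permutons\<close>

lemma permuton_prob_space: "\<mu> \<in> permutons \<Longrightarrow> prob_space \<mu>"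
  and permuton_sets: "\<mu> \<in> permutons \<Longrightarrow> sets \<mu> = sets (restrict_space borel (cbox 0 1))"
  by (simp_all add: permutons_def)

lemma permuton_space: "\<mu> \<in> permutons \<Longrightarrow> space \<mu> = cbox 0 1"
  using sets_eq_imp_space_eq[OF permuton_sets] by (simp add: space_restrict_space)

lemma measurable_permuton: "\<mu> \<in> permutons \<Longrightarrow> f \<in> borel \<rightarrow>\<^sub>M N \<Longrightarrow> f \<in> \<mu> \<rightarrow>\<^sub>M N"
  by (simp add: measurable_cong_sets[OF permuton_sets refl] measurable_restrict_space1)

lemma borel_measurable_coord [measurable]: "(\<lambda>x :: real ^ 'd::finite. x $ i) \<in> borel_measurable borel"
  by (intro borel_measurable_continuous_onI continuous_intros)

lemma measurable_permuton_coord: "\<mu> \<in> permutons \<Longrightarrow> (\<lambda>x. x $ i) \<in> borel_measurable \<mu>"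
  by (rule measurable_permuton) measurable

lemma measure_permuton_coord:
  assumes "\<mu> \<in> permutons" "A \<in> sets borel"
  shows "measure \<mu> {x \<in> space \<mu>. x $ i \<in> A} = measure lborel ({0..1} \<inter> A)"
proof -
  have "distr \<mu> borel (\<lambda>x. x $ i) = uniform_measure lborel {0..1}"
    using assms(1) by (simp add: permutons_def)
  then have "measure (distr \<mu> borel (\<lambda>x. x $ i)) A = measure (uniform_measure lborel {0..1}) A"
    by simp
  also have "measure (distr \<mu> borel (\<lambda>x. x $ i)) A = measure \<mu> {x \<in> space \<mu>. x $ i \<in> A}"
    by (subst measure_distr[OF measurable_permuton_coord[OF assms(1)] assms(2)])
      (auto intro!: arg_cong[where f = "measure \<mu>"])
  also have "measure (uniform_measure lborel {0..1}) A = measure lborel ({0..1} \<inter> A)"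
    using assms(2) by (subst measure_uniform_measure) auto
  finally show ?thesis .
qed

lemma measure_permuton_coord_less:
  assumes "\<mu> \<in> permutons" "t \<in> {0..1}"
  shows "measure \<mu> {x \<in> space \<mu>. x $ i < t} = t"
proof -
  have "{0..1} \<inter> {..<t} = {0..<t}" using assms(2) by auto
  then show ?thesis
    using measure_permuton_coord[OF assms(1), of "{..<t}" i] assms(2) by simp
qed

text \<open>The length of an interval bounds its mass because the marginal is uniform. The bound is
  the same for all permutons, which is what later turns pattern densities into uniform limits of
  continuous functions.\<close>

lemma measure_permuton_coord_near:
  assumes "\<mu> \<in> permutons" "\<delta> \<ge> 0"
  shows "measure \<mu> {x \<in> space \<mu>. \<bar>s - x $ i\<bar> < \<delta>} \<le> 2 * \<delta>"
proof -
  have "measure \<mu> {x \<in> space \<mu>. \<bar>s - x $ i\<bar> < \<delta>} = measure lborel ({0..1} \<inter> {s - \<delta> <..< s + \<delta>})"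
    by (subst measure_permuton_coord[OF assms(1), of _ i, symmetric])
      (auto intro!: arg_cong[where f = "measure \<mu>"])
  also have "\<dots> \<le> measure lborel {s - \<delta> <..< s + \<delta>}"
  proof (rule measure_mono_fmeasurable)
    show "{s - \<delta> <..< s + \<delta>} \<in> fmeasurable lborel"
      using assms(2) by (intro fmeasurableI) auto
  qed auto
  finally show ?thesis using assms(2) by simp
qed

lemma prob_space_PiM_const: "prob_space \<mu> \<Longrightarrow> prob_space (PiM I (\<lambda>_. \<mu>))"
  by (rule prob_space_PiM)

lemma distr_PiM_pair:
  assumes \<mu>: "prob_space \<mu>" and ab: "a \<in> I" "b \<in> I" "a \<noteq> b"
  shows "distr (PiM I (\<lambda>_. \<mu>)) (\<mu> \<Otimes>\<^sub>M \<mu>) (\<lambda>x. (x a, x b)) = \<mu> \<Otimes>\<^sub>M \<mu>"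
proof (rule pair_measure_eqI[symmetric])
  interpret prob_space \<mu> by fact
  interpret P: product_prob_space "\<lambda>_. \<mu>" I by unfold_locales
  show "sigma_finite_measure \<mu>" "sigma_finite_measure \<mu>" by unfold_locales
  fix A B assume AB: "A \<in> sets \<mu>" "B \<in> sets \<mu>"
  have "emeasure (distr (PiM I (\<lambda>_. \<mu>)) (\<mu> \<Otimes>\<^sub>M \<mu>) (\<lambda>x. (x a, x b))) (A \<times> B)
      = emeasure (PiM I (\<lambda>_. \<mu>)) {x \<in> space (PiM I (\<lambda>_. \<mu>)). \<forall>i\<in>{a, b}. x i \<in> (if i = a then A else B)}"
    using AB ab by (subst emeasure_distr) (auto intro!: arg_cong2[where f = emeasure])
  also have "\<dots> = (\<Prod>i\<in>{a, b}. emeasure \<mu> (if i = a then A else B))"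
    using AB ab by (intro P.emeasure_PiM_Collect) auto
  also have "\<dots> = emeasure \<mu> A * emeasure \<mu> B" using ab by auto
  finally show "emeasure \<mu> A * emeasure \<mu> B
    = emeasure (distr (PiM I (\<lambda>_. \<mu>)) (\<mu> \<Otimes>\<^sub>M \<mu>) (\<lambda>x. (x a, x b))) (A \<times> B)" ..
qed simp

text \<open>By Fubini, fix the point with label \<open>a\<close>; the other point must then have its
  coordinate \<open>c\<close> in an interval of length \<open>2 * \<delta>\<close>.\<close>

lemma measure_PiM_permuton_near:
  assumes \<mu>: "\<mu> \<in> permutons" and ab: "a \<in> I" "b \<in> I" "a \<noteq> b" and \<delta>: "\<delta> \<ge> 0"
  shows "measure (PiM I (\<lambda>_. \<mu>)) {x \<in> space (PiM I (\<lambda>_. \<mu>)). \<bar>x a $ c - x b $ c\<bar> < \<delta>} \<le> 2 * \<delta>"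
proof -
  note ps = permuton_prob_space[OF \<mu>]
  interpret prob_space \<mu> by fact
  note [measurable] = measurable_permuton_coord[OF \<mu>]
  define S where "S = {p \<in> space (\<mu> \<Otimes>\<^sub>M \<mu>). \<bar>fst p $ c - snd p $ c\<bar> < \<delta>}"
  have S: "S \<in> sets (\<mu> \<Otimes>\<^sub>M \<mu>)" unfolding S_def by measurable
  have m: "(\<lambda>x. (x a, x b)) \<in> PiM I (\<lambda>_. \<mu>) \<rightarrow>\<^sub>M \<mu> \<Otimes>\<^sub>M \<mu>" using ab by simp
  have "emeasure (PiM I (\<lambda>_. \<mu>)) {x \<in> space (PiM I (\<lambda>_. \<mu>)). \<bar>x a $ c - x b $ c\<bar> < \<delta>}
      = emeasure (distr (PiM I (\<lambda>_. \<mu>)) (\<mu> \<Otimes>\<^sub>M \<mu>) (\<lambda>x. (x a, x b))) S"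
    using ab by (subst emeasure_distr[OF m S])
      (auto simp: S_def space_pair_measure space_PiM PiE_mem intro!: arg_cong2[where f = emeasure])
  also have "\<dots> = emeasure (\<mu> \<Otimes>\<^sub>M \<mu>) S" by (simp add: distr_PiM_pair[OF ps ab])
  also have "\<dots> = (\<integral>\<^sup>+u. emeasure \<mu> (Pair u -` S) \<partial>\<mu>)" by (rule emeasure_pair_measure_alt[OF S])
  also have "\<dots> \<le> (\<integral>\<^sup>+u. ennreal (2 * \<delta>) \<partial>\<mu>)"
  proof (rule nn_integral_mono)
    fix u assume "u \<in> space \<mu>"
    then have "Pair u -` S = {v \<in> space \<mu>. \<bar>u $ c - v $ c\<bar> < \<delta>}"
      by (auto simp: S_def space_pair_measure)
    then show "emeasure \<mu> (Pair u -` S) \<le> ennreal (2 * \<delta>)"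
      using measure_permuton_coord_near[OF \<mu> \<delta>, of "u $ c" c]
      by (simp add: emeasure_eq_measure ennreal_leI)
  qed
  also have "\<dots> = ennreal (2 * \<delta>)" by (simp add: emeasure_space_1)
  finally show ?thesis
    using \<delta> by (simp add: finite_measure.emeasure_eq_measure[OF prob_space.finite_measure[OF prob_space_PiM_const[OF ps]]])
qed

text \<open>A tie lies in every near-tie event, and the probabilities of these tend to 0; there are
  finitely many pairs and coordinates.\<close>

lemma AE_tie_free:
  assumes \<mu>: "\<mu> \<in> permutons"
  shows "AE x in PiM {1..k} (\<lambda>_. \<mu>). tie_free k x"
proof -
  note ps = permuton_prob_space[OF \<mu>]
  let ?P = "PiM {1..k} (\<lambda>_. \<mu>)"
  interpret P: prob_space ?P by (rule prob_space_PiM_const[OF ps])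
  note [measurable] = measurable_permuton_coord[OF \<mu>]
  have "AE x in ?P. x a $ c \<noteq> x b $ c" if ab: "a \<in> {1..k}" "b \<in> {1..k}" "a \<noteq> b" for a b c
  proof -
    have meas: "{x \<in> space ?P. x a $ c = x b $ c} \<in> P.events"
      using ab(1,2) by measurable
    have "P.prob {x \<in> space ?P. x a $ c = x b $ c} \<le> 0"
    proof (rule field_le_epsilon)
      fix e :: real assume e: "e > 0"
      have "P.prob {x \<in> space ?P. x a $ c = x b $ c} \<le> P.prob {x \<in> space ?P. \<bar>x a $ c - x b $ c\<bar> < e / 2}"
        using e ab(1,2) by (intro P.finite_measure_mono) auto
      also have "\<dots> \<le> e" using measure_PiM_permuton_near[OF \<mu> ab, of "e / 2" c] e by simp
      finally show "P.prob {x \<in> space ?P. x a $ c = x b $ c} \<le> 0 + e" by simp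
    qed
    then have "P.prob {x \<in> space ?P. x a $ c = x b $ c} = 0"
      by (rule antisym[OF _ measure_nonneg])
    then have "emeasure ?P {x \<in> space ?P. x a $ c = x b $ c} = 0"
      unfolding P.emeasure_eq_measure by (simp only: ennreal_0)
    with meas show ?thesis by (subst AE_iff_measurable[OF meas]) auto
  qed
  moreover have "finite {(a, b, c :: 'a). a \<in> {1..k} \<and> b \<in> {1..k} \<and> a \<noteq> b}"
    by (rule finite_subset[of _ "{1..k} \<times> {1..k} \<times> UNIV"]) auto
  ultimately have "AE x in ?P. \<forall>t \<in> {(a, b, c). a \<in> {1..k} \<and> b \<in> {1..k} \<and> a \<noteq> b}.
      x (fst t) $ snd (snd t) \<noteq> x (fst (snd t)) $ snd (snd t)"
    by (intro AE_finite_allI) auto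
  then show ?thesis
    by eventually_elim (force simp: tie_free_def)
qed

section \<open>Functions of the relative order of a sample\<close>

definition order_invariant :: "nat \<Rightarrow> ((nat \<Rightarrow> real ^ 'd::finite) \<Rightarrow> 'b) \<Rightarrow> bool" where
  "order_invariant k G \<longleftrightarrow> (\<forall>x y. (\<forall>a\<in>{1..k}. \<forall>b\<in>{1..k}. \<forall>c. x a $ c < x b $ c \<longleftrightarrow> y a $ c < y b $ c)
     \<longrightarrow> G x = G y)"

lemma order_invariantD:
  "order_invariant k G \<Longrightarrow>
    (\<And>a b c. a \<in> {1..k} \<Longrightarrow> b \<in> {1..k} \<Longrightarrow> x a $ c < x b $ c \<longleftrightarrow> y a $ c < y b $ c) \<Longrightarrow> G x = G y"
  unfolding order_invariant_def by blast

text \<open>The set of all true comparisons determines the value, via any representative with the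
  same set. It ranges over a finite power set, which gives finite range, boundedness and
  measurability.\<close>

lemma order_invariant_factor:
  fixes G :: "(nat \<Rightarrow> real ^ 'd::finite) \<Rightarrow> 'b"
  assumes "order_invariant k G"
  obtains h :: "(nat \<times> nat \<times> 'd) set \<Rightarrow> 'b"
  where "\<And>x. G x = h {(a, b, c). a \<in> {1..k} \<and> b \<in> {1..k} \<and> x a $ c < x b $ c}"
proof -
  define D where "D x = {(a, b, c). a \<in> {1..k} \<and> b \<in> {1..k} \<and> x a $ c < x b $ c}"
    for x :: "nat \<Rightarrow> real ^ 'd"
  have "G x = (\<lambda>s. G (SOME y. D y = s)) (D x)" for x
  proof (rule order_invariantD[OF assms])
    fix a b c assume ab: "a \<in> {1..k}" "b \<in> {1..k}"
    have "D (SOME y. D y = D x) = D x" by (rule someI[of "\<lambda>y. D y = D x"]) simp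
    then have "(a, b, c) \<in> D (SOME y. D y = D x) \<longleftrightarrow> (a, b, c) \<in> D x" by simp
    then show "x a $ c < x b $ c \<longleftrightarrow> (SOME y. D y = D x) a $ c < (SOME y. D y = D x) b $ c"
      using ab by (simp add: D_def)
  qed
  then show thesis by (intro that) (simp add: D_def)
qed

lemma order_invariant_finite_range:
  fixes G :: "(nat \<Rightarrow> real ^ 'd::finite) \<Rightarrow> 'b"
  assumes "order_invariant k G"
  shows "finite (range G)"
proof -
  obtain h where "\<And>x. G x = h {(a, b, c). a \<in> {1..k} \<and> b \<in> {1..k} \<and> x a $ c < x b $ c}"
    using order_invariant_factor[OF assms] by blast
  then have "range G \<subseteq> h ` Pow ({1..k} \<times> {1..k} \<times> UNIV)" by auto
  then show ?thesis by (rule finite_subset) simp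
qed

lemma order_invariant_bounded:
  fixes G :: "(nat \<Rightarrow> real ^ 'd::finite) \<Rightarrow> real"
  assumes "order_invariant k G"
  obtains B where "\<And>x. \<bar>G x\<bar> \<le> B"
  using finite_imp_bounded[OF order_invariant_finite_range[OF assms]] by (auto simp: bounded_iff)

lemma order_invariant_measurable_count_space:
  fixes G :: "(nat \<Rightarrow> real ^ 'd::finite) \<Rightarrow> 'b"
  assumes G: "order_invariant k G"
    and M: "\<And>i. (\<lambda>x. x $ i) \<in> borel_measurable M"
  shows "G \<in> PiM {1..k} (\<lambda>_. M) \<rightarrow>\<^sub>M count_space UNIV"
proof -
  note [measurable] = M
  let ?T = "{1..k} \<times> {1..k} \<times> (UNIV :: 'd set)"
  define D where "D x = {(a, b, c). a \<in> {1..k} \<and> b \<in> {1..k} \<and> x a $ c < x b $ c}"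
    for x :: "nat \<Rightarrow> real ^ 'd"
  obtain h where h: "\<And>x. G x = h {(a, b, c). a \<in> {1..k} \<and> b \<in> {1..k} \<and> x a $ c < x b $ c}"
    using order_invariant_factor[OF G] by blast
  note h = h[folded D_def]
  let ?P = "PiM {1..k} (\<lambda>_. M)"
  have D_sub: "D x \<subseteq> ?T" for x by (auto simp: D_def)
  have pre: "D -` {s} \<inter> space ?P \<in> sets ?P" if s: "s \<subseteq> ?T" for s
  proof -
    have mem: "t \<in> D x \<longleftrightarrow> x (fst t) $ snd (snd t) < x (fst (snd t)) $ snd (snd t)" if "t \<in> ?T" for t x
      using that by (cases t) (simp add: D_def)
    have "D x = s \<longleftrightarrow> (\<forall>t\<in>?T. t \<in> D x \<longleftrightarrow> t \<in> s)" for x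
      using s D_sub[of x] by blast
    then have "D x = s \<longleftrightarrow> (\<forall>t\<in>?T. (x (fst t) $ snd (snd t) < x (fst (snd t)) $ snd (snd t)) = (t \<in> s))" for x
      using mem by (simp only: cong: ball_cong)
    then have "D -` {s} \<inter> space ?P = {x \<in> space ?P.
        \<forall>t\<in>?T. (x (fst t) $ snd (snd t) < x (fst (snd t)) $ snd (snd t)) = (t \<in> s)}"
      by (intro set_eqI) (simp only: Int_iff vimage_eq singleton_iff mem_Collect_eq conj_commute)
    also have "\<dots> \<in> sets ?P"
    proof (rule sets.sets_Collect_finite_All)
      fix t assume "t \<in> ?T"
      then obtain a b c where t: "t = (a, b, c)" and a: "a \<in> {1..k}" and b: "b \<in> {1..k}" by blast
      have "(\<lambda>x. x a $ c) \<in> borel_measurable ?P" "(\<lambda>x. x b $ c) \<in> borel_measurable ?P"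
        using measurable_compose[OF measurable_component_singleton[OF a, of "\<lambda>_. M"] M[of c]]
          measurable_compose[OF measurable_component_singleton[OF b, of "\<lambda>_. M"] M[of c]] .
      then have *: "{x \<in> space ?P. x a $ c < x b $ c} \<in> sets ?P" by (rule borel_measurable_less)
      have "{x \<in> space ?P. (x a $ c < x b $ c) = (t \<in> s)} \<in> sets ?P"
        using * sets.sets_Collect_neg[OF *] by (cases "t \<in> s") (simp_all only: simp_thms)
      then show "{x \<in> space ?P. (x (fst t) $ snd (snd t) < x (fst (snd t)) $ snd (snd t)) = (t \<in> s)} \<in> sets ?P"
        by (simp only: t fst_conv snd_conv)
    qed simp_all
    finally show ?thesis .
  qed
  have "D \<in> ?P \<rightarrow>\<^sub>M count_space (Pow ?T)"
  proof (rule measurable_count_space_eq2[THEN iffD2])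
    show "D \<in> space ?P \<rightarrow> Pow ?T \<and> (\<forall>s\<in>Pow ?T. D -` {s} \<inter> space ?P \<in> sets ?P)"
      using D_sub pre by (intro conjI Pi_I ballI) (simp_all only: Pow_iff)
  qed simp
  then have "(\<lambda>x. h (D x)) \<in> PiM {1..k} (\<lambda>_. M) \<rightarrow>\<^sub>M count_space UNIV"
    by (rule measurable_compose) simp
  then show ?thesis by (simp only: h[abs_def])
qed

lemma order_invariant_measurable:
  fixes G :: "(nat \<Rightarrow> real ^ 'd::finite) \<Rightarrow> 'b::topological_space"
  assumes G: "order_invariant k G" and \<mu>: "\<mu> \<in> permutons"
  shows "G \<in> borel_measurable (PiM {1..k} (\<lambda>_. \<mu>))"
  using measurable_compose[OF order_invariant_measurable_count_space[OF G measurable_permuton_coord[OF \<mu>]]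
      borel_measurable_count_space[of "\<lambda>x. x"]] by simp

lemma order_invariant_integrable:
  fixes G :: "(nat \<Rightarrow> real ^ 'd::finite) \<Rightarrow> real"
  assumes G: "order_invariant k G" and \<mu>: "\<mu> \<in> permutons"
  shows "integrable (PiM {1..k} (\<lambda>_. \<mu>)) G"
proof -
  interpret prob_space "PiM {1..k} (\<lambda>_. \<mu>)"
    by (rule prob_space_PiM_const[OF permuton_prob_space[OF \<mu>]])
  obtain B where "\<And>x. \<bar>G x\<bar> \<le> B" using order_invariant_bounded[OF G] by blast
  then show ?thesis
    by (intro integrable_const_bound[where B = B] order_invariant_measurable[OF G \<mu>]) auto
qed

lemma order_invariant_coord_rank: "order_invariant k (\<lambda>x. restrict (coord_rank k x) {1..k})"
  unfolding order_invariant_def coord_rank_def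
  by (intro allI impI restrict_ext arg_cong[where f = card]) (auto simp: not_less[symmetric])

text \<open>With ties \<open>perm_of\<close> may be unspecified, but the predicate under its
  description operator is the same for both samples, so the values agree even then.\<close>

lemma order_invariant_perm_of: "order_invariant k (perm_of k)"
proof (unfold order_invariant_def, intro allI impI)
  fix x y :: "nat \<Rightarrow> real ^ 'e::finite option"
  assume eq: "\<forall>a\<in>{1..k}. \<forall>b\<in>{1..k}. \<forall>c. x a $ c < x b $ c \<longleftrightarrow> y a $ c < y b $ c"
  have "restrict (coord_rank k x) {1..k} = restrict (coord_rank k y) {1..k}"
    using order_invariant_coord_rank eq unfolding order_invariant_def by blast
  then have r: "coord_rank k x a = coord_rank k y a" if "a \<in> {1..k}" for a
    using that by (metis restrict_apply')
  show "perm_of k x = perm_of k y"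
    unfolding perm_of_def
    by (rule arg_cong[where f = The], rule ext) (use eq r in \<open>auto simp: Ball_def\<close>)
qed

lemma order_invariant_comp: "order_invariant k G \<Longrightarrow> order_invariant k (\<lambda>x. f (G x))"
  unfolding order_invariant_def by metis

lemma freq_permuton_eq_prob:
  assumes "\<mu> \<in> permutons"
  shows "freq_permuton \<tau> \<mu> = measure (PiM {1..psize \<tau>} (\<lambda>_. \<mu>))
    {x \<in> space (PiM {1..psize \<tau>} (\<lambda>_. \<mu>)). perm_of (psize \<tau>) x = \<tau>}"
proof -
  have "freq_permuton \<tau> \<mu> = (LINT x|PiM {1..psize \<tau>} (\<lambda>_. \<mu>). indicator {x. perm_of (psize \<tau>) x = \<tau>} x)"
    unfolding freq_permuton_def by (intro Bochner_Integration.integral_cong) (auto simp: indicator_def)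
  then show ?thesis
    by (simp add: Int_def conj_commute)
qed

lemma freq_permuton_range:
  assumes "\<mu> \<in> permutons"
  shows "freq_permuton \<tau> \<mu> \<in> {0..1}"
  using prob_space.prob_le_1[OF prob_space_PiM_const[OF permuton_prob_space[OF assms]]]
  by (simp add: freq_permuton_eq_prob[OF assms])

section \<open>Joint samples and relabelling\<close>

definition concat_points :: "nat \<Rightarrow> nat \<Rightarrow> (nat \<Rightarrow> 'a) \<Rightarrow> (nat \<Rightarrow> 'a) \<Rightarrow> nat \<Rightarrow> 'a" where
  "concat_points k l x y = (\<lambda>i\<in>{1..k + l}. if i \<le> k then x i else y (i - k))"

lemma concat_points_left: "i \<in> {1..k} \<Longrightarrow> concat_points k l x y i = x i"
  by (simp add: concat_points_def)

lemma concat_points_right: "i \<in> {1..l} \<Longrightarrow> concat_points k l x y (i + k) = y i"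
  by (simp add: concat_points_def)

lemma measurable_concat_points:
  assumes "\<And>i. i \<in> {1..k} \<Longrightarrow> (\<lambda>w. f w i) \<in> L \<rightarrow>\<^sub>M M" "\<And>i. i \<in> {1..l} \<Longrightarrow> (\<lambda>w. g w i) \<in> L \<rightarrow>\<^sub>M M"
  shows "(\<lambda>w. concat_points k l (f w) (g w)) \<in> L \<rightarrow>\<^sub>M PiM {1..k + l} (\<lambda>_. M)"
  unfolding concat_points_def
proof (rule measurable_restrict)
  fix i assume i: "i \<in> {1..k + l}"
  show "(\<lambda>w. if i \<le> k then f w i else g w (i - k)) \<in> L \<rightarrow>\<^sub>M M"
  proof (cases "i \<le> k")
    case True
    then show ?thesis using assms(1)[of i] i by simp
  next
    case False
    then have "i - k \<in> {1..l}" using i unfolding atLeastAtMost_iff by arith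
    from assms(2)[OF this] False show ?thesis by simp
  qed
qed

lemma distr_concat_points:
  assumes "prob_space \<mu>"
  shows "distr (PiM {1..k} (\<lambda>_. \<mu>) \<Otimes>\<^sub>M PiM {1..l} (\<lambda>_. \<mu>)) (PiM {1..k + l} (\<lambda>_. \<mu>))
    (\<lambda>p. concat_points k l (fst p) (snd p)) = PiM {1..k + l} (\<lambda>_. \<mu>)" (is "distr (?P \<Otimes>\<^sub>M ?Q) ?R ?f = ?R")
proof -
  interpret prob_space \<mu> by fact
  interpret product_prob_space "\<lambda>_. \<mu>" "UNIV :: nat set" by unfold_locales
  interpret Q: prob_space ?Q by (rule prob_space_PiM_const[OF assms])
  have meas: "?f \<in> ?P \<Otimes>\<^sub>M ?Q \<rightarrow>\<^sub>M ?R"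
    by (rule measurable_concat_points)
      (auto intro: measurable_compose[OF measurable_fst measurable_component_singleton]
        measurable_compose[OF measurable_snd measurable_component_singleton])
  show ?thesis
  proof (rule PiM_eqI)
    fix A assume A: "\<And>i. i \<in> {1..k + l} \<Longrightarrow> A i \<in> sets \<mu>"
    have "?f -` Pi\<^sub>E {1..k + l} A \<inter> space (?P \<Otimes>\<^sub>M ?Q)
        = Pi\<^sub>E {1..k} A \<times> Pi\<^sub>E {1..l} (\<lambda>i. A (i + k))" (is "?X = ?Y")
    proof (rule set_eqI, clarify, rule iffI)
      fix x y assume "(x, y) \<in> ?X"
      then have sp: "x \<in> space ?P" "y \<in> space ?Q"
        and mem: "\<And>i. i \<in> {1..k + l} \<Longrightarrow> concat_points k l x y i \<in> A i"
        by (auto simp: space_pair_measure PiE_mem)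
      have "x i \<in> A i" if "i \<in> {1..k}" for i
        using mem[of i] that by (simp add: concat_points_left)
      moreover have "y i \<in> A (i + k)" if "i \<in> {1..l}" for i
        using mem[of "i + k"] that by (simp add: concat_points_right)
      ultimately show "(x, y) \<in> ?Y" using sp by (auto simp: space_PiM PiE_iff)
    next
      fix x y assume xy: "(x, y) \<in> ?Y"
      then have "concat_points k l x y \<in> Pi\<^sub>E {1..k + l} A"
      proof (intro PiE_I)
        fix i assume "i \<in> {1..k + l}"
        then consider "i \<in> {1..k}" | "\<not> i \<le> k" "i - k \<in> {1..l}"
          unfolding atLeastAtMost_iff by arith
        then show "concat_points k l x y i \<in> A i"
        proof cases
          case 1
          then show ?thesis using xy by (auto simp: concat_points_left PiE_mem)
        next
          case 2
          from xy have "y \<in> Pi\<^sub>E {1..l} (\<lambda>i. A (i + k))" by blast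
          from PiE_mem[OF this 2(2)] 2 \<open>i \<in> {1..k + l}\<close> show ?thesis by (simp add: concat_points_def)
        qed
      qed (auto simp: concat_points_def)
      moreover have "Pi\<^sub>E {1..k} A \<subseteq> space ?P" "Pi\<^sub>E {1..l} (\<lambda>i. A (i + k)) \<subseteq> space ?Q"
        unfolding space_PiM by (rule PiE_mono, rule sets.sets_into_space, rule A, simp)+
      ultimately show "(x, y) \<in> ?X" using xy by (auto simp: space_pair_measure)
    qed
    then have "emeasure (distr (?P \<Otimes>\<^sub>M ?Q) ?R ?f) (Pi\<^sub>E {1..k + l} A)
        = emeasure (?P \<Otimes>\<^sub>M ?Q) (Pi\<^sub>E {1..k} A \<times> Pi\<^sub>E {1..l} (\<lambda>i. A (i + k)))"
      using A by (subst emeasure_distr[OF meas]) (auto intro!: sets_PiM_I_finite)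
    also have "\<dots> = emeasure ?P (Pi\<^sub>E {1..k} A) * emeasure ?Q (Pi\<^sub>E {1..l} (\<lambda>i. A (i + k)))"
      using A by (intro Q.emeasure_pair_measure_Times sets_PiM_I_finite) auto
    also have "\<dots> = (\<Prod>i\<in>{1..k}. emeasure \<mu> (A i)) * (\<Prod>i\<in>{1..l}. emeasure \<mu> (A (i + k)))"
      using A by (subst (1 2) emeasure_PiM) auto
    also have "(\<Prod>i\<in>{1..l}. emeasure \<mu> (A (i + k))) = (\<Prod>i\<in>{k + 1..k + l}. emeasure \<mu> (A i))"
      using prod.shift_bounds_cl_nat_ivl[of "\<lambda>i. emeasure \<mu> (A i)" 1 k l] by (simp add: add.commute)
    also have "(\<Prod>i\<in>{1..k}. emeasure \<mu> (A i)) * \<dots> = (\<Prod>i\<in>{1..k + l}. emeasure \<mu> (A i))"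
      by (rule prod.ub_add_nat[symmetric]) simp
    finally show "emeasure (distr (?P \<Otimes>\<^sub>M ?Q) ?R ?f) (Pi\<^sub>E {1..k + l} A) = (\<Prod>i\<in>{1..k + l}. emeasure \<mu> (A i))" .
  qed simp_all
qed

lemma integral_concat_points:
  fixes F :: "(nat \<Rightarrow> 'a) \<Rightarrow> real"
  assumes \<mu>: "prob_space \<mu>" and F: "F \<in> borel_measurable (PiM {1..k + l} (\<lambda>_. \<mu>))" and B: "\<And>x. \<bar>F x\<bar> \<le> B"
  shows "(LINT x|PiM {1..k + l} (\<lambda>_. \<mu>). F x)
    = (LINT x|PiM {1..k} (\<lambda>_. \<mu>). LINT y|PiM {1..l} (\<lambda>_. \<mu>). F (concat_points k l x y))"
proof -
  let ?P = "PiM {1..k} (\<lambda>_. \<mu>)" let ?Q = "PiM {1..l} (\<lambda>_. \<mu>)" let ?R = "PiM {1..k + l} (\<lambda>_. \<mu>)"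
  interpret P: prob_space ?P by (rule prob_space_PiM_const[OF \<mu>])
  interpret Q: prob_space ?Q by (rule prob_space_PiM_const[OF \<mu>])
  interpret PQ: pair_prob_space ?P ?Q by unfold_locales
  have meas: "(\<lambda>p. concat_points k l (fst p) (snd p)) \<in> ?P \<Otimes>\<^sub>M ?Q \<rightarrow>\<^sub>M ?R"
    by (rule measurable_concat_points)
      (auto intro: measurable_compose[OF measurable_fst measurable_component_singleton]
        measurable_compose[OF measurable_snd measurable_component_singleton])
  have "(LINT x|?R. F x) = (LINT x|distr (?P \<Otimes>\<^sub>M ?Q) ?R (\<lambda>p. concat_points k l (fst p) (snd p)). F x)"
    by (simp only: distr_concat_points[OF \<mu>])
  also have "\<dots> = (LINT p|(?P \<Otimes>\<^sub>M ?Q). F (concat_points k l (fst p) (snd p)))"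
    by (rule integral_distr[OF meas F])
  also have "\<dots> = (LINT x|?P. LINT y|?Q. F (concat_points k l (fst (x, y)) (snd (x, y))))"
    by (rule PQ.integral_fst'[symmetric], rule PQ.integrable_const_bound[where B = B])
      (use B measurable_compose[OF meas F] in auto)
  finally show ?thesis by simp
qed

text \<open>The points are independent with a common law, so reindexing by \<open>\<pi>\<close>
  preserves the product measure.\<close>

lemma integral_PiM_permutes:
  fixes G :: "(nat \<Rightarrow> real ^ 'd::finite) \<Rightarrow> real"
  assumes \<mu>: "\<mu> \<in> permutons" and G: "order_invariant k G" and \<pi>: "\<pi> permutes {1..k}"
  shows "(LINT x|PiM {1..k} (\<lambda>_. \<mu>). G (x \<circ> \<pi>)) = (LINT x|PiM {1..k} (\<lambda>_. \<mu>). G x)"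
proof -
  let ?P = "PiM {1..k} (\<lambda>_. \<mu>)" and ?f = "\<lambda>x. \<lambda>i\<in>{1..k}. x (\<pi> i)"
  have in_img: "\<pi> i \<in> {1..k}" if "i \<in> {1..k}" for i
    using permutes_in_image[OF \<pi>] that by blast
  have "distr ?P ?P ?f = ?P"
    using distr_PiM_reindex[of "{1..k}" "\<lambda>_. \<mu>" \<pi> "{1..k}"] permuton_prob_space[OF \<mu>]
      inj_on_subset[OF permutes_inj[OF \<pi>]] in_img by auto
  then have "(LINT x|?P. G x) = (LINT x|distr ?P ?P ?f. G x)" by simp
  also have "\<dots> = (LINT x|?P. G (?f x))"
    by (intro integral_distr order_invariant_measurable[OF G \<mu>] measurable_restrict
        measurable_component_singleton in_img)
  also have "\<dots> = (LINT x|?P. G (x \<circ> \<pi>))"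
    by (intro Bochner_Integration.integral_cong refl order_invariantD[OF G]) simp
  finally show ?thesis ..
qed

lemma coord_rank_permutes:
  assumes "tie_free k x"
  shows "(\<lambda>a. if a \<in> {1..k} then coord_rank k x a else a) permutes {1..k}"
proof (rule bij_imp_permutes)
  have "bij_betw (\<lambda>a. if a \<in> {1..k} then coord_rank k x a else a) {1..k} {1..k} \<longleftrightarrow>
      bij_betw (coord_rank k x) {1..k} {1..k}"
    by (rule bij_betw_cong) simp
  then show "bij_betw (\<lambda>a. if a \<in> {1..k} then coord_rank k x a else a) {1..k} {1..k}"
    using coord_rank_bij(1)[OF assms] by simp
qed auto

text \<open>Averaging over all labellings of the sample points leaves a function of the sampled pattern.\<close>

lemma order_invariant_expectation:
  fixes G :: "(nat \<Rightarrow> real ^ 'e::finite option) \<Rightarrow> real"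
  assumes G: "order_invariant k G" and k: "k \<ge> 1"
  obtains b where "\<And>\<mu>. \<mu> \<in> permutons \<Longrightarrow>
    (LINT x|PiM {1..k} (\<lambda>_. \<mu>). G x) = (\<Sum>\<rho> | psize \<rho> = k. b \<rho> * freq_permuton \<rho> \<mu>)"
proof -
  define S where "S = {\<pi>. \<pi> permutes {1..k}}"
  have "finite S" unfolding S_def by (rule finite_permutations) simp
  moreover have "id \<in> S" unfolding S_def using permutes_id by blast
  ultimately have S: "card S > 0" by (auto simp: card_gt_0_iff)
  have in_img: "\<pi> a \<in> {1..k}" if "\<pi> \<in> S" "a \<in> {1..k}" for \<pi> a
    using that permutes_in_image[of \<pi> "{1..k}" a] unfolding S_def by simp
  \<comment> \<open>By exchangeability \<open>H\<close> has the same expectation as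
    \<open>G\<close>, but it no longer depends on the labelling.\<close>
  define H where "H x = (\<Sum>\<pi>\<in>S. G (x \<circ> \<pi>)) / card S" for x
  have H_canon: "H x = H (canonical_points (perm_of k x))" if x: "tie_free k x" for x
  proof -
    define f where "f a = (if a \<in> {1..k} then coord_rank k x a else a)" for a
    have f: "f permutes {1..k}" unfolding f_def by (rule coord_rank_permutes[OF x])
    have "G (x \<circ> \<pi>) = G (canonical_points (perm_of k x) \<circ> (f \<circ> \<pi>))" if "\<pi> \<in> S" for \<pi>
    proof (rule order_invariantD[OF G])
      fix a b c assume ab: "a \<in> {1..k}" "b \<in> {1..k}"
      then have "\<pi> a \<in> {1..k}" "\<pi> b \<in> {1..k}"
        using in_img[OF that] by blast+
      from tie_free_less_iff[OF x k this, of c] this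
      show "(x \<circ> \<pi>) a $ c < (x \<circ> \<pi>) b $ c \<longleftrightarrow> (canonical_points (perm_of k x) \<circ> (f \<circ> \<pi>)) a $ c
          < (canonical_points (perm_of k x) \<circ> (f \<circ> \<pi>)) b $ c"
        by (simp add: f_def)
    qed
    then have "(\<Sum>\<pi>\<in>S. G (x \<circ> \<pi>)) = (\<Sum>\<pi>\<in>S. G (canonical_points (perm_of k x) \<circ> (f \<circ> \<pi>)))"
      by (rule sum.cong[OF refl])
    \<comment> \<open>Left composition with \<open>f\<close> permutes \<open>S\<close>, so the
      relabelling by rank disappears from the sum.\<close>
    also have "\<dots> = (\<Sum>\<pi>\<in>(\<circ>) f ` S. G (canonical_points (perm_of k x) \<circ> \<pi>))"
      using sum.reindex[OF inj_on_subset[OF fun.inj_map[OF permutes_inj[OF f]] subset_UNIV],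
          of "\<lambda>\<pi>. G (canonical_points (perm_of k x) \<circ> \<pi>)" S] by (simp only: comp_def)
    also have "(\<circ>) f ` S = S"
      unfolding S_def using image_compose_permutations_left[OF f] by (simp add: setcompr_eq_image)
    finally show ?thesis unfolding H_def by (rule arg_cong)
  qed
  show thesis
  proof (rule that)
    fix \<mu> :: "(real ^ 'e option) measure" assume \<mu>: "\<mu> \<in> permutons"
    let ?P = "PiM {1..k} (\<lambda>_. \<mu>)"
    interpret P: prob_space ?P by (rule prob_space_PiM_const[OF permuton_prob_space[OF \<mu>]])
    have inv: "order_invariant k (\<lambda>x. G (x \<circ> \<pi>))" if "\<pi> \<in> S" for \<pi>
      unfolding order_invariant_def
    proof (intro allI impI order_invariantD[OF G])
      fix x y a b c
      assume "\<forall>a\<in>{1..k}. \<forall>b\<in>{1..k}. \<forall>c. (x a $ c < x b $ c) = (y a $ c < (y :: nat \<Rightarrow> real ^ 'e option) b $ c)"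
        and "a \<in> {1..k}" "b \<in> {1..k}"
      moreover from this have "\<pi> a \<in> {1..k}" "\<pi> b \<in> {1..k}"
        using in_img[OF that] by blast+
      ultimately show "(x \<circ> \<pi>) a $ c < (x \<circ> \<pi>) b $ c \<longleftrightarrow> (y \<circ> \<pi>) a $ c < (y \<circ> \<pi>) b $ c"
        unfolding comp_apply by blast
    qed
    note int = order_invariant_integrable[OF inv \<mu>]
    have "(LINT x|?P. H x) = (\<Sum>\<pi>\<in>S. LINT x|?P. G (x \<circ> \<pi>)) / card S"
      unfolding H_def by (simp only: integral_divide_zero Bochner_Integration.integral_sum[OF int])
    also have "(\<Sum>\<pi>\<in>S. LINT x|?P. G (x \<circ> \<pi>)) = (\<Sum>\<pi>\<in>S. LINT x|?P. G x)"
      by (rule sum.cong) (simp_all only: integral_PiM_permutes[OF \<mu> G] S_def mem_Collect_eq)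
    also have "\<dots> / card S = (LINT x|?P. G x)" using S by simp
    finally have "(LINT x|?P. G x) = (LINT x|?P. H x)" ..
    \<comment> \<open>Almost surely exactly one summand survives, that of the sampled pattern. The
      value of \<open>H\<close> at the canonical points of \<open>\<rho>\<close> is the required
      coefficient.\<close>
    also have "\<dots> = (LINT x|?P. (\<Sum>\<rho> | psize \<rho> = k. H (canonical_points \<rho>) * of_bool (perm_of k x = \<rho>)))"
    proof (rule integral_cong_AE)
      show "AE x in ?P. H x = (\<Sum>\<rho> | psize \<rho> = k. H (canonical_points \<rho>) * of_bool (perm_of k x = \<rho>))"
        using AE_tie_free[OF \<mu>]
      proof eventually_elim
        case (elim x)
        have "(\<Sum>\<rho> | psize \<rho> = k. H (canonical_points \<rho>) * of_bool (perm_of k x = \<rho>))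
            = (\<Sum>\<rho> | psize \<rho> = k. if \<rho> = perm_of k x then H (canonical_points \<rho>) else 0)"
          by (rule sum.cong) auto
        also have "\<dots> = H (canonical_points (perm_of k x))"
          using perm_of_spec(1)[OF elim k] by (simp add: finite_dperms)
        finally show ?case using H_canon[OF elim] by simp
      qed
      show "H \<in> borel_measurable ?P"
        unfolding H_def by (intro borel_measurable_divide borel_measurable_sum
            order_invariant_measurable[OF inv \<mu>] borel_measurable_const)
      show "(\<lambda>x. \<Sum>\<rho> | psize \<rho> = k. H (canonical_points \<rho>) * of_bool (perm_of k x = \<rho>)) \<in> borel_measurable ?P"
        by (rule order_invariant_measurable[OF order_invariant_comp[OF order_invariant_perm_of] \<mu>])
    qed
    also have "\<dots> = (\<Sum>\<rho> | psize \<rho> = k. H (canonical_points \<rho>) * freq_permuton \<rho> \<mu>)"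
    proof (subst Bochner_Integration.integral_sum)
      show "integrable ?P (\<lambda>x. H (canonical_points \<rho>) * of_bool (perm_of k x = \<rho>))" for \<rho>
        by (rule order_invariant_integrable[OF order_invariant_comp[OF order_invariant_perm_of] \<mu>])
      show "(\<Sum>\<rho> | psize \<rho> = k. LINT x|?P. H (canonical_points \<rho>) * of_bool (perm_of k x = \<rho>))
          = (\<Sum>\<rho> | psize \<rho> = k. H (canonical_points \<rho>) * freq_permuton \<rho> \<mu>)"
        by (rule sum.cong) (auto simp: freq_permuton_def)
    qed
    finally show "(LINT x|?P. G x) = (\<Sum>\<rho> | psize \<rho> = k. H (canonical_points \<rho>) * freq_permuton \<rho> \<mu>)" .
  qed
qed

text \<open>Linear combinations of pattern densities, taken up to equality on
  \<open>permutons\<close>: the rule \<open>cong\<close> is there because the integral identities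
  below hold for permutons only.\<close>

inductive freq_combination :: "((real ^ 'e::finite option) measure \<Rightarrow> real) \<Rightarrow> bool" where
  freq: "freq_combination (freq_permuton \<tau>)"
| add: "freq_combination F \<Longrightarrow> freq_combination F' \<Longrightarrow> freq_combination (\<lambda>\<mu>. F \<mu> + F' \<mu>)"
| scale: "freq_combination F \<Longrightarrow> freq_combination (\<lambda>\<mu>. c * F \<mu>)"
| cong: "freq_combination F \<Longrightarrow> (\<And>\<mu>. \<mu> \<in> permutons \<Longrightarrow> F' \<mu> = F \<mu>) \<Longrightarrow> freq_combination F'"

lemma freq_combination_sum:
  assumes "finite A" "\<And>i. i \<in> A \<Longrightarrow> freq_combination (F i)"
  shows "freq_combination (\<lambda>\<mu>. \<Sum>i\<in>A. F i \<mu>)"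
  using assms
proof (induction A rule: finite_induct)
  case empty
  show ?case using freq_combination.scale[OF freq_combination.freq, of 0] by simp
next
  case (insert i A)
  then show ?case using freq_combination.add[of "F i"] by simp
qed

lemma freq_combination_integral:
  assumes "order_invariant k G" "k \<ge> 1"
  shows "freq_combination (\<lambda>\<mu>. LINT x|PiM {1..k} (\<lambda>_. \<mu>). G x)"
proof -
  obtain b where b: "\<And>\<mu>. \<mu> \<in> permutons \<Longrightarrow>
    (LINT x|PiM {1..k} (\<lambda>_. \<mu>). G x) = (\<Sum>\<rho> | psize \<rho> = k. b \<rho> * freq_permuton \<rho> \<mu>)"
    using order_invariant_expectation[OF assms] by blast
  show ?thesis
    by (rule freq_combination.cong[OF freq_combination_sum b])
      (auto intro: finite_dperms freq_combination.intros(1,3))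
qed

lemma freq_combination_const: "freq_combination (\<lambda>_. c)"
proof (rule freq_combination.cong)
  show "freq_combination (\<lambda>\<mu>. LINT x|PiM {1..1 :: nat} (\<lambda>_. \<mu>). c)"
    by (rule freq_combination_integral) (auto simp: order_invariant_def)
  show "c = (LINT x|PiM {1..1 :: nat} (\<lambda>_. \<mu>). c)" if "\<mu> \<in> permutons" for \<mu> :: "(real ^ 'a option) measure"
    using prob_space.prob_space[OF prob_space_PiM_const[OF permuton_prob_space[OF that]], of "{1..1::nat}"]
    by (simp only: lebesgue_integral_const real_scaleR_def mult_1)
qed

text \<open>Two independent samples form one larger sample. The event that its first points show
  \<open>\<tau>\<close> and its last points show \<open>\<tau>'\<close> depends on the relative
  order alone, so its probability is again a combination. This closes combinations under
  products.\<close>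

lemma freq_combination_freq_mult:
  fixes \<tau> \<tau>' :: "'e::finite dperm"
  shows "freq_combination (\<lambda>\<mu>. freq_permuton \<tau> \<mu> * freq_permuton \<tau>' \<mu>)"
proof (rule freq_combination.cong)
  let ?k = "psize \<tau>" and ?l = "psize \<tau>'"
  define G :: "(nat \<Rightarrow> real ^ 'e option) \<Rightarrow> real"
    where "G x = of_bool (perm_of ?k x = \<tau>) * of_bool (perm_of ?l (\<lambda>i. x (i + ?k)) = \<tau>')" for x
  have G: "order_invariant (?k + ?l) G"
    unfolding order_invariant_def
  proof (intro allI impI)
    fix x y :: "nat \<Rightarrow> real ^ 'e option"
    assume xy: "\<forall>a\<in>{1..?k + ?l}. \<forall>b\<in>{1..?k + ?l}. \<forall>c. (x a $ c < x b $ c) = (y a $ c < y b $ c)"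
    have "perm_of ?k x = perm_of ?k y"
      by (rule order_invariantD[OF order_invariant_perm_of]) (use xy in auto)
    moreover have "perm_of ?l (\<lambda>i. x (i + ?k)) = perm_of ?l (\<lambda>i. y (i + ?k))"
      by (rule order_invariantD[OF order_invariant_perm_of]) (use xy in auto)
    ultimately show "G x = G y" by (simp add: G_def)
  qed
  show "freq_combination (\<lambda>\<mu>. LINT x|PiM {1..?k + ?l} (\<lambda>_. \<mu>). G x)"
    by (rule freq_combination_integral[OF G]) (use psize_ge_1[of \<tau>] in linarith)
  fix \<mu> :: "(real ^ 'e option) measure" assume \<mu>: "\<mu> \<in> permutons"
  have "G (concat_points ?k ?l x y) = of_bool (perm_of ?k x = \<tau>) * of_bool (perm_of ?l y = \<tau>')" for x y
  proof -
    have "perm_of ?k (concat_points ?k ?l x y) = perm_of ?k x"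
      by (rule order_invariantD[OF order_invariant_perm_of]) (simp add: concat_points_left)
    moreover have "perm_of ?l (\<lambda>i. concat_points ?k ?l x y (i + ?k)) = perm_of ?l y"
      by (rule order_invariantD[OF order_invariant_perm_of]) (simp only: concat_points_right)
    ultimately show ?thesis by (simp add: G_def)
  qed
  moreover have "(LINT x|PiM {1..?k + ?l} (\<lambda>_. \<mu>). G x)
    = (LINT x|PiM {1..?k} (\<lambda>_. \<mu>). LINT y|PiM {1..?l} (\<lambda>_. \<mu>). G (concat_points ?k ?l x y))"
    by (rule integral_concat_points[OF permuton_prob_space[OF \<mu>] order_invariant_measurable[OF G \<mu>], of 1])
      (simp add: G_def)
  ultimately show "freq_permuton \<tau> \<mu> * freq_permuton \<tau>' \<mu> = (LINT x|PiM {1..?k + ?l} (\<lambda>_. \<mu>). G x)"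
    by (simp add: freq_permuton_def)
qed

lemma freq_combination_mult:
  assumes "freq_combination F" "freq_combination F'"
  shows "freq_combination (\<lambda>\<mu>. F \<mu> * F' \<mu>)"
  using assms(1)
proof induction
  case (freq \<tau>)
  show ?case using assms(2)
  proof induction
    case (freq \<tau>')
    show ?case by (rule freq_combination_freq_mult)
  next
    case (add F F')
    from freq_combination.add[OF add.IH] show ?case by (simp add: distrib_left)
  next
    case (scale F c)
    from freq_combination.scale[OF scale.IH, of c] show ?case by (simp add: mult.left_commute)
  next
    case (cong F F')
    show ?case by (rule freq_combination.cong[OF cong.IH]) (simp add: cong.hyps)
  qed
next
  case (add F1 F2)
  from freq_combination.add[OF add.IH] show ?case by (simp add: distrib_right)
next
  case (scale F1 c)
  from freq_combination.scale[OF scale.IH, of c] show ?case by (simp add: mult.assoc)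
next
  case (cong F1 F2)
  show ?case by (rule freq_combination.cong[OF cong.IH]) (simp add: cong.hyps)
qed

lemma order_invariant_agree:
  "order_invariant k G \<Longrightarrow> (\<And>i. i \<in> {1..k} \<Longrightarrow> x i = y i) \<Longrightarrow> G x = G y"
  by (rule order_invariantD) auto

text \<open>
  Since the marginals are uniform, the coordinate \<open>x $ c\<close> is the probability that a sample point is
  below \<open>x\<close> in direction \<open>c\<close>. Hence the following functions form a ring that separates points,
  and their integrals are linear combinations of pattern densities.
\<close>

definition sampled_function :: "(real ^ 'd::finite \<Rightarrow> real) \<Rightarrow> bool" where
  "sampled_function g \<longleftrightarrow> continuous_on (cbox 0 1) g \<and>
     (\<exists>l G. order_invariant (1 + l) G \<and> (\<forall>\<mu>\<in>permutons. \<forall>x\<in>cbox 0 1.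
        g x = (LINT y|PiM {1..l} (\<lambda>_. \<mu>). G (concat_points 1 l (\<lambda>_. x) y))))"

lemma measurable_sampled:
  fixes G :: "(nat \<Rightarrow> real ^ 'd::finite) \<Rightarrow> real"
  assumes G: "order_invariant (1 + l) G" and \<mu>: "\<mu> \<in> permutons" and x: "x \<in> cbox 0 1"
  shows "(\<lambda>y. G (concat_points 1 l (\<lambda>_. x) y)) \<in> borel_measurable (PiM {1..l} (\<lambda>_. \<mu>))"
proof (rule measurable_compose[OF _ order_invariant_measurable[OF G \<mu>]])
  show "concat_points 1 l (\<lambda>_. x) \<in> PiM {1..l} (\<lambda>_. \<mu>) \<rightarrow>\<^sub>M PiM {1..1 + l} (\<lambda>_. \<mu>)"
    by (rule measurable_concat_points) (use x permuton_space[OF \<mu>] in \<open>auto intro: measurable_component_singleton\<close>)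
qed

lemma integrable_sampled:
  fixes G :: "(nat \<Rightarrow> real ^ 'd::finite) \<Rightarrow> real"
  assumes G: "order_invariant (1 + l) G" and \<mu>: "\<mu> \<in> permutons" and x: "x \<in> cbox 0 1"
  shows "integrable (PiM {1..l} (\<lambda>_. \<mu>)) (\<lambda>y. G (concat_points 1 l (\<lambda>_. x) y))"
proof -
  interpret prob_space "PiM {1..l} (\<lambda>_. \<mu>)"
    by (rule prob_space_PiM_const[OF permuton_prob_space[OF \<mu>]])
  obtain B where "\<And>x. \<bar>G x\<bar> \<le> B" using order_invariant_bounded[OF G] by blast
  then show ?thesis
    by (intro integrable_const_bound[where B = B] measurable_sampled[OF assms]) auto
qed

text \<open>The two functions share the given point \<open>x\<close> but use disjoint auxiliary
  points, whose independence splits the integral. Sum and product of sampled functions are the cases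
  of interest for \<open>h\<close>.\<close>

lemma sampled_pair:
  fixes G1 G2 :: "(nat \<Rightarrow> real ^ 'd::finite) \<Rightarrow> real" and h :: "real \<Rightarrow> real \<Rightarrow> real"
  assumes G1: "order_invariant (1 + l1) G1" and G2: "order_invariant (1 + l2) G2"
  obtains G where "order_invariant (1 + (l1 + l2)) G"
    "\<And>\<mu> x. \<mu> \<in> permutons \<Longrightarrow> x \<in> cbox 0 1 \<Longrightarrow>
      (LINT y|PiM {1..l1 + l2} (\<lambda>_. \<mu>). G (concat_points 1 (l1 + l2) (\<lambda>_. x) y))
      = (LINT y|PiM {1..l1} (\<lambda>_. \<mu>). LINT z|PiM {1..l2} (\<lambda>_. \<mu>).
          h (G1 (concat_points 1 l1 (\<lambda>_. x) y)) (G2 (concat_points 1 l2 (\<lambda>_. x) z)))"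
proof -
  \<comment> \<open>Index 1, the given point, stays; the auxiliary points of \<open>G2\<close> move
    behind the \<open>l1\<close> auxiliary points of \<open>G1\<close>.\<close>
  define s where "s i = (if i = 1 then 1 else i + l1)" for i :: nat
  define G where "G x = h (G1 x) (G2 (\<lambda>i. x (s i)))" for x
  have s_in: "s i \<in> {1..1 + (l1 + l2)}" if "i \<in> {1..1 + l2}" for i
    using that by (auto simp: s_def)
  have G: "order_invariant (1 + (l1 + l2)) G"
    unfolding order_invariant_def
  proof (intro allI impI)
    fix x y :: "nat \<Rightarrow> real ^ 'd"
    assume xy: "\<forall>a\<in>{1..1 + (l1 + l2)}. \<forall>b\<in>{1..1 + (l1 + l2)}. \<forall>c. (x a $ c < x b $ c) = (y a $ c < y b $ c)"
    have "G1 x = G1 y" by (rule order_invariantD[OF G1]) (use xy in auto)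
    moreover have "G2 (\<lambda>i. x (s i)) = G2 (\<lambda>i. y (s i))"
      by (rule order_invariantD[OF G2]) (use xy s_in in blast)
    ultimately show "G x = G y" by (simp add: G_def)
  qed
  show thesis
  proof (rule that[OF G])
    fix \<mu> :: "(real ^ 'd) measure" and x :: "real ^ 'd"
    assume \<mu>: "\<mu> \<in> permutons" and x: "x \<in> cbox 0 1"
    obtain B where B: "\<And>x. \<bar>G x\<bar> \<le> B" using order_invariant_bounded[OF G] by blast
    have "G (concat_points 1 (l1 + l2) (\<lambda>_. x) (concat_points l1 l2 y z))
        = h (G1 (concat_points 1 l1 (\<lambda>_. x) y)) (G2 (concat_points 1 l2 (\<lambda>_. x) z))" for y z
    proof -
      have "G1 (concat_points 1 (l1 + l2) (\<lambda>_. x) (concat_points l1 l2 y z)) = G1 (concat_points 1 l1 (\<lambda>_. x) y)"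
        by (rule order_invariant_agree[OF G1]) (auto simp: concat_points_def)
      moreover have "G2 (\<lambda>i. concat_points 1 (l1 + l2) (\<lambda>_. x) (concat_points l1 l2 y z) (s i))
          = G2 (concat_points 1 l2 (\<lambda>_. x) z)"
        by (rule order_invariant_agree[OF G2]) (auto simp: concat_points_def s_def)
      ultimately show ?thesis by (simp add: G_def)
    qed
    then show "(LINT y|PiM {1..l1 + l2} (\<lambda>_. \<mu>). G (concat_points 1 (l1 + l2) (\<lambda>_. x) y))
      = (LINT y|PiM {1..l1} (\<lambda>_. \<mu>). LINT z|PiM {1..l2} (\<lambda>_. \<mu>).
          h (G1 (concat_points 1 l1 (\<lambda>_. x) y)) (G2 (concat_points 1 l2 (\<lambda>_. x) z)))"
      by (subst integral_concat_points[OF permuton_prob_space[OF \<mu>] measurable_sampled[OF G \<mu> x] B]) simp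
  qed
qed

lemma sampled_function_add:
  assumes "sampled_function g1" "sampled_function g2"
  shows "sampled_function (\<lambda>x. g1 x + g2 x)"
proof -
  obtain l1 G1 where G1: "order_invariant (1 + l1) G1" and g1: "\<And>\<mu> x. \<mu> \<in> permutons \<Longrightarrow> x \<in> cbox 0 1 \<Longrightarrow>
      g1 x = (LINT y|PiM {1..l1} (\<lambda>_. \<mu>). G1 (concat_points 1 l1 (\<lambda>_. x) y))"
    using assms(1) unfolding sampled_function_def by blast
  obtain l2 G2 where G2: "order_invariant (1 + l2) G2" and g2: "\<And>\<mu> x. \<mu> \<in> permutons \<Longrightarrow> x \<in> cbox 0 1 \<Longrightarrow>
      g2 x = (LINT y|PiM {1..l2} (\<lambda>_. \<mu>). G2 (concat_points 1 l2 (\<lambda>_. x) y))"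
    using assms(2) unfolding sampled_function_def by blast
  obtain G where G: "order_invariant (1 + (l1 + l2)) G"
    and eq: "\<And>\<mu> x. \<mu> \<in> permutons \<Longrightarrow> x \<in> cbox 0 1 \<Longrightarrow>
      (LINT y|PiM {1..l1 + l2} (\<lambda>_. \<mu>). G (concat_points 1 (l1 + l2) (\<lambda>_. x) y))
      = (LINT y|PiM {1..l1} (\<lambda>_. \<mu>). LINT z|PiM {1..l2} (\<lambda>_. \<mu>).
          (G1 (concat_points 1 l1 (\<lambda>_. x) y)) + (G2 (concat_points 1 l2 (\<lambda>_. x) z)))"
    using sampled_pair[OF G1 G2, of "(+)"] by blast
  have "g1 x + g2 x = (LINT y|PiM {1..l1 + l2} (\<lambda>_. \<mu>). G (concat_points 1 (l1 + l2) (\<lambda>_. x) y))"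
    if \<mu>: "\<mu> \<in> permutons" and x: "x \<in> cbox 0 1" for \<mu> x
  proof -
    interpret P: prob_space "PiM {1..l1} (\<lambda>_. \<mu>)"
      by (rule prob_space_PiM_const[OF permuton_prob_space[OF \<mu>]])
    interpret Q: prob_space "PiM {1..l2} (\<lambda>_. \<mu>)"
      by (rule prob_space_PiM_const[OF permuton_prob_space[OF \<mu>]])
    show ?thesis
      unfolding eq[OF \<mu> x] g1[OF \<mu> x] g2[OF \<mu> x]
      using integrable_sampled[OF G1 \<mu> x] integrable_sampled[OF G2 \<mu> x]
      by (simp add: P.prob_space Q.prob_space del: One_nat_def)
  qed
  moreover have "continuous_on (cbox 0 1) (\<lambda>x. g1 x + g2 x)"
    using assms unfolding sampled_function_def by (intro continuous_on_add) auto
  ultimately show ?thesis using G unfolding sampled_function_def by blast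
qed

lemma sampled_function_mult:
  assumes "sampled_function g1" "sampled_function g2"
  shows "sampled_function (\<lambda>x. g1 x * g2 x)"
proof -
  obtain l1 G1 where G1: "order_invariant (1 + l1) G1" and g1: "\<And>\<mu> x. \<mu> \<in> permutons \<Longrightarrow> x \<in> cbox 0 1 \<Longrightarrow>
      g1 x = (LINT y|PiM {1..l1} (\<lambda>_. \<mu>). G1 (concat_points 1 l1 (\<lambda>_. x) y))"
    using assms(1) unfolding sampled_function_def by blast
  obtain l2 G2 where G2: "order_invariant (1 + l2) G2" and g2: "\<And>\<mu> x. \<mu> \<in> permutons \<Longrightarrow> x \<in> cbox 0 1 \<Longrightarrow>
      g2 x = (LINT y|PiM {1..l2} (\<lambda>_. \<mu>). G2 (concat_points 1 l2 (\<lambda>_. x) y))"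
    using assms(2) unfolding sampled_function_def by blast
  obtain G where G: "order_invariant (1 + (l1 + l2)) G"
    and eq: "\<And>\<mu> x. \<mu> \<in> permutons \<Longrightarrow> x \<in> cbox 0 1 \<Longrightarrow>
      (LINT y|PiM {1..l1 + l2} (\<lambda>_. \<mu>). G (concat_points 1 (l1 + l2) (\<lambda>_. x) y))
      = (LINT y|PiM {1..l1} (\<lambda>_. \<mu>). LINT z|PiM {1..l2} (\<lambda>_. \<mu>).
          (G1 (concat_points 1 l1 (\<lambda>_. x) y)) * (G2 (concat_points 1 l2 (\<lambda>_. x) z)))"
    using sampled_pair[OF G1 G2, of "(*)"] by blast
  have "g1 x * g2 x = (LINT y|PiM {1..l1 + l2} (\<lambda>_. \<mu>). G (concat_points 1 (l1 + l2) (\<lambda>_. x) y))"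
    if \<mu>: "\<mu> \<in> permutons" and x: "x \<in> cbox 0 1" for \<mu> x
    unfolding eq[OF \<mu> x] g1[OF \<mu> x] g2[OF \<mu> x] by simp
  moreover have "continuous_on (cbox 0 1) (\<lambda>x. g1 x * g2 x)"
    using assms unfolding sampled_function_def by (intro continuous_on_mult) auto
  ultimately show ?thesis using G unfolding sampled_function_def by blast
qed

lemma sampled_function_const: "sampled_function (\<lambda>_. c)"
proof -
  have "c = (LINT y|PiM {1..0} (\<lambda>_. \<mu>). (\<lambda>_. c) (concat_points 1 0 (\<lambda>_. x) y))"
    if "\<mu> \<in> permutons" for \<mu> :: "(real ^ 'a) measure" and x :: "real ^ 'a"
    using prob_space.prob_space[OF prob_space_PiM_const[OF permuton_prob_space[OF that]], of "{1..0::nat}"]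
    by (simp only: lebesgue_integral_const real_scaleR_def mult_1)
  moreover have "order_invariant (1 + 0) (\<lambda>_ :: nat \<Rightarrow> real ^ 'a. c)" by (simp add: order_invariant_def)
  ultimately show ?thesis unfolding sampled_function_def by (blast intro: continuous_on_const)
qed

lemma sampled_function_coord: "sampled_function (\<lambda>x :: real ^ 'd::finite. x $ c)"
proof -
  define G :: "(nat \<Rightarrow> real ^ 'd) \<Rightarrow> real" where "G x = of_bool (x 2 $ c < x 1 $ c)" for x
  have G: "order_invariant (1 + 1) G"
    unfolding order_invariant_def
  proof (intro allI impI)
    fix x y :: "nat \<Rightarrow> real ^ 'd"
    assume xy: "\<forall>a\<in>{1..1 + 1}. \<forall>b\<in>{1..1 + 1}. \<forall>c. (x a $ c < x b $ c) = (y a $ c < y b $ c)"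
    have "(2::nat) \<in> {1..1 + 1}" "(1::nat) \<in> {1..1 + 1}" by auto
    with xy have "(x 2 $ c < x 1 $ c) = (y 2 $ c < y 1 $ c)" by blast
    then show "G x = G y" by (simp only: G_def)
  qed
  have "x $ c = (LINT y|PiM {1..1} (\<lambda>_. \<mu>). G (concat_points 1 1 (\<lambda>_. x) y))"
    if \<mu>: "\<mu> \<in> permutons" and x: "x \<in> cbox 0 1" for \<mu> x
  proof -
    interpret prob_space \<mu> by (rule permuton_prob_space[OF \<mu>])
    interpret product_sigma_finite "\<lambda>_. \<mu>" by unfold_locales
    note [measurable] = measurable_permuton_coord[OF \<mu>]
    have c: "x $ c \<in> {0..1}" using x by (auto simp: mem_box_cart)
    have "(LINT y|PiM {1..1} (\<lambda>_. \<mu>). G (concat_points 1 1 (\<lambda>_. x) y))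
        = (LINT y|PiM {1::nat} (\<lambda>_. \<mu>). indicator {z. z $ c < x $ c} (y 1))"
      by (rule Bochner_Integration.integral_cong) (auto simp: G_def concat_points_def indicator_def)
    also have "\<dots> = (LINT z|\<mu>. indicator {z. z $ c < x $ c} z)"
      by (rule product_integral_singleton) measurable
    also have "\<dots> = measure \<mu> {z \<in> space \<mu>. z $ c < x $ c}"
      by (simp add: Int_def conj_commute)
    also have "\<dots> = x $ c" by (rule measure_permuton_coord_less[OF \<mu> c])
    finally show ?thesis ..
  qed
  moreover have "continuous_on (cbox 0 1) (\<lambda>x :: real ^ 'd. x $ c)" by (intro continuous_intros)
  ultimately show ?thesis using G unfolding sampled_function_def by blast
qed

text \<open>Drawing \<open>x\<close> itself from the permuton makes it the first of
  \<open>1 + l\<close> sample points, so the integral of \<open>g\<close> is the expectation of an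
  order invariant function.\<close>

lemma freq_combination_sampled_function:
  fixes g :: "real ^ 'e::finite option \<Rightarrow> real"
  assumes "sampled_function g"
  shows "freq_combination (\<lambda>\<mu>. LINT x|\<mu>. g x)"
proof -
  obtain l G where G: "order_invariant (1 + l) G" and g: "\<And>\<mu> x. \<mu> \<in> permutons \<Longrightarrow> x \<in> cbox 0 1 \<Longrightarrow>
      g x = (LINT y|PiM {1..l} (\<lambda>_. \<mu>). G (concat_points 1 l (\<lambda>_. x) y))"
    and cont: "continuous_on (cbox 0 1) g"
    using assms(1) unfolding sampled_function_def by blast
  show ?thesis
  proof (rule freq_combination.cong)
    show "freq_combination (\<lambda>\<mu>. LINT x|PiM {1..1 + l} (\<lambda>_. \<mu>). G x)"
      by (rule freq_combination_integral[OF G]) simp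
    fix \<mu> :: "(real ^ 'e option) measure" assume \<mu>: "\<mu> \<in> permutons"
    interpret prob_space \<mu> by (rule permuton_prob_space[OF \<mu>])
    interpret product_sigma_finite "\<lambda>_. \<mu>" by unfold_locales
    obtain B where B: "\<And>x. \<bar>G x\<bar> \<le> B" using order_invariant_bounded[OF G] by blast
    have "(LINT x|PiM {1..1 + l} (\<lambda>_. \<mu>). G x)
        = (LINT x|PiM {1..1} (\<lambda>_. \<mu>). LINT y|PiM {1..l} (\<lambda>_. \<mu>). G (concat_points 1 l x y))"
      by (rule integral_concat_points[OF permuton_prob_space[OF \<mu>] order_invariant_measurable[OF G \<mu>] B])
    also have "\<dots> = (LINT x|PiM {1::nat} (\<lambda>_. \<mu>). g (x 1))"
    proof (rule Bochner_Integration.integral_cong)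
      fix x assume "x \<in> space (PiM {1::nat} (\<lambda>_. \<mu>))"
      then have "x 1 \<in> cbox 0 1" by (auto simp: space_PiM permuton_space[OF \<mu>] PiE_iff)
      moreover have "concat_points 1 l x y = concat_points 1 l (\<lambda>_. x 1) y" for y
        unfolding concat_points_def by (rule restrict_ext) (auto simp: le_antisym)
      ultimately show "(LINT y|PiM {1..l} (\<lambda>_. \<mu>). G (concat_points 1 l x y)) = g (x 1)"
        using g[OF \<mu>] by simp
    qed simp
    also have "\<dots> = (LINT x|\<mu>. g x)"
      by (rule product_integral_singleton)
        (simp add: measurable_cong_sets[OF permuton_sets[OF \<mu>] refl] borel_measurable_continuous_on_restrict[OF cont])
    finally show "(LINT x|\<mu>. g x) = (LINT x|PiM {1..1 + l} (\<lambda>_. \<mu>). G x)" ..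
  qed
qed

lemma integrable_permuton_continuous:
  assumes "\<mu> \<in> permutons" "continuous_on (cbox 0 1) g"
  shows "integrable \<mu> (g :: real ^ 'd::finite \<Rightarrow> real)"
proof -
  interpret prob_space \<mu> by (rule permuton_prob_space[OF assms(1)])
  obtain B where "\<And>x. x \<in> cbox 0 1 \<Longrightarrow> \<bar>g x\<bar> \<le> B"
    using compact_imp_bounded[OF compact_continuous_image[OF assms(2) compact_cbox]]
    by (auto simp: bounded_iff)
  then show ?thesis
    by (intro integrable_const_bound[where B = B] AE_I2)
      (simp_all add: permuton_space[OF assms(1)] measurable_cong_sets[OF permuton_sets[OF assms(1)] refl]
        borel_measurable_continuous_on_restrict[OF assms(2)])
qed

text \<open>Stone-Weierstrass provides one approximant \<open>g'\<close> for all permutons at once.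
  That uniformity is what later makes the inverse of \<open>pattern_densities\<close>
  continuous.\<close>

lemma integral_approx_freq_combination:
  fixes g :: "real ^ 'e::finite option \<Rightarrow> real"
  assumes g: "continuous_on (cbox 0 1) g" and "\<epsilon> > 0"
  obtains F where "freq_combination F" "\<And>\<mu>. \<mu> \<in> permutons \<Longrightarrow> \<bar>(LINT x|\<mu>. g x) - F \<mu>\<bar> \<le> \<epsilon>"
proof -
  interpret function_ring_on "Collect sampled_function" "cbox 0 1 :: (real ^ 'e option) set"
  proof
    show "\<exists>f\<in>Collect sampled_function. f x \<noteq> f y" if xy: "x \<noteq> y" for x y :: "real ^ 'e option"
    proof -
      obtain c where "x $ c \<noteq> y $ c" using xy by (auto simp: vec_eq_iff)
      with sampled_function_coord[of c] show ?thesis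
        by (intro bexI[of _ "\<lambda>x. x $ c"]) simp_all
    qed
    show "continuous_on (cbox 0 1) f" if "f \<in> Collect sampled_function" for f :: "real ^ 'e option \<Rightarrow> real"
      using that by (simp add: sampled_function_def)
  qed (simp_all add: sampled_function_const sampled_function_add sampled_function_mult)
  obtain g' where g': "sampled_function g'" and close: "\<And>x. x \<in> cbox 0 1 \<Longrightarrow> \<bar>g x - g' x\<bar> < \<epsilon>"
    using Stone_Weierstrass_basic[OF assms] by blast
  show thesis
  proof (rule that[OF freq_combination_sampled_function[OF g']])
    fix \<mu> :: "(real ^ 'e option) measure" assume \<mu>: "\<mu> \<in> permutons"
    interpret prob_space \<mu> by (rule permuton_prob_space[OF \<mu>])
    have "continuous_on (cbox 0 1) g'" using g' by (simp add: sampled_function_def)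
    note int = integrable_permuton_continuous[OF \<mu> g] integrable_permuton_continuous[OF \<mu> this]
    have "\<bar>(LINT x|\<mu>. g x) - (LINT x|\<mu>. g' x)\<bar> = \<bar>LINT x|\<mu>. g x - g' x\<bar>"
      using int by simp
    also have "\<dots> \<le> (LINT x|\<mu>. \<bar>g x - g' x\<bar>)" by (rule integral_abs_bound)
    also have "\<dots> \<le> (LINT x|\<mu>. \<epsilon>)"
      using int close by (intro integral_mono) (auto simp: permuton_space[OF \<mu>] intro: less_imp_le)
    finally show "\<bar>(LINT x|\<mu>. g x) - (LINT x|\<mu>. g' x)\<bar> \<le> \<epsilon>" by (simp add: prob_space)
  qed
qed

section \<open>The permuton of a permutation\<close>

text \<open>The set lies between \<open>box a b\<close> and \<open>cbox a b\<close>, which have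
  equal volume. Half-open boxes arise as level sets of ceilings.\<close>

lemma emeasure_half_open_box:
  fixes a b :: "real ^ 'd::finite"
  assumes "\<And>c. a $ c \<le> b $ c"
  shows "emeasure lborel {x. \<forall>c. a $ c < x $ c \<and> x $ c \<le> b $ c} = ennreal (\<Prod>c\<in>UNIV. b $ c - a $ c)"
proof -
  let ?H = "{x. \<forall>c. a $ c < x $ c \<and> x $ c \<le> b $ c}"
  have le: "a \<bullet> v \<le> b \<bullet> v" if "v \<in> Basis" for v
    using that assms by (auto simp: Basis_vec_def inner_axis)
  have "cbox a b \<noteq> {}" using assms by (auto simp: interval_ne_empty_cart)
  then have "(\<Prod>v\<in>Basis. (b - a) \<bullet> v) = (\<Prod>c\<in>UNIV. b $ c - a $ c)"
    using content_cbox_cart[of a b] measure_lborel_cbox[OF le] by simp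
  then have "emeasure lborel (box a b) = ennreal (\<Prod>c\<in>UNIV. b $ c - a $ c)"
    "emeasure lborel (cbox a b) = ennreal (\<Prod>c\<in>UNIV. b $ c - a $ c)"
    using le by simp_all
  moreover have "?H \<in> sets lborel" by measurable
  then have "emeasure lborel (box a b) \<le> emeasure lborel ?H" "emeasure lborel ?H \<le> emeasure lborel (cbox a b)"
    by (auto intro!: emeasure_mono simp: mem_box_cart less_imp_le)
  ultimately show ?thesis by simp
qed

lemma nat_ceiling_eq_iff:
  assumes "m \<ge> 1"
  shows "nat \<lceil>y :: real\<rceil> = m \<longleftrightarrow> real m - 1 < y \<and> y \<le> real m"
proof -
  have "nat \<lceil>y\<rceil> = m \<longleftrightarrow> \<lceil>y\<rceil> = int m" using assms by linarith
  also have "\<dots> \<longleftrightarrow> real m - 1 < y \<and> y \<le> real m" by (simp add: ceiling_eq_iff)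
  finally show ?thesis .
qed

text \<open>The first coordinate is treated as the identity permutation, so that all d marginals are
  handled by one argument.\<close>

definition cell_index :: "'e::finite dperm \<Rightarrow> nat \<Rightarrow> 'e option \<Rightarrow> nat" where
  "cell_index \<sigma> i c = (case c of None \<Rightarrow> i | Some j \<Rightarrow> papp \<sigma> i $ j)"

definition perm_cell :: "'e::finite dperm \<Rightarrow> nat \<Rightarrow> (real ^ 'e option) set" where
  "perm_cell \<sigma> i = {x. \<forall>c. nat \<lceil>real (psize \<sigma>) * x $ c\<rceil> = cell_index \<sigma> i c}"

lemma cell_index_permutes: "(\<lambda>i. cell_index \<sigma> i c) permutes {1..psize \<sigma>}"
  using papp_permutes[of \<sigma>] permutes_id[of "{1..psize \<sigma>}"]
  by (cases c) (simp_all add: cell_index_def id_def)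

lemma cell_index_in: "i \<in> {1..psize \<sigma>} \<Longrightarrow> cell_index \<sigma> i c \<in> {1..psize \<sigma>}"
  using permutes_in_image[OF cell_index_permutes[of \<sigma> c], of i] by simp

lemma perm_cell_alt:
  assumes i: "i \<in> {1..psize \<sigma>}"
  shows "perm_cell \<sigma> i = {x. \<forall>c. (real (cell_index \<sigma> i c) - 1) / psize \<sigma> < x $ c \<and>
    x $ c \<le> cell_index \<sigma> i c / psize \<sigma>}"
proof -
  have pos: "real (psize \<sigma>) > 0" using psize_ge_1[of \<sigma>] by simp
  have "cell_index \<sigma> i c \<ge> 1" for c using cell_index_in[OF i, of c] by simp
  then show ?thesis
    unfolding perm_cell_def using pos
    by (auto simp: nat_ceiling_eq_iff pos_divide_less_eq pos_le_divide_eq mult.commute)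
qed

lemma sets_perm_cell: "i \<in> {1..psize \<sigma>} \<Longrightarrow> perm_cell \<sigma> i \<in> sets borel"
  by (subst perm_cell_alt) (assumption, measurable)

lemma perm_cell_subset_cube:
  assumes i: "i \<in> {1..psize \<sigma>}"
  shows "perm_cell \<sigma> i \<subseteq> cbox 0 1"
proof
  fix x assume x: "x \<in> perm_cell \<sigma> i"
  have "0 \<le> x $ c \<and> x $ c \<le> 1" for c
  proof -
    have s: "1 \<le> real (cell_index \<sigma> i c)" "real (cell_index \<sigma> i c) \<le> psize \<sigma>"
      using cell_index_in[OF i, of c] by auto
    have "0 \<le> (real (cell_index \<sigma> i c) - 1) / psize \<sigma>" using s by simp
    moreover have "cell_index \<sigma> i c / real (psize \<sigma>) \<le> 1" using s by simp
    ultimately show ?thesis using x unfolding perm_cell_alt[OF i] by (auto intro: less_imp_le order.trans)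
  qed
  then show "x \<in> cbox 0 1" by (simp add: mem_box_cart)
qed

text \<open>If \<open>x $ None = 0\<close>, the ceiling is the index 0, which \<open>papp\<close>
  fixes. The density set of \<open>permuton_of\<close> therefore contains points outside all cells,
  for instance the origin; they lie in a null hyperplane.\<close>

lemma perm_cell_iff:
  assumes x: "x \<in> cbox 0 1" "x $ None \<noteq> 0"
  shows "nat \<lceil>real (psize \<sigma>) * x $ None\<rceil> \<in> {1..psize \<sigma>}"
    and "i \<in> {1..psize \<sigma>} \<Longrightarrow> x \<in> perm_cell \<sigma> i \<longleftrightarrow> i = nat \<lceil>real (psize \<sigma>) * x $ None\<rceil> \<and>
      (\<forall>j. papp \<sigma> (nat \<lceil>real (psize \<sigma>) * x $ None\<rceil>) $ j = nat \<lceil>real (psize \<sigma>) * x $ Some j\<rceil>)"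
proof -
  have "0 < x $ None" "x $ None \<le> 1"
    using x by (auto simp: mem_box_cart less_le)
  moreover have "real (psize \<sigma>) > 0" using psize_ge_1[of \<sigma>] by simp
  ultimately have "0 < real (psize \<sigma>) * x $ None" "real (psize \<sigma>) * x $ None \<le> psize \<sigma>"
    by simp_all
  then have "0 < \<lceil>real (psize \<sigma>) * x $ None\<rceil>" "\<lceil>real (psize \<sigma>) * x $ None\<rceil> \<le> int (psize \<sigma>)"
    by (simp_all only: zero_less_ceiling ceiling_le_iff of_int_of_nat_eq)
  then show "nat \<lceil>real (psize \<sigma>) * x $ None\<rceil> \<in> {1..psize \<sigma>}"
    unfolding atLeastAtMost_iff by linarith
  show "x \<in> perm_cell \<sigma> i \<longleftrightarrow> i = nat \<lceil>real (psize \<sigma>) * x $ None\<rceil> \<and>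
      (\<forall>j. papp \<sigma> (nat \<lceil>real (psize \<sigma>) * x $ None\<rceil>) $ j = nat \<lceil>real (psize \<sigma>) * x $ Some j\<rceil>)"
    unfolding perm_cell_def mem_Collect_eq split_option_all
    by (auto simp: cell_index_def)
qed

abbreviation perm_density_set :: "'e::finite dperm \<Rightarrow> (real ^ 'e option) set" where
  "perm_density_set \<sigma> \<equiv> {x. \<forall>j. papp \<sigma> (nat \<lceil>real (psize \<sigma>) * x $ None\<rceil>) $ j
     = nat \<lceil>real (psize \<sigma>) * x $ Some j\<rceil>}"

lemma indicator_perm_density_set:
  assumes x: "x \<in> cbox 0 1" "x $ None \<noteq> 0"
  shows "indicator (perm_density_set \<sigma>) x = (\<Sum>i\<in>{1..psize \<sigma>}. indicator (perm_cell \<sigma> i) x :: ennreal)"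
proof -
  let ?i = "nat \<lceil>real (psize \<sigma>) * x $ None\<rceil>"
  have "(\<Sum>i\<in>{1..psize \<sigma>}. indicator (perm_cell \<sigma> i) x :: ennreal)
      = (\<Sum>i\<in>{1..psize \<sigma>}. if i = ?i then indicator (perm_density_set \<sigma>) x else 0)"
    by (rule sum.cong[OF refl]) (simp only: indicator_def perm_cell_iff(2)[OF x] mem_Collect_eq, simp)
  also have "\<dots> = indicator (perm_density_set \<sigma>) x"
    using perm_cell_iff(1)[OF x, of \<sigma>] by (subst sum.delta) simp_all
  finally show ?thesis ..
qed

lemma AE_first_coord_nonzero: "AE x in lborel. (x :: real ^ 'e::finite option) $ None \<noteq> 0"
proof -
  have "negligible {x :: real ^ 'e option. x $ None = 0}" by (rule negligible_standard_hyperplane_cart)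
  moreover have "{x :: real ^ 'e option. x $ None = 0} \<in> sets lborel" by measurable
  ultimately have "{x :: real ^ 'e option. x $ None = 0} \<in> null_sets lborel"
    by (simp add: negligible_iff_null_sets null_sets_completion_iff)
  from AE_not_in[OF this] show ?thesis by simp
qed

lemma sets_perm_density_set: "perm_density_set \<sigma> \<in> sets borel"
proof -
  have m: "(\<lambda>x. nat \<lceil>real (psize \<sigma>) * x $ c\<rceil>) \<in> borel \<rightarrow>\<^sub>M count_space UNIV" for c :: "'a option"
    by measurable
  have [measurable]: "(\<lambda>x. papp \<sigma> (nat \<lceil>real (psize \<sigma>) * x $ None\<rceil>) $ j) \<in> borel \<rightarrow>\<^sub>M count_space UNIV" for j
    using measurable_compose[OF m[of None], of "\<lambda>i. papp \<sigma> i $ j" "count_space UNIV"] by simp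
  have "{x \<in> space borel. \<forall>j\<in>UNIV. papp \<sigma> (nat \<lceil>real (psize \<sigma>) * x $ None\<rceil>) $ j
      = nat \<lceil>real (psize \<sigma>) * x $ Some j\<rceil>} \<in> sets borel"
  proof (rule sets.sets_Collect_finite_All)
    fix j
    show "{x \<in> space borel. papp \<sigma> (nat \<lceil>real (psize \<sigma>) * x $ None\<rceil>) $ j
      = nat \<lceil>real (psize \<sigma>) * x $ Some j\<rceil>} \<in> sets borel" by measurable
  qed simp
  then show ?thesis by simp
qed

lemma emeasure_permuton_of:
  assumes A: "A \<in> sets borel" "A \<subseteq> cbox 0 1"
  shows "emeasure (permuton_of \<sigma>) A
    = ennreal (real (psize \<sigma>) ^ CARD('e)) * (\<Sum>i\<in>{1..psize \<sigma>}. emeasure lborel (perm_cell (\<sigma> :: 'e::finite dperm) i \<inter> A))"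
proof -
  let ?R = "restrict_space lborel (cbox 0 1) :: (real ^ 'e option) measure"
  let ?n = "ennreal (real (psize \<sigma>) ^ CARD('e))"
  note [measurable] = sets_perm_density_set[of \<sigma>] A(1)
  have meas: "(\<lambda>x. ?n * indicator (perm_density_set \<sigma>) x) \<in> borel_measurable ?R"
    by (rule measurable_restrict_space1) measurable
  have cA: "perm_cell \<sigma> i \<inter> A \<in> sets lborel" if "i \<in> {1..psize \<sigma>}" for i
    using sets_perm_cell[OF that] A(1) by simp
  have "A \<in> sets ?R" using A by (simp add: sets_restrict_space_iff)
  then have "emeasure (permuton_of \<sigma>) A
      = (\<integral>\<^sup>+x. ?n * indicator (perm_density_set \<sigma>) x * indicator A x \<partial>?R)"
    unfolding permuton_of_def by (subst emeasure_density[OF meas]) auto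
  also have "\<dots> = (\<integral>\<^sup>+x. ?n * indicator (perm_density_set \<sigma>) x * indicator A x * indicator (cbox 0 1) x \<partial>lborel)"
    by (rule nn_integral_restrict_space) simp
  also have "\<dots> = (\<integral>\<^sup>+x. ?n * (\<Sum>i\<in>{1..psize \<sigma>}. indicator (perm_cell \<sigma> i \<inter> A) x) \<partial>lborel)"
  proof (rule nn_integral_cong_AE)
    show "AE x in lborel. ?n * indicator (perm_density_set \<sigma>) x * indicator A x * indicator (cbox 0 1) x
      = ?n * (\<Sum>i\<in>{1..psize \<sigma>}. indicator (perm_cell \<sigma> i \<inter> A) x)"
      using AE_first_coord_nonzero
    proof eventually_elim
      case (elim x)
      show ?case
      proof (cases "x \<in> A")
        case True
        with A have "x \<in> cbox 0 1" by blast
        from indicator_perm_density_set[OF this elim, of \<sigma>] True this show ?thesis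
          by (simp add: indicator_inter_arith)
      qed simp
    qed
  qed
  also have "\<dots> = ?n * (\<integral>\<^sup>+x. (\<Sum>i\<in>{1..psize \<sigma>}. indicator (perm_cell \<sigma> i \<inter> A) x) \<partial>lborel)"
    by (intro nn_integral_cmult borel_measurable_sum borel_measurable_indicator cA)
  also have "(\<integral>\<^sup>+x. (\<Sum>i\<in>{1..psize \<sigma>}. indicator (perm_cell \<sigma> i \<inter> A) x) \<partial>lborel)
      = (\<Sum>i\<in>{1..psize \<sigma>}. \<integral>\<^sup>+x. indicator (perm_cell \<sigma> i \<inter> A) x \<partial>lborel)"
    by (intro nn_integral_sum borel_measurable_indicator cA)
  also have "\<dots> = (\<Sum>i\<in>{1..psize \<sigma>}. emeasure lborel (perm_cell \<sigma> i \<inter> A))"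
    by (intro sum.cong refl nn_integral_indicator cA)
  finally show ?thesis .
qed

text \<open>The exponent counts the d - 1 uncut sides. The cut side is written as a difference of
  truncations so that the sum over all cells telescopes.\<close>

lemma emeasure_perm_cell_le:
  fixes \<sigma> :: "'e::finite dperm"
  assumes i: "i \<in> {1..psize \<sigma>}" and t: "0 \<le> t"
  shows "emeasure lborel (perm_cell \<sigma> i \<inter> {x. x $ c \<le> t}) = ennreal ((1 / psize \<sigma>) ^ CARD('e) *
    (min t (cell_index \<sigma> i c / psize \<sigma>) - min t ((real (cell_index \<sigma> i c) - 1) / psize \<sigma>)))"
proof (cases "t < (real (cell_index \<sigma> i c) - 1) / psize \<sigma>")
  case True
  have "(real (cell_index \<sigma> i c) - 1) / psize \<sigma> \<le> cell_index \<sigma> i c / psize \<sigma>"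
    by (simp add: divide_right_mono)
  with True have "min t (cell_index \<sigma> i c / psize \<sigma>) = t" "min t ((real (cell_index \<sigma> i c) - 1) / psize \<sigma>) = t"
    by simp_all
  moreover have "perm_cell \<sigma> i \<inter> {x. x $ c \<le> t} = {}"
    using True unfolding perm_cell_alt[OF i] by (auto simp: not_le dest!: spec[of _ c])
  ultimately show ?thesis by simp
next
  case False
  define a where "a c' = (real (cell_index \<sigma> i c') - 1) / psize \<sigma>" for c'
  define b where "b c' = cell_index \<sigma> i c' / real (psize \<sigma>)" for c'
  define b' where "b' c' = (if c' = c then min t (b c') else b c')" for c'
  have ba: "b c' - a c' = 1 / psize \<sigma>" for c' by (simp add: a_def b_def diff_divide_distrib)
  have "1 / real (psize \<sigma>) \<ge> 0" by simp
  then have ab: "a c' \<le> b c'" for c' using ba[of c'] by linarith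
  have ab': "a c' \<le> b' c'" for c' using ab[of c'] False by (auto simp: b'_def a_def)
  have "perm_cell \<sigma> i \<inter> {x. x $ c \<le> t} = {x. \<forall>c'. (\<chi> c. a c) $ c' < x $ c' \<and> x $ c' \<le> (\<chi> c. b' c) $ c'}"
    unfolding perm_cell_alt[OF i] by (auto simp: a_def b_def b'_def)
  then have "emeasure lborel (perm_cell \<sigma> i \<inter> {x. x $ c \<le> t})
      = emeasure lborel {x. \<forall>c'. (\<chi> c. a c) $ c' < x $ c' \<and> x $ c' \<le> (\<chi> c. b' c) $ c'}" by simp
  also have "\<dots> = ennreal (\<Prod>c'\<in>UNIV. (\<chi> c. b' c) $ c' - (\<chi> c. a c) $ c')"
    by (rule emeasure_half_open_box) (simp add: ab')
  also have "(\<Prod>c'\<in>UNIV. (\<chi> c. b' c) $ c' - (\<chi> c. a c) $ c') = (b' c - a c) * (\<Prod>c'\<in>UNIV - {c}. b' c' - a c')"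
    by (simp add: prod.remove[of UNIV c])
  also have "(\<Prod>c'\<in>UNIV - {c}. b' c' - a c') = (\<Prod>c'\<in>UNIV - {c}. 1 / psize \<sigma>)"
    by (rule prod.cong) (simp_all add: b'_def ba)
  also have "\<dots> = (1 / psize \<sigma>) ^ CARD('e)" by (simp add: card_Diff_singleton)
  also have "b' c - a c = min t (b c) - min t (a c)" using False by (simp add: b'_def a_def)
  finally show ?thesis by (simp add: a_def b_def mult.commute)
qed

text \<open>Along each coordinate the cell indices run through \<open>{1..psize \<sigma>}\<close>
  exactly once. Sorted in that order, the cut lengths telescope to \<open>min t 1\<close>, and the
  density cancels the volume of the remaining sides.\<close>

lemma emeasure_permuton_of_coord_le:
  fixes \<sigma> :: "'e::finite dperm"
  assumes t: "0 \<le> t"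
  shows "emeasure (permuton_of \<sigma>) {x \<in> cbox 0 1. x $ c \<le> t} = ennreal (min t 1)"
proof -
  let ?n = "real (psize \<sigma>)"
  have n: "?n > 0" using psize_ge_1[of \<sigma>] by simp
  define h where "h m = min t (real m / ?n) - min t ((real m - 1) / ?n)" for m
  have h0: "0 \<le> h m" for m
  proof -
    have "(real m - 1) / ?n \<le> real m / ?n" by (simp add: divide_right_mono)
    then show ?thesis unfolding h_def by linarith
  qed
  have meas: "{x :: real ^ 'e option \<in> cbox 0 1. x $ c \<le> t} \<in> sets borel"
  proof -
    have "{x :: real ^ 'e option \<in> cbox 0 1. x $ c \<le> t} = cbox 0 1 \<inter> {x. x $ c \<le> t}" by auto
    also have "\<dots> \<in> sets borel" by measurable
    finally show ?thesis .
  qed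
  have "emeasure (permuton_of \<sigma>) {x \<in> cbox 0 1. x $ c \<le> t} = ennreal (?n ^ CARD('e)) *
      (\<Sum>i\<in>{1..psize \<sigma>}. emeasure lborel (perm_cell \<sigma> i \<inter> {x \<in> cbox 0 1. x $ c \<le> t}))"
    by (rule emeasure_permuton_of[OF meas]) auto
  also have "(\<Sum>i\<in>{1..psize \<sigma>}. emeasure lborel (perm_cell \<sigma> i \<inter> {x \<in> cbox 0 1. x $ c \<le> t}))
      = (\<Sum>i\<in>{1..psize \<sigma>}. ennreal ((1 / ?n) ^ CARD('e) * h (cell_index \<sigma> i c)))"
  proof (rule sum.cong[OF refl])
    fix i assume i: "i \<in> {1..psize \<sigma>}"
    have "perm_cell \<sigma> i \<inter> {x \<in> cbox 0 1. x $ c \<le> t} = perm_cell \<sigma> i \<inter> {x. x $ c \<le> t}"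
      using perm_cell_subset_cube[OF i] by blast
    then show "emeasure lborel (perm_cell \<sigma> i \<inter> {x \<in> cbox 0 1. x $ c \<le> t})
        = ennreal ((1 / ?n) ^ CARD('e) * h (cell_index \<sigma> i c))"
      unfolding h_def using emeasure_perm_cell_le[OF i t, of c] by simp
  qed
  also have "\<dots> = ennreal (\<Sum>i\<in>{1..psize \<sigma>}. (1 / ?n) ^ CARD('e) * h (cell_index \<sigma> i c))"
    using h0 by (intro sum_ennreal) simp
  also have "(\<Sum>i\<in>{1..psize \<sigma>}. (1 / ?n) ^ CARD('e) * h (cell_index \<sigma> i c))
      = (1 / ?n) ^ CARD('e) * (\<Sum>i\<in>{1..psize \<sigma>}. h (cell_index \<sigma> i c))"
    by (rule sum_distrib_left[symmetric])
  also have "(\<Sum>i\<in>{1..psize \<sigma>}. h (cell_index \<sigma> i c)) = (\<Sum>m\<in>{1..psize \<sigma>}. h m)"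
    using sum.permute[OF cell_index_permutes, of h \<sigma> c] by (simp add: comp_def)
  \<comment> \<open>As \<open>m\<close> is positive here, the predecessor may be taken in the
    natural numbers, the form that telescopes.\<close>
  also have "(\<Sum>m\<in>{1..psize \<sigma>}. h m) = (\<Sum>m\<in>{1..psize \<sigma>}. min t (real m / ?n) - min t (real (m - 1) / ?n))"
    by (rule sum.cong) (auto simp: h_def of_nat_diff)
  also have "\<dots> = min t 1"
  proof -
    have "(\<Sum>m\<in>{0 + 1..N}. min t (real m / ?n) - min t (real (m - 1) / ?n)) = min t (real N / ?n) - min t (real 0 / ?n)" for N
      by (induction N) (auto simp: atLeastAtMostSuc_conv)
    from this[of "psize \<sigma>"] show ?thesis using n t by simp
  qed
  also have "ennreal (?n ^ CARD('e)) * ennreal ((1 / ?n) ^ CARD('e) * min t 1) = ennreal (min t 1)"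
    using n t by (simp add: ennreal_mult[symmetric] power_one_over)
  finally show ?thesis .
qed

lemma space_permuton_of: "space (permuton_of \<sigma>) = cbox 0 1"
  by (simp add: permuton_of_def space_restrict_space)

lemma sets_permuton_of: "sets (permuton_of \<sigma>) = sets (restrict_space borel (cbox 0 1))"
  by (simp add: permuton_of_def sets_restrict_space)

lemma permuton_of_in_permutons: "permuton_of (\<sigma> :: 'e::finite dperm) \<in> permutons"
proof -
  \<comment> \<open>For \<open>t = 1\<close> the marginal formula is the total mass.\<close>
  have "{x :: real ^ 'e option \<in> cbox 0 1. x $ None \<le> 1} = cbox 0 1" by (auto simp: mem_box_cart)
  then have "emeasure (permuton_of \<sigma>) (space (permuton_of \<sigma>)) = 1"
    using emeasure_permuton_of_coord_le[of 1 \<sigma> None] by (simp add: space_permuton_of)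
  then interpret prob_space "permuton_of \<sigma>" by (rule prob_spaceI)
  have "distr (permuton_of \<sigma>) borel (\<lambda>x. x $ c) = uniform_measure lborel {0..1}" for c
  proof (rule cdf_unique)
    have meas: "(\<lambda>x. x $ c) \<in> borel_measurable (permuton_of \<sigma>)"
      by (simp add: measurable_cong_sets[OF sets_permuton_of refl] measurable_restrict_space1)
    show "real_distribution (distr (permuton_of \<sigma>) borel (\<lambda>x. x $ c))"
      unfolding real_distribution_def real_distribution_axioms_def
      using prob_space_distr[OF meas] by simp
    show "real_distribution (uniform_measure lborel {0..1::real})"
      unfolding real_distribution_def real_distribution_axioms_def
      by (auto intro!: prob_space_uniform_measure)
    show "cdf (distr (permuton_of \<sigma>) borel (\<lambda>x. x $ c)) = cdf (uniform_measure lborel {0..1::real})"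
    proof
      fix t :: real
      have "cdf (distr (permuton_of \<sigma>) borel (\<lambda>x. x $ c)) t = measure (permuton_of \<sigma>) {x \<in> cbox 0 1. x $ c \<le> t}"
        unfolding cdf_def by (subst measure_distr[OF meas])
          (auto simp: space_permuton_of intro!: arg_cong[where f = "measure (permuton_of \<sigma>)"])
      also have "\<dots> = max 0 (min t 1)"
      proof (cases "0 \<le> t")
        case True
        then show ?thesis using emeasure_permuton_of_coord_le[OF True, of \<sigma> c] by (simp add: measure_def)
      next
        case False
        then have "\<not> x $ c \<le> t" if "x \<in> cbox 0 1" for x :: "real ^ 'e option"
          using that unfolding mem_box_cart by (metis order.trans zero_index)
        then have eq: "{x :: real ^ 'e option \<in> cbox 0 1. x $ c \<le> t} = {}" by blast
        show ?thesis unfolding eq using False by simp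
      qed
      also have "max 0 (min t 1) = measure lborel ({0..1} \<inter> {..t})"
      proof -
        have "{0..1} \<inter> {..t} = {0..min t 1}" by auto
        then show ?thesis by (cases "0 \<le> t") auto
      qed
      also have "\<dots> = cdf (uniform_measure lborel {0..1::real}) t"
        unfolding cdf_def by (subst measure_uniform_measure) auto
      finally show "cdf (distr (permuton_of \<sigma>) borel (\<lambda>x. x $ c)) t = cdf (uniform_measure lborel {0..1::real}) t" .
    qed
  qed
  then show ?thesis unfolding permutons_def using prob_space_axioms sets_permuton_of by blast
qed

text \<open>Inside the cube and off the null hyperplane \<open>x $ None = 0\<close>, the density is
  positive only on cells.\<close>

lemma AE_permuton_of_cell: "AE x in permuton_of \<sigma>. \<exists>i\<in>{1..psize \<sigma>}. x \<in> perm_cell \<sigma> i"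
proof -
  note [measurable] = sets_perm_density_set[of \<sigma>]
  have meas: "(\<lambda>x. ennreal (real (psize \<sigma>) ^ CARD('a)) * indicator (perm_density_set \<sigma>) x)
      \<in> borel_measurable (restrict_space lborel (cbox 0 1))"
    by (rule measurable_restrict_space1) measurable
  have "AE x in restrict_space lborel (cbox 0 1). 0 < ennreal (real (psize \<sigma>) ^ CARD('a)) * indicator (perm_density_set \<sigma>) x
      \<longrightarrow> (\<exists>i\<in>{1..psize \<sigma>}. x \<in> perm_cell \<sigma> i)"
  proof (subst AE_restrict_space_iff)
    show "AE x in lborel. x \<in> cbox 0 1 \<longrightarrow> 0 < ennreal (real (psize \<sigma>) ^ CARD('a)) * indicator (perm_density_set \<sigma>) x
      \<longrightarrow> (\<exists>i\<in>{1..psize \<sigma>}. x \<in> perm_cell \<sigma> i)"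
      using AE_first_coord_nonzero
    proof eventually_elim
      case (elim x)
      show ?case
      proof (intro impI)
        assume x: "x \<in> cbox 0 1" and pos: "0 < ennreal (real (psize \<sigma>) ^ CARD('a)) * indicator (perm_density_set \<sigma>) x"
        have "x \<in> perm_density_set \<sigma>"
        proof (rule ccontr)
          assume "x \<notin> perm_density_set \<sigma>"
          then have "indicator (perm_density_set \<sigma>) x = (0 :: ennreal)" by (rule indicator_simps(2))
          with pos show False by (simp only: mult_zero_right less_irrefl)
        qed
        with perm_cell_iff(2)[OF x elim perm_cell_iff(1)[OF x elim], of \<sigma>] perm_cell_iff(1)[OF x elim, of \<sigma>]
        show "\<exists>i\<in>{1..psize \<sigma>}. x \<in> perm_cell \<sigma> i" by blast
      qed
    qed
  qed simp
  then show ?thesis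
    unfolding permuton_of_def by (subst AE_density[OF meas])
qed

section \<open>Patterns of points lying in cells\<close>

lemma sorted_list_of_set_nth_rank:
  assumes "finite I" "m \<in> I"
  shows "sorted_list_of_set I ! (card {m' \<in> I. m' \<le> m} - 1) = (m :: nat)"
proof -
  let ?L = "sorted_list_of_set I"
  have set: "set ?L = I" and sorted: "sorted_wrt (<) ?L" using assms(1) by simp_all
  obtain p where p: "p < length ?L" "?L ! p = m"
    using assms(2) set by (metis in_set_conv_nth)
  have mono: "?L ! i < ?L ! j" if "i < j" "j < length ?L" for i j
    using sorted_wrt_nth_less[OF sorted that] .
  have "{m' \<in> I. m' \<le> m} = (!) ?L ` {..p}"
  proof (rule set_eqI, rule iffI)
    fix x assume x: "x \<in> {m' \<in> I. m' \<le> m}"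
    then obtain i where i: "i < length ?L" "?L ! i = x" using set by (metis (lifting) in_set_conv_nth mem_Collect_eq)
    then have "i \<le> p" using mono[of p i] x p by (cases "p < i") auto
    with i show "x \<in> (!) ?L ` {..p}" by blast
  next
    fix x assume "x \<in> (!) ?L ` {..p}"
    then obtain i where i: "i \<le> p" "x = ?L ! i" by blast
    have "?L ! i \<le> ?L ! p" using mono[of i p] i p by (cases "i = p") auto
    moreover have "?L ! i \<in> I" using i p set nth_mem[of i ?L] by simp
    ultimately show "x \<in> {m' \<in> I. m' \<le> m}" using i p by simp
  qed
  moreover have "inj_on ((!) ?L) {..p}"
    using p by (intro inj_on_nth) auto
  ultimately have "card {m' \<in> I. m' \<le> m} = Suc p" by (simp add: card_image)
  with p show ?thesis by simp
qed

text \<open>Distinct cells differ in every coordinate since each coordinate is a permutation; hence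
  the weak monotonicity of ceilings already decides strict comparisons.\<close>

lemma perm_cell_less_iff:
  assumes i: "i \<in> {1..psize \<sigma>}" "x \<in> perm_cell \<sigma> i" and i': "i' \<in> {1..psize \<sigma>}" "y \<in> perm_cell \<sigma> i'"
    and "i \<noteq> i'"
  shows "x $ c < y $ c \<longleftrightarrow> cell_index \<sigma> i c < cell_index \<sigma> i' c"
proof -
  have mono: "nat \<lceil>real (psize \<sigma>) * s\<rceil> \<le> nat \<lceil>real (psize \<sigma>) * t\<rceil>" if "s \<le> t" for s t
    using that by (intro nat_mono ceiling_mono mult_left_mono) auto
  have ne: "cell_index \<sigma> i c \<noteq> cell_index \<sigma> i' c"
    using permutes_inj[OF cell_index_permutes[of \<sigma> c]] \<open>i \<noteq> i'\<close> by (auto dest: injD)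
  have ix: "cell_index \<sigma> i c = nat \<lceil>real (psize \<sigma>) * x $ c\<rceil>"
    and iy: "cell_index \<sigma> i' c = nat \<lceil>real (psize \<sigma>) * y $ c\<rceil>"
    using i(2) i'(2) by (simp_all add: perm_cell_def)
  show ?thesis
  proof (cases "x $ c" "y $ c" rule: linorder_cases)
    case less
    from mono[OF less_imp_le[OF this], folded ix iy] ne less show ?thesis by linarith
  next
    case equal
    with ne ix iy show ?thesis by simp
  next
    case greater
    from mono[OF less_imp_le[OF this], folded ix iy] ne greater show ?thesis by linarith
  qed
qed

text \<open>Points in different cells compare like the cells, so sorting the sample by first
  coordinate lists the columns that were hit in increasing order.\<close>

lemma perm_of_cells:
  fixes \<sigma> :: "'e::finite dperm"
  assumes x: "tie_free k x" and k: "k \<ge> 1"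
    and q: "\<And>a. a \<in> {1..k} \<Longrightarrow> q a \<in> {1..psize \<sigma>} \<and> x a \<in> perm_cell \<sigma> (q a)" and inj: "inj_on q {1..k}"
  shows "perm_of k x = pat (q ` {1..k}) \<sigma>"
proof -
  define I where "I = q ` {1..k}"
  have cardI: "card I = k" unfolding I_def using card_image[OF inj] by simp
  have sub: "I \<subseteq> {1..psize \<sigma>}" unfolding I_def using q by blast
  have so: "same_order k (pat I \<sigma>) (\<lambda>a j. papp \<sigma> (sorted_list_of_set I ! (a - 1)) $ j)"
    using pat_same_order[OF sub] k cardI by simp
  have less: "x a $ c < x b $ c \<longleftrightarrow> cell_index \<sigma> (q a) c < cell_index \<sigma> (q b) c"
    if ab: "a \<in> {1..k}" "b \<in> {1..k}" for a b c
  proof (cases "a = b")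
    case False
    then have "q a \<noteq> q b" using inj_onD[OF inj _ ab] by blast
    then show ?thesis using perm_cell_less_iff[of "q a" \<sigma> "x a" "q b" "x b" c] q ab by blast
  qed simp
  have rank: "sorted_list_of_set I ! (coord_rank k x a - 1) = q a" if a: "a \<in> {1..k}" for a
  proof -
    have "{m \<in> I. m \<le> q a} = q ` {l \<in> {1..k}. x l $ None \<le> x a $ None}"
      unfolding I_def using less[OF a, of _ None] by (auto simp: cell_index_def not_less[symmetric])
    moreover have "inj_on q {l \<in> {1..k}. x l $ None \<le> x a $ None}"
      by (rule inj_on_subset[OF inj]) auto
    ultimately have "card {m \<in> I. m \<le> q a} = coord_rank k x a"
      by (simp add: card_image coord_rank_def)
    moreover have "finite I" "q a \<in> I" using a by (simp_all add: I_def)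
    ultimately show ?thesis using sorted_list_of_set_nth_rank[of I "q a"] by simp
  qed
  have "perm_of k x = pat I \<sigma>"
  proof (rule perm_of_eqI[OF x])
    show "psize (pat I \<sigma>) = k" using so by (simp add: same_order_def)
    fix a b j assume ab: "a \<in> {1..k}" "b \<in> {1..k}"
    have "coord_rank k x a \<in> {1..k}" "coord_rank k x b \<in> {1..k}"
      using bij_betw_apply[OF coord_rank_bij(1)[OF x]] ab by auto
    then have "papp (pat I \<sigma>) (coord_rank k x a) $ j < papp (pat I \<sigma>) (coord_rank k x b) $ j
      \<longleftrightarrow> papp \<sigma> (q a) $ j < papp \<sigma> (q b) $ j"
      using so rank ab unfolding same_order_def by simp
    then show "papp (pat I \<sigma>) (coord_rank k x a) $ j < papp (pat I \<sigma>) (coord_rank k x b) $ j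
      \<longleftrightarrow> x a $ Some j < x b $ Some j"
      using less[OF ab, of "Some j"] by (simp add: cell_index_def)
  qed
  then show ?thesis by (simp add: I_def)
qed

text \<open>Each set counted on the right is the image of exactly k! injections; the product is k!
  in the form given by \<open>card_inj_on_subset_funcset\<close>.\<close>

lemma card_inj_funcset_images:
  fixes N :: "nat set" and R :: "nat set \<Rightarrow> bool"
  assumes N: "finite N"
  shows "card {f \<in> {1..k} \<rightarrow>\<^sub>E N. inj_on f {1..k} \<and> R (f ` {1..k})}
    = card {I. I \<subseteq> N \<and> card I = k \<and> R I} * (\<Prod>i\<in>{0..<k}. k - i)"
proof -
  define C where "C = {I. I \<subseteq> N \<and> card I = k \<and> R I}"
  define E where "E I = {f \<in> {1..k} \<rightarrow>\<^sub>E I. inj_on f {1..k}}" for I :: "nat set"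
  have C: "finite C" "\<And>I. I \<in> C \<Longrightarrow> finite I \<and> card I = k"
    unfolding C_def using N by (auto intro: finite_subset)
  have img: "f ` {1..k} = I" if "f \<in> E I" "I \<in> C" for f I
  proof (rule card_subset_eq)
    show "f ` {1..k} \<subseteq> I" using that(1) unfolding E_def by blast
    show "card (f ` {1..k}) = card I"
      using that C(2)[OF that(2)] card_image[of f "{1..k}"] unfolding E_def by simp
  qed (use C(2)[OF that(2)] in simp)
  have "{f \<in> {1..k} \<rightarrow>\<^sub>E N. inj_on f {1..k} \<and> R (f ` {1..k})} = (\<Union>I\<in>C. E I)"
  proof (rule set_eqI, rule iffI)
    fix f assume "f \<in> {f \<in> {1..k} \<rightarrow>\<^sub>E N. inj_on f {1..k} \<and> R (f ` {1..k})}"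
    then have f: "f \<in> {1..k} \<rightarrow>\<^sub>E N" "inj_on f {1..k}" "R (f ` {1..k})" by blast+
    then have "f ` {1..k} \<in> C" unfolding C_def using card_image[OF f(2)] by auto
    moreover have "f \<in> E (f ` {1..k})" using f unfolding E_def by (auto simp: PiE_iff)
    ultimately show "f \<in> (\<Union>I\<in>C. E I)" by blast
  next
    fix f assume "f \<in> (\<Union>I\<in>C. E I)"
    then obtain I where I: "I \<in> C" "f \<in> E I" by blast
    have "f \<in> {1..k} \<rightarrow>\<^sub>E N" using I PiE_mono[of "{1..k}" "\<lambda>_. I" "\<lambda>_. N"] unfolding C_def E_def by blast
    then show "f \<in> {f \<in> {1..k} \<rightarrow>\<^sub>E N. inj_on f {1..k} \<and> R (f ` {1..k})}"
      using I img[OF I(2,1)] unfolding C_def E_def by simp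
  qed
  also have "card (\<Union>I\<in>C. E I) = (\<Sum>I\<in>C. card (E I))"
  proof (rule card_UN_disjoint)
    show "\<forall>I\<in>C. finite (E I)"
    proof
      fix I assume "I \<in> C"
      then have "finite ({1..k} \<rightarrow>\<^sub>E I)" using C(2) by (intro finite_PiE) auto
      then show "finite (E I)" unfolding E_def by simp
    qed
    show "\<forall>I\<in>C. \<forall>J\<in>C. I \<noteq> J \<longrightarrow> E I \<inter> E J = {}" using img by blast
  qed (rule C(1))
  also have "\<dots> = (\<Sum>I\<in>C. \<Prod>i\<in>{0..<k}. k - i)"
  proof (rule sum.cong[OF refl])
    fix I assume "I \<in> C"
    then show "card (E I) = (\<Prod>i\<in>{0..<k}. k - i)"
      unfolding E_def using card_inj_on_subset_funcset[of "{1..k}" I "{1..k}"] C(2) by simp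
  qed
  finally show ?thesis by (simp add: C_def)
qed

lemma freq_range: "freq \<tau> \<sigma> \<in> {0..1}"
proof -
  have "card {I. I \<subseteq> {1..psize \<sigma>} \<and> card I = psize \<tau> \<and> \<tau> = pat I \<sigma>}
      \<le> card {I. I \<subseteq> {1..psize \<sigma>} \<and> card I = psize \<tau>}"
    by (rule card_mono) auto
  then show ?thesis
    unfolding freq_def using n_subsets[of "{1..psize \<sigma>}" "psize \<tau>"] by (auto simp: divide_le_eq)
qed

text \<open>Given that the sample hits distinct columns, the set of these columns is a uniform
  subset, so the conditional probability of \<open>\<tau>\<close> is exactly
  \<open>freq \<tau> \<sigma>\<close>. The error is at most the probability that some column is hit
  twice.\<close>

lemma freq_permuton_of:
  fixes \<sigma> \<tau> :: "'e::finite dperm"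
  shows "\<bar>freq \<tau> \<sigma> - freq_permuton \<tau> (permuton_of \<sigma>)\<bar> \<le> 2 * (real (psize \<tau>))\<^sup>2 / psize \<sigma>"
proof -
  define k where "k = psize \<tau>"
  define n where "n = psize \<sigma>"
  have k: "k \<ge> 1" and n: "n \<ge> 1" unfolding k_def n_def by (rule psize_ge_1)+
  define \<mu> where "\<mu> = permuton_of \<sigma>"
  have \<mu>: "\<mu> \<in> permutons" unfolding \<mu>_def by (rule permuton_of_in_permutons)
  let ?P = "PiM {1..k} (\<lambda>_. \<mu>)"
  interpret \<mu>: prob_space \<mu> by (rule permuton_prob_space[OF \<mu>])
  interpret P: prob_space ?P by (rule prob_space_PiM_const[OF permuton_prob_space[OF \<mu>]])
  interpret PP: product_prob_space "\<lambda>_. \<mu>" "{1..k}" by unfold_locales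
  \<comment> \<open>Almost surely \<open>q x\<close> is the column of \<open>x\<close>, that is, the
    index of its cell.\<close>
  define q where "q x = nat \<lceil>real n * x $ None\<rceil>" for x :: "real ^ 'e option"
  have q_meas: "q \<in> \<mu> \<rightarrow>\<^sub>M count_space UNIV"
    unfolding q_def by (rule measurable_permuton[OF \<mu>]) measurable
  define X where "X x = (\<lambda>a\<in>{1..k}. q (x a))" for x :: "nat \<Rightarrow> real ^ 'e option"
  define F where "F = ({1..k} \<rightarrow>\<^sub>E {1..n})"
  have finF: "finite F" unfolding F_def by (intro finite_PiE) auto
  have AE_X: "AE x in ?P. X x \<in> F \<and> (\<forall>a\<in>{1..k}. x a \<in> perm_cell \<sigma> (q (x a)))"
  proof -
    have "AE x in \<mu>. q x \<in> {1..n} \<and> x \<in> perm_cell \<sigma> (q x)"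
      using AE_permuton_of_cell[of \<sigma>] unfolding \<mu>_def[symmetric]
    proof eventually_elim
      case (elim x)
      then obtain i where i: "i \<in> {1..n}" "x \<in> perm_cell \<sigma> i" unfolding n_def by blast
      then have "q x = i" by (auto simp: q_def perm_cell_def n_def cell_index_def split_option_all)
      with i show ?case by simp
    qed
    then have "AE x in ?P. \<forall>a\<in>{1..k}. q (x a) \<in> {1..n} \<and> x a \<in> perm_cell \<sigma> (q (x a))"
      by (intro AE_finite_allI AE_PiM_component) (auto intro: permuton_prob_space[OF \<mu>])
    then show ?thesis by eventually_elim (auto simp: X_def F_def)
  qed
  have prob_q: "\<mu>.prob {x \<in> space \<mu>. q x \<in> {i}} = 1 / n" if i: "i \<in> {1..n}" for i
  proof -
    have pos: "real n > 0" using n by simp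
    have "{x \<in> space \<mu>. q x \<in> {i}} = {x \<in> space \<mu>. x $ None \<in> {(real i - 1) / n <.. i / n}}"
      unfolding q_def using i pos
      by (auto simp: nat_ceiling_eq_iff pos_divide_less_eq pos_le_divide_eq mult.commute)
    then have "\<mu>.prob {x \<in> space \<mu>. q x \<in> {i}} = measure lborel ({0..1} \<inter> {(real i - 1) / n <.. real i / n})"
      using measure_permuton_coord[OF \<mu>, of "{(real i - 1) / n <.. i / n}" None] by simp
    also have "{0..1} \<inter> {(real i - 1) / n <.. real i / n} = {(real i - 1) / n <.. real i / n}"
    proof -
      have "0 \<le> (real i - 1) / n" "real i / n \<le> 1" using i by auto
      then show ?thesis by auto
    qed
    also have "measure lborel {(real i - 1) / n <.. real i / n} = 1 / n"
      by (subst measure_lborel_Ioc) (auto simp: divide_right_mono diff_divide_distrib)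
    finally show ?thesis .
  qed
  have prob_X: "P.prob {x \<in> space ?P. X x = f} = (1 / n) ^ k" if f: "f \<in> F" for f
  proof -
    have "{x \<in> space ?P. X x = f} = {x \<in> space ?P. \<forall>a\<in>{1..k}. x a \<in> {z \<in> space \<mu>. q z \<in> {f a}}}"
      using f unfolding X_def F_def by (auto simp: fun_eq_iff PiE_iff extensional_def space_PiM)
    also have "emeasure ?P \<dots> = (\<Prod>a\<in>{1..k}. emeasure \<mu> {z \<in> space \<mu>. q z \<in> {f a}})"
    proof (rule PP.emeasure_PiM_Collect)
      fix a assume "a \<in> {1..k}"
      show "{z \<in> space \<mu>. q z \<in> {f a}} \<in> \<mu>.events"
        using measurable_sets[OF q_meas, of "{f a}"] by (simp add: vimage_def Int_def conj_commute)
    qed auto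
    also have "\<dots> = (\<Prod>a\<in>{1..k}. ennreal (1 / n))"
    proof (rule prod.cong[OF refl])
      fix a assume "a \<in> {1..k}"
      then have "f a \<in> {1..n}" using f unfolding F_def by (rule PiE_mem[rotated])
      then show "emeasure \<mu> {z \<in> space \<mu>. q z \<in> {f a}} = ennreal (1 / n)"
        by (simp only: \<mu>.emeasure_eq_measure prob_q)
    qed
    also have "\<dots> = ennreal ((1 / n) ^ k)" by (simp add: ennreal_power)
    finally show ?thesis
      unfolding P.emeasure_eq_measure by (subst (asm) ennreal_inj) simp_all
  qed
  have X_meas: "{x \<in> space ?P. X x = f} \<in> P.events" for f
  proof (cases "f \<in> extensional {1..k}")
    case True
    then have "{x \<in> space ?P. X x = f} = {x \<in> space ?P. \<forall>a\<in>{1..k}. q (x a) = f a}"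
      unfolding X_def by (auto simp: fun_eq_iff extensional_def)
    also have "\<dots> \<in> P.events"
    proof (rule sets.sets_Collect_finite_All)
      fix a assume a: "a \<in> {1..k}"
      have "(\<lambda>x. q (x a)) \<in> ?P \<rightarrow>\<^sub>M count_space UNIV"
        by (rule measurable_compose[OF measurable_component_singleton[OF a] q_meas])
      then show "{x \<in> space ?P. q (x a) = f a} \<in> P.events" by measurable
    qed simp
    finally show ?thesis .
  next
    case False
    then have eq: "{x \<in> space ?P. X x = f} = {}" unfolding X_def by auto
    show ?thesis unfolding eq by (rule sets.empty_sets)
  qed
  \<comment> \<open>The probability that a given set of k columns is hit: k! labellings, each of
    probability 1/n^k.\<close>
  define p where "p = real (\<Prod>i\<in>{0..<k}. k - i) * (1 / n) ^ k"
  have prob_R: "P.prob {x \<in> space ?P. X x \<in> {f \<in> F. inj_on f {1..k} \<and> R (f ` {1..k})}}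
      = card {I. I \<subseteq> {1..n} \<and> card I = k \<and> R I} * p" for R
  proof -
    let ?S = "{f \<in> F. inj_on f {1..k} \<and> R (f ` {1..k})}"
    have "finite ?S" using finF by simp
    have "{x \<in> space ?P. X x \<in> ?S} = (\<Union>f\<in>?S. {x \<in> space ?P. X x = f})" by blast
    then have "P.prob {x \<in> space ?P. X x \<in> ?S} = P.prob (\<Union>f\<in>?S. {x \<in> space ?P. X x = f})" by simp
    also have "\<dots> = (\<Sum>f\<in>?S. P.prob {x \<in> space ?P. X x = f})"
      by (rule P.finite_measure_finite_Union)
        (use \<open>finite ?S\<close> X_meas in \<open>auto simp: disjoint_family_on_def\<close>)
    also have "\<dots> = (\<Sum>f\<in>?S. (1 / n) ^ k)" by (rule sum.cong[OF refl prob_X]) blast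
    also have "\<dots> = real (card ?S) * (1 / n) ^ k" by simp
    also have "card ?S = card {I. I \<subseteq> {1..n} \<and> card I = k \<and> R I} * (\<Prod>i\<in>{0..<k}. k - i)"
      unfolding F_def by (rule card_inj_funcset_images) simp
    finally show ?thesis by (simp only: p_def of_nat_mult mult.assoc)
  qed
  \<comment> \<open>\<open>A\<close>: the columns are distinct. \<open>B\<close>: moreover they show
    the pattern \<open>\<tau>\<close> in \<open>\<sigma>\<close>. \<open>T\<close>: the sample shows
    \<open>\<tau>\<close>. Up to a null set \<open>B\<close> is the intersection of \<open>A\<close>
    and \<open>T\<close>.\<close>
  define A where "A = {x \<in> space ?P. X x \<in> {f \<in> F. inj_on f {1..k}}}"
  define B where "B = {x \<in> space ?P. X x \<in> {f \<in> F. inj_on f {1..k} \<and> pat (f ` {1..k}) \<sigma> = \<tau>}}"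
  define T where "T = {x \<in> space ?P. perm_of k x = \<tau>}"
  have X_sets: "{x \<in> space ?P. X x \<in> S} \<in> P.events" if "finite S" for S
  proof -
    have "{x \<in> space ?P. X x \<in> S} = (\<Union>f\<in>S. {x \<in> space ?P. X x = f})" by blast
    also have "\<dots> \<in> P.events" using that X_meas by (intro sets.finite_UN) auto
    finally show ?thesis .
  qed
  have A_meas: "A \<in> P.events" unfolding A_def by (rule X_sets) (use finF in simp)
  have B_meas: "B \<in> P.events" unfolding B_def by (rule X_sets) (use finF in simp)
  have T_meas: "T \<in> P.events"
  proof -
    have "perm_of k \<in> ?P \<rightarrow>\<^sub>M count_space UNIV"
      by (rule order_invariant_measurable_count_space[OF order_invariant_perm_of measurable_permuton_coord[OF \<mu>]])
    then show ?thesis unfolding T_def by measurable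
  qed
  have prob_A: "P.prob A = (n choose k) * p"
    using prob_R[of "\<lambda>_. True"] n_subsets[of "{1..n}" k] unfolding A_def by simp
  have prob_B: "P.prob B = card {I. I \<subseteq> {1..n} \<and> card I = k \<and> pat I \<sigma> = \<tau>} * p"
    using prob_R[of "\<lambda>I. pat I \<sigma> = \<tau>"] unfolding B_def by simp
  have "AE x in ?P. x \<in> T \<and> x \<in> A \<longleftrightarrow> x \<in> B"
    using AE_X AE_tie_free[OF \<mu>] AE_space
  proof eventually_elim
    case (elim x)
    have "perm_of k x = pat (X x ` {1..k}) \<sigma>" if inj: "inj_on (X x) {1..k}"
    proof (rule perm_of_cells[OF elim(2) k _ inj])
      fix a assume a: "a \<in> {1..k}"
      have "X x a = q (x a)" using a by (simp add: X_def)
      moreover have "X x a \<in> {1..psize \<sigma>}" using elim(1) a unfolding F_def n_def by (metis PiE_mem)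
      ultimately show "X x a \<in> {1..psize \<sigma>} \<and> x a \<in> perm_cell \<sigma> (X x a)"
        using elim(1) a by metis
    qed
    then show ?case using elim(1,3) unfolding A_def B_def T_def by auto
  qed
  then have TA: "P.prob (T \<inter> A) = P.prob B"
    using T_meas A_meas B_meas by (intro P.finite_measure_eq_AE) auto
  have "P.prob (space ?P - A) \<le> (\<Sum>(a, b)\<in>{1..k} \<times> {1..k}. if a = b then 0 else 2 * (1 / n))"
  proof -
    \<comment> \<open>Two points in the same column have first coordinates less than 1/n apart, so
      each of at most k^2 pairs contributes at most 2/n.\<close>
    define W where "W = (\<lambda>(a, b). if a = b then {} else {x \<in> space ?P. \<bar>x a $ None - x b $ None\<bar> < 1 / n})"
    have W_meas: "W t \<in> P.events" if "t \<in> {1..k} \<times> {1..k}" for t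
    proof -
      obtain a b where t: "t = (a, b)" "a \<in> {1..k}" "b \<in> {1..k}" using \<open>t \<in> {1..k} \<times> {1..k}\<close> by blast
      have "(\<lambda>x. x a $ None) \<in> borel_measurable ?P" "(\<lambda>x. x b $ None) \<in> borel_measurable ?P"
        using measurable_compose[OF measurable_component_singleton[OF t(2), of "\<lambda>_. \<mu>"] measurable_permuton_coord[OF \<mu>]]
          measurable_compose[OF measurable_component_singleton[OF t(3), of "\<lambda>_. \<mu>"] measurable_permuton_coord[OF \<mu>]] .
      then have "{x \<in> space ?P. \<bar>x a $ None - x b $ None\<bar> < 1 / n} \<in> P.events"
        by (intro borel_measurable_less borel_measurable_abs borel_measurable_diff borel_measurable_const)
      then show ?thesis by (simp add: W_def t(1))
    qed
    have "AE x in ?P. x \<in> space ?P - A \<longrightarrow> x \<in> (\<Union>t\<in>{1..k} \<times> {1..k}. W t)"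
      using AE_X AE_space
    proof eventually_elim
      case (elim x)
      show ?case
      proof
        assume "x \<in> space ?P - A"
        then have "\<not> inj_on (X x) {1..k}" using elim unfolding A_def by blast
        then obtain a b where ab: "a \<in> {1..k}" "b \<in> {1..k}" "a \<noteq> b" "q (x a) = q (x b)"
          unfolding inj_on_def X_def by auto
        have "X x a \<in> {1..n}" using elim(1) ab(1) unfolding F_def by blast
        then have "q (x a) \<in> {1..n}" using ab(1) by (simp only: X_def restrict_apply')
        then have q1: "q (x a) \<ge> 1" by simp
        have "real (q (x a)) - 1 < real n * x a $ None \<and> real n * x a $ None \<le> q (x a)"
          by (rule nat_ceiling_eq_iff[OF q1, THEN iffD1]) (simp only: q_def)
        moreover have "real (q (x a)) - 1 < real n * x b $ None \<and> real n * x b $ None \<le> q (x a)"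
          by (rule nat_ceiling_eq_iff[OF q1, THEN iffD1]) (simp only: ab(4), simp only: q_def)
        ultimately have "\<bar>real n * x a $ None - real n * x b $ None\<bar> < 1" by linarith
        then have "\<bar>x a $ None - x b $ None\<bar> < 1 / n"
          using n by (simp add: right_diff_distrib[symmetric] abs_mult pos_less_divide_eq mult.commute)
        then have "x \<in> W (a, b)" using ab(3) elim(2) by (simp add: W_def)
        then show "x \<in> (\<Union>t\<in>{1..k} \<times> {1..k}. W t)" using ab by blast
      qed
    qed
    then have "P.prob (space ?P - A) \<le> P.prob (\<Union>t\<in>{1..k} \<times> {1..k}. W t)"
      by (intro P.finite_measure_mono_AE sets.finite_UN W_meas) auto
    also have "\<dots> \<le> (\<Sum>t\<in>{1..k} \<times> {1..k}. P.prob (W t))"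
      by (rule P.finite_measure_subadditive_finite) (use W_meas in auto)
    also have "\<dots> \<le> (\<Sum>t\<in>{1..k} \<times> {1..k}. case t of (a, b) \<Rightarrow> if a = b then 0 else 2 * (1 / n))"
    proof (rule sum_mono, clarify)
      fix a b assume ab: "a \<in> {1..k}" "b \<in> {1..k}"
      show "P.prob (W (a, b)) \<le> (if a = b then 0 else 2 * (1 / n))"
        using measure_PiM_permuton_near[OF \<mu> ab, of "1 / n" None] by (simp add: W_def)
    qed
    finally show ?thesis .
  qed
  also have "\<dots> \<le> (\<Sum>(a, b)\<in>{1..k} \<times> {1..k}. 2 * (1 / n))" by (intro sum_mono) auto
  also have "\<dots> = 2 * real k ^ 2 / n" by (simp add: power2_eq_square)
  finally have compl: "1 - P.prob A \<le> 2 * real k ^ 2 / n" using P.prob_compl[OF A_meas] by simp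
  have T_split: "freq_permuton \<tau> \<mu> = P.prob (T \<inter> A) + P.prob (T - A)"
  proof -
    have "freq_permuton \<tau> \<mu> = P.prob T" unfolding T_def k_def by (rule freq_permuton_eq_prob[OF \<mu>])
    also have "\<dots> = P.prob (T \<inter> A) + P.prob (T - A)"
      using P.finite_measure_Union[of "T \<inter> A" "T - A"] T_meas A_meas by (simp add: Int_Diff_Un Int_Diff_disjoint)
    finally show ?thesis .
  qed
  have TA0: "0 \<le> P.prob (T - A)" "P.prob (T - A) \<le> 1 - P.prob A"
    using P.prob_compl[OF A_meas] P.finite_measure_mono[of "T - A" "space ?P - A"] A_meas T_meas
    by (auto simp: T_def)
  \<comment> \<open>For k > n both sides vanish, as there are no k-subsets and \<open>freq\<close>
    is 0 by definition.\<close>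
  have main: "P.prob B = freq \<tau> \<sigma> * P.prob A"
  proof (cases "k \<le> n")
    case True
    then have "(n choose k) > 0" by simp
    have "{I. I \<subseteq> {1..n} \<and> card I = k \<and> pat I \<sigma> = \<tau>} = {I. I \<subseteq> {1..n} \<and> card I = k \<and> \<tau> = pat I \<sigma>}" by blast
    with True \<open>(n choose k) > 0\<close> show ?thesis
      unfolding prob_A prob_B freq_def n_def[symmetric] k_def[symmetric] by simp
  next
    case False
    then show ?thesis unfolding prob_A prob_B freq_def n_def[symmetric] k_def[symmetric]
      by (auto dest: card_mono[rotated])
  qed
  have f01: "0 \<le> freq \<tau> \<sigma>" "freq \<tau> \<sigma> \<le> 1" using freq_range[of \<tau> \<sigma>] by simp_all
  have "0 \<le> freq \<tau> \<sigma> * (1 - P.prob A)" "freq \<tau> \<sigma> * (1 - P.prob A) \<le> 1 - P.prob A"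
    using f01 P.prob_le_1[of A] by (auto intro: mult_left_le_one_le)
  \<comment> \<open>A difference of two numbers that both lie between 0 and the probability of the
    complement of \<open>A\<close>.\<close>
  moreover have "freq \<tau> \<sigma> - freq_permuton \<tau> \<mu> = freq \<tau> \<sigma> * (1 - P.prob A) - P.prob (T - A)"
    unfolding T_split TA main by (simp only: right_diff_distrib mult_1_right diff_diff_eq)
  ultimately have "\<bar>freq \<tau> \<sigma> - freq_permuton \<tau> \<mu>\<bar> \<le> 1 - P.prob A"
    using TA0 by linarith
  with compl show ?thesis unfolding \<mu>_def k_def n_def by simp
qed

section \<open>Continuity of pattern densities\<close>

text \<open>The simplifier would turn the index set \<open>{1..k}\<close> into \<open>{Suc 0..k}\<close>.\<close>

declare One_nat_def [simp del]

lemma continuous_map_real_uniform_approx: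
  fixes F :: "'a \<Rightarrow> real"
  assumes "\<And>\<epsilon>. \<epsilon> > 0 \<Longrightarrow> \<exists>F'. continuous_map T euclideanreal F' \<and> (\<forall>x\<in>topspace T. \<bar>F x - F' x\<bar> \<le> \<epsilon>)"
  shows "continuous_map T euclideanreal F"
  unfolding continuous_map_def
proof (intro conjI allI impI)
  fix U :: "real set" assume "openin euclideanreal U"
  then have U: "open U" by simp
  show "openin T {x \<in> topspace T. F x \<in> U}"
  proof (subst openin_subopen, intro ballI)
    fix x assume x: "x \<in> {x \<in> topspace T. F x \<in> U}"
    then obtain e where e: "e > 0" "ball (F x) e \<subseteq> U" using U open_contains_ball by blast
    \<comment> \<open>Two approximation errors and one oscillation of \<open>F'\<close> add up to
      less than \<open>e\<close>.\<close>
    obtain F' where F': "continuous_map T euclideanreal F'" "\<And>x. x \<in> topspace T \<Longrightarrow> \<bar>F x - F' x\<bar> \<le> e / 4"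
      using assms[of "e / 4"] e(1) by auto
    define W where "W = {y \<in> topspace T. F' y \<in> ball (F' x) (e / 4)}"
    have "openin T W" unfolding W_def using F'(1) by (rule openin_continuous_map_preimage) simp
    moreover have "x \<in> W" using x e(1) by (simp add: W_def)
    moreover have "y \<in> {x \<in> topspace T. F x \<in> U}" if "y \<in> W" for y
    proof -
      have y: "y \<in> topspace T" "\<bar>F' x - F' y\<bar> < e / 4" using that by (auto simp: W_def dist_real_def)
      have "x \<in> topspace T" using x by simp
      from F'(2)[OF y(1)] F'(2)[OF this] y(2) e(1) have "\<bar>F x - F y\<bar> < e" by linarith
      then have "F y \<in> ball (F x) e" by (simp add: dist_real_def)
      with e y show ?thesis by blast
    qed
    ultimately show "\<exists>W. openin T W \<and> x \<in> W \<and> W \<subseteq> {x \<in> topspace T. F x \<in> U}" by blast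
  qed
qed simp

lemma continuous_map_permuton_integral:
  assumes "continuous_on (cbox 0 1) (g :: real ^ 'd::finite \<Rightarrow> real)"
  shows "continuous_map permuton_topology euclideanreal (\<lambda>\<mu>. LINT x|\<mu>. g x)"
  unfolding continuous_map_def
proof (intro conjI allI impI)
  fix U :: "real set" assume "openin euclideanreal U"
  then have "{\<mu> \<in> permutons. (LINT x|\<mu>. g x) \<in> U} \<in>
      {{\<mu> \<in> permutons. (LINT x|\<mu>. f x) \<in> U} | (f :: real ^ 'd \<Rightarrow> real) U. continuous_on (cbox 0 1) f \<and> open (U :: real set)}"
    using assms by auto
  then have "openin permuton_topology {\<mu> \<in> permutons. (LINT x|\<mu>. g x) \<in> U}"
    unfolding permuton_topology_def by (rule topology_generated_by_Basis)
  then show "openin permuton_topology {\<mu> \<in> topspace permuton_topology. (LINT x|\<mu>. g x) \<in> U}"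
    by (simp only: topspace_permuton_topology)
qed simp

text \<open>Extensional functions are those with value \<open>undefined\<close> off
  \<open>{1..k}\<close>, so the set is a full product with singleton factors there.\<close>

lemma compact_cube_power: "compact (Pi\<^sub>E {1..k::nat} (\<lambda>_. cbox 0 1 :: (real ^ 'd::finite) set))"
proof -
  have "Pi\<^sub>E {1..k} (\<lambda>_. cbox 0 1 :: (real ^ 'd) set) = Pi\<^sub>E UNIV (\<lambda>i. if i \<in> {1..k} then cbox 0 1 else {undefined})"
    by (auto simp: PiE_iff extensional_def split: if_splits)
  also have "compact \<dots>" by (rule compact_PiE_UNIV) auto
  finally show ?thesis .
qed

section \<open>Integrals of continuous functions of several points\<close>

inductive product_combination :: "nat \<Rightarrow> ((nat \<Rightarrow> real ^ 'd::finite) \<Rightarrow> real) \<Rightarrow> bool" for k where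
  prod: "(\<And>a. continuous_on (cbox 0 1) (g a)) \<Longrightarrow> product_combination k (\<lambda>x. c * (\<Prod>a\<in>{1..k}. g a (x a)))"
| add: "product_combination k F \<Longrightarrow> product_combination k F' \<Longrightarrow> product_combination k (\<lambda>x. F x + F' x)"

lemma product_combination_mult:
  assumes "product_combination k F" "product_combination k F'"
  shows "product_combination k (\<lambda>x. F x * F' x)"
  using assms(1)
proof induction
  case (prod g c)
  show ?case using assms(2)
  proof induction
    case (prod g' c')
    have "product_combination k (\<lambda>x. (c * c') * (\<Prod>a\<in>{1..k}. g a (x a) * g' a (x a)))"
      by (rule product_combination.prod) (intro continuous_on_mult prod \<open>\<And>a. continuous_on (cbox 0 1) (g a)\<close>)
    then show ?case by (simp add: prod.distrib mult_ac)
  next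
    case (add F F')
    from product_combination.add[OF add.IH] show ?case by (simp add: distrib_left)
  qed
next
  case (add F1 F2)
  from product_combination.add[OF add.IH] show ?case by (simp add: distrib_right)
qed

lemma product_combination_const: "product_combination k (\<lambda>_. c)"
  using product_combination.prod[of "\<lambda>_ _. 1" k c] by simp

lemma product_combination_coord:
  assumes "a \<in> {1..k}"
  shows "product_combination k (\<lambda>x. x a $ c)"
proof -
  have "continuous_on (cbox 0 1) (\<lambda>z :: real ^ 'a. if a' = a then z $ c else 1)" for a'
    by (cases "a' = a") (auto intro!: continuous_intros)
  then have "product_combination k (\<lambda>x. 1 * (\<Prod>a'\<in>{1..k}. if a' = a then x a' $ c else 1))"
    by (rule product_combination.prod)
  then show ?thesis using assms by (simp add: prod.delta)
qed

lemma product_combination_continuous: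
  assumes "product_combination k F"
  shows "continuous_on (Pi\<^sub>E {1..k} (\<lambda>_. cbox 0 1)) F"
  using assms
proof induction
  case (prod g c)
  have "continuous_on (Pi\<^sub>E {1..k} (\<lambda>_. cbox 0 1)) (\<lambda>x. g a (x a))" if "a \<in> {1..k}" for a
    by (rule continuous_on_compose2[OF prod[of a] continuous_on_subset[OF continuous_on_product_coordinates]])
      (use that in auto)
  then show ?case by (intro continuous_on_mult continuous_on_const continuous_on_prod) auto
qed (rule continuous_on_add)

text \<open>By Fubini the integral of a product of one-point functions is the product of their
  integrals, each continuous by the choice of the topology.\<close>

lemma product_combination_integral:
  fixes F :: "(nat \<Rightarrow> real ^ 'd::finite) \<Rightarrow> real"
  assumes "product_combination k F"
  shows "continuous_map permuton_topology euclideanreal (\<lambda>\<mu>. LINT x|PiM {1..k} (\<lambda>_. \<mu>). F x) \<and>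
    (\<forall>\<mu>\<in>permutons. integrable (PiM {1..k} (\<lambda>_. \<mu>)) F)"
  using assms
proof induction
  case (prod g c)
  have int: "integrable (PiM {1..k} (\<lambda>_. \<mu>)) (\<lambda>x. \<Prod>a\<in>{1..k}. g a (x a)) \<and>
      (LINT x|PiM {1..k} (\<lambda>_. \<mu>). (\<Prod>a\<in>{1..k}. g a (x a))) = (\<Prod>a\<in>{1..k}. LINT x|\<mu>. g a x)"
    if \<mu>: "\<mu> \<in> permutons" for \<mu>
  proof -
    interpret prob_space \<mu> by (rule permuton_prob_space[OF \<mu>])
    interpret product_sigma_finite "\<lambda>_. \<mu>" by unfold_locales
    show ?thesis
      by (intro conjI product_integrable_prod product_integral_prod integrable_permuton_continuous[OF \<mu> prod]) auto
  qed
  have "continuous_map permuton_topology euclideanreal (\<lambda>\<mu>. c * (\<Prod>a\<in>{1..k}. (LINT x|\<mu>. g a x)))"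
    by (intro continuous_map_real_mult continuous_map_prod continuous_map_permuton_integral prod) auto
  then have "continuous_map permuton_topology euclideanreal
      (\<lambda>\<mu>. LINT x|PiM {1..k} (\<lambda>_. \<mu>). c * (\<Prod>a\<in>{1..k}. g a (x a)))"
    by (rule continuous_map_eq) (simp add: topspace_permuton_topology int)
  then show ?case using int by simp
next
  case (add F F')
  have "continuous_map permuton_topology euclideanreal
      (\<lambda>\<mu>. (LINT x|PiM {1..k} (\<lambda>_. \<mu>). F x) + (LINT x|PiM {1..k} (\<lambda>_. \<mu>). F' x))"
    using add.IH by (intro continuous_map_add) auto
  then have "continuous_map permuton_topology euclideanreal (\<lambda>\<mu>. LINT x|PiM {1..k} (\<lambda>_. \<mu>). F x + F' x)"
    by (rule continuous_map_eq) (use add.IH in \<open>simp add: topspace_permuton_topology\<close>)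
  then show ?case using add.IH by simp
qed

lemma product_combination_dense:
  fixes H :: "(nat \<Rightarrow> real ^ 'd::finite) \<Rightarrow> real"
  assumes "continuous_on (Pi\<^sub>E {1..k} (\<lambda>_. cbox 0 1)) H" "\<epsilon> > 0"
  obtains F where "product_combination k F" "\<And>x. x \<in> Pi\<^sub>E {1..k} (\<lambda>_. cbox 0 1) \<Longrightarrow> \<bar>H x - F x\<bar> < \<epsilon>"
proof -
  interpret function_ring_on "Collect (product_combination k)" "Pi\<^sub>E {1..k} (\<lambda>_. cbox 0 1 :: (real ^ 'd) set)"
  proof
    show "\<exists>f\<in>Collect (product_combination k). f x \<noteq> f y"
      if xy: "x \<in> Pi\<^sub>E {1..k} (\<lambda>_. cbox 0 1)" "y \<in> Pi\<^sub>E {1..k} (\<lambda>_. cbox 0 1)" "x \<noteq> y"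
      for x y :: "nat \<Rightarrow> real ^ 'd"
    proof -
      obtain a where a: "a \<in> {1..k}" "x a \<noteq> y a" using PiE_ext[OF xy(1,2)] xy(3) by blast
      then obtain c where "x a $ c \<noteq> y a $ c" by (auto simp: vec_eq_iff)
      with product_combination_coord[OF a(1), of c] show ?thesis
        by (intro bexI[of _ "\<lambda>x. x a $ c"]) simp_all
    qed
    show "continuous_on (Pi\<^sub>E {1..k} (\<lambda>_. cbox 0 1)) f" if "f \<in> Collect (product_combination k)"
      for f :: "(nat \<Rightarrow> real ^ 'd) \<Rightarrow> real"
      using that by (simp only: mem_Collect_eq product_combination_continuous)
  qed (simp_all only: mem_Collect_eq compact_cube_power product_combination_const product_combination.add
      product_combination_mult)
  show thesis using Stone_Weierstrass_basic[OF assms] that by blast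
qed

text \<open>All product measures live on the same compact power of the cube. A uniform approximation
  there by product combinations carries over to the integrals, simultaneously for every
  permuton.\<close>

lemma continuous_map_integral_power:
  fixes H :: "(nat \<Rightarrow> real ^ 'd::finite) \<Rightarrow> real"
  assumes H: "continuous_on (Pi\<^sub>E {1..k} (\<lambda>_. cbox 0 1)) H"
    and int: "\<And>\<mu>. \<mu> \<in> permutons \<Longrightarrow> integrable (PiM {1..k} (\<lambda>_. \<mu>)) H"
  shows "continuous_map permuton_topology euclideanreal (\<lambda>\<mu>. LINT x|PiM {1..k} (\<lambda>_. \<mu>). H x)"
proof (rule continuous_map_real_uniform_approx)
  fix \<epsilon> :: real assume "\<epsilon> > 0"
  obtain F where F: "product_combination k F" "\<And>x. x \<in> Pi\<^sub>E {1..k} (\<lambda>_. cbox 0 1) \<Longrightarrow> \<bar>H x - F x\<bar> < \<epsilon>"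
    using product_combination_dense[OF H \<open>\<epsilon> > 0\<close>] by blast
  note F' = product_combination_integral[OF F(1)]
  have "\<bar>(LINT x|PiM {1..k} (\<lambda>_. \<mu>). H x) - (LINT x|PiM {1..k} (\<lambda>_. \<mu>). F x)\<bar> \<le> \<epsilon>" if \<mu>: "\<mu> \<in> permutons" for \<mu>
  proof -
    let ?P = "PiM {1..k} (\<lambda>_. \<mu>)"
    interpret prob_space ?P by (rule prob_space_PiM_const[OF permuton_prob_space[OF \<mu>]])
    have int': "integrable ?P H" "integrable ?P F" using int[OF \<mu>] F' \<mu> by auto
    have "\<bar>(LINT x|?P. H x) - (LINT x|?P. F x)\<bar> = \<bar>LINT x|?P. H x - F x\<bar>"
      using int' by simp
    also have "\<dots> \<le> (LINT x|?P. \<bar>H x - F x\<bar>)" by (rule integral_abs_bound)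
    also have "\<dots> \<le> (LINT x|?P. \<epsilon>)"
    proof (rule integral_mono[OF _ integrable_const])
      show "integrable ?P (\<lambda>x. \<bar>H x - F x\<bar>)" using int' by simp
      show "\<bar>H x - F x\<bar> \<le> \<epsilon>" if "x \<in> space ?P" for x
        using F(2)[of x] that unfolding space_PiM permuton_space[OF \<mu>] by linarith
    qed
    finally show ?thesis by (simp add: prob_space)
  qed
  then show "\<exists>F'. continuous_map permuton_topology euclideanreal F' \<and>
      (\<forall>\<mu>\<in>topspace permuton_topology. \<bar>(LINT x|PiM {1..k} (\<lambda>_. \<mu>). H x) - F' \<mu>\<bar> \<le> \<epsilon>)"
    using F' by (auto simp: topspace_permuton_topology)
qed

section \<open>Damping the jumps at ties\<close>

abbreviation tie_indices :: "nat \<Rightarrow> (nat \<times> nat \<times> 'd) set" where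
  "tie_indices k \<equiv> {(a, b, c). a \<in> {1..k} \<and> b \<in> {1..k} \<and> a \<noteq> b}"

definition tie_weight :: "nat \<Rightarrow> real \<Rightarrow> (nat \<Rightarrow> real ^ 'd::finite) \<Rightarrow> real" where
  "tie_weight k \<delta> x = (\<Prod>(a, b, c)\<in>tie_indices k. min 1 (\<bar>x a $ c - x b $ c\<bar> / \<delta>))"

lemma finite_tie_indices: "finite (tie_indices k :: (nat \<times> nat \<times> 'd::finite) set)"
  by (rule finite_subset[of _ "{1..k} \<times> {1..k} \<times> UNIV"]) auto

lemma tie_weight_range: "\<delta> > 0 \<Longrightarrow> 0 \<le> tie_weight k \<delta> x \<and> tie_weight k \<delta> x \<le> 1"
  unfolding tie_weight_def by (auto intro!: prod_nonneg prod_le_1)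

lemma continuous_tie_weight:
  fixes S :: "(nat \<Rightarrow> real ^ 'd::finite) set"
  assumes "\<delta> > 0"
  shows "continuous_on S (tie_weight k \<delta>)"
  unfolding tie_weight_def[abs_def] case_prod_beta
proof (intro continuous_on_prod continuous_on_min continuous_on_const continuous_on_divide
    continuous_on_rabs continuous_on_diff)
  show "continuous_on S (\<lambda>x. x a $ c)" for a c
    by (intro continuous_on_component continuous_on_subset[OF continuous_on_product_coordinates]) auto
  then show "continuous_on S (\<lambda>x. x a $ c)" for a c .
qed (use assms in auto)

text \<open>
  An order invariant function is discontinuous only at ties, where \<open>tie_weight\<close> vanishes. The weight
  differs from 1 only near ties, which has small probability, uniformly over all permutons.
\<close>

lemma isCont_order_invariant_tie_weight:
  fixes G :: "(nat \<Rightarrow> real ^ 'd::finite) \<Rightarrow> real"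
  assumes G: "order_invariant k G" and \<delta>: "\<delta> > 0"
  shows "isCont (\<lambda>x. G x * tie_weight k \<delta> x) x"
proof -
  have w: "(tie_weight k \<delta> \<longlongrightarrow> tie_weight k \<delta> x) (at x)"
    using continuous_tie_weight[OF \<delta>, of "UNIV :: (nat \<Rightarrow> real ^ 'd) set" k] by (simp add: continuous_on_eq_continuous_at isCont_def)
  have coord: "((\<lambda>y. y b $ c - y a $ c) \<longlongrightarrow> x b $ c - x a $ c) (at x)" for a b :: nat and c :: 'd
  proof -
    have "continuous_on UNIV (\<lambda>y :: nat \<Rightarrow> real ^ 'd. y b $ c - y a $ c)"
      by (intro continuous_on_diff continuous_on_component continuous_on_product_coordinates)
    then show ?thesis by (simp add: continuous_on_eq_continuous_at isCont_def)
  qed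
  obtain B where B: "\<And>x. \<bar>G x\<bar> \<le> B" using order_invariant_bounded[OF G] by blast
  have "((\<lambda>y. G y * tie_weight k \<delta> y) \<longlongrightarrow> G x * tie_weight k \<delta> x) (at x)"
  proof (cases "tie_weight k \<delta> x = 0")
    case True
    \<comment> \<open>At a tie the bounded factor \<open>G\<close> is squeezed by the vanishing
      weight.\<close>
    have "((\<lambda>y. B * tie_weight k \<delta> y) \<longlongrightarrow> B * 0) (at x)"
      using w True by (intro tendsto_mult tendsto_const) simp
    then have lim0: "((\<lambda>y. B * tie_weight k \<delta> y) \<longlongrightarrow> 0) (at x)" by simp
    have "norm (G y * tie_weight k \<delta> y) \<le> B * tie_weight k \<delta> y" for y
      using mult_right_mono[OF B[of y], of "tie_weight k \<delta> y"] tie_weight_range[OF \<delta>, of k y]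
      by (simp add: abs_mult)
    then have "((\<lambda>y. G y * tie_weight k \<delta> y) \<longlongrightarrow> 0) (at x)"
      by (intro Lim_null_comparison[OF always_eventually lim0]) simp
    then show ?thesis using True by simp
  next
    case False
    have ne: "x a $ c \<noteq> x b $ c" if "(a, b, c) \<in> tie_indices k" for a b c
    proof
      assume "x a $ c = x b $ c"
      with that have "tie_weight k \<delta> x = 0"
        unfolding tie_weight_def by (intro prod_zero finite_tie_indices bexI[of _ "(a, b, c)"]) auto
      with False show False by simp
    qed
    \<comment> \<open>Away from ties each of the finitely many strict comparisons persists nearby,
      so \<open>G\<close> is locally constant.\<close>
    have "\<forall>\<^sub>F y in at x. \<forall>t\<in>tie_indices k. (x (fst t) $ snd (snd t) < x (fst (snd t)) $ snd (snd t)) =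
        (y (fst t) $ snd (snd t) < y (fst (snd t)) $ snd (snd t))"
    proof (rule eventually_ball_finite[OF finite_tie_indices], intro ballI)
      fix t :: "nat \<times> nat \<times> 'd" assume t: "t \<in> tie_indices k"
      obtain a b c where t': "t = (a, b, c)" by (cases t)
      have "x a $ c \<noteq> x b $ c" using ne t t' by blast
      then consider "0 < x b $ c - x a $ c" | "x b $ c - x a $ c < 0" by linarith
      then have "\<forall>\<^sub>F y in at x. (x a $ c < x b $ c) = (y a $ c < y b $ c)"
      proof cases
        case 1
        from order_tendstoD(1)[OF coord this] show ?thesis
          by eventually_elim (use 1 in auto)
      next
        case 2
        from order_tendstoD(2)[OF coord this] show ?thesis
          by eventually_elim (use 2 in auto)
      qed
      then show "\<forall>\<^sub>F y in at x. (x (fst t) $ snd (snd t) < x (fst (snd t)) $ snd (snd t)) =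
        (y (fst t) $ snd (snd t) < y (fst (snd t)) $ snd (snd t))" by (simp add: t')
    qed
    then have "\<forall>\<^sub>F y in at x. G x = G y"
    proof eventually_elim
      case (elim y)
      show ?case
      proof (rule order_invariantD[OF G])
        fix a b c assume "a \<in> {1..k}" "b \<in> {1..k}"
        then show "(x a $ c < x b $ c) = (y a $ c < y b $ c)"
          using elim by (cases "a = b") (auto dest: bspec[of _ _ "(a, b, c)"])
      qed
    qed
    then have "\<forall>\<^sub>F y in at x. G x * tie_weight k \<delta> y = G y * tie_weight k \<delta> y"
      by eventually_elim simp
    then show ?thesis
      by (rule Lim_transform_eventually[rotated]) (intro tendsto_mult tendsto_const w)
  qed
  then show ?thesis by (simp add: isCont_def)
qed

text \<open>Damping changes the integral by at most the bound \<open>B\<close> times the probability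
  of a near tie, which is small uniformly over permutons; the damped integrand is
  continuous.\<close>

lemma continuous_map_order_invariant_integral:
  fixes G :: "(nat \<Rightarrow> real ^ 'd::finite) \<Rightarrow> real"
  assumes G: "order_invariant k G"
  shows "continuous_map permuton_topology euclideanreal (\<lambda>\<mu>. LINT x|PiM {1..k} (\<lambda>_. \<mu>). G x)"
proof (rule continuous_map_real_uniform_approx)
  fix \<epsilon> :: real assume "\<epsilon> > 0"
  obtain B where B: "\<And>x. \<bar>G x\<bar> \<le> B" using order_invariant_bounded[OF G] by blast
  then have "B \<ge> 0" by (metis abs_ge_zero order.trans)
  define T where "T = (tie_indices k :: (nat \<times> nat \<times> 'd) set)"
  have finT: "finite T" unfolding T_def by (rule finite_tie_indices)
  \<comment> \<open>Chosen so that \<open>B\<close> times the union bound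
    \<open>card T * (2 * \<delta>)\<close> is at most \<open>\<epsilon>\<close>; the summand 1 keeps
    the denominator positive when \<open>B\<close> or \<open>card T\<close> is 0.\<close>
  define \<delta> where "\<delta> = \<epsilon> / (B * (card T * 2) + 1)"
  have pos: "B * (card T * 2) + 1 > 0" using \<open>B \<ge> 0\<close> by (simp add: add_nonneg_pos)
  have \<delta>: "\<delta> > 0" unfolding \<delta>_def using \<open>\<epsilon> > 0\<close> pos by simp
  have "B * (card T * (2 * \<delta>)) = (B * (card T * 2)) * \<delta>" by simp
  also have "\<dots> \<le> (B * (card T * 2) + 1) * \<delta>" using \<delta> by (intro mult_right_mono) auto
  also have "\<dots> = \<epsilon>" unfolding \<delta>_def using pos by simp
  finally have \<delta>_le: "B * (card T * (2 * \<delta>)) \<le> \<epsilon>" .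
  define H where "H x = G x * tie_weight k \<delta> x" for x
  have contH: "continuous_on S H" for S
    unfolding H_def using isCont_order_invariant_tie_weight[OF G \<delta>]
    by (intro continuous_at_imp_continuous_on) auto
  have coord: "(\<lambda>x. x a $ c) \<in> borel_measurable (PiM {1..k} (\<lambda>_. \<mu>))"
    if "\<mu> \<in> permutons" "a \<in> {1..k}" for \<mu> a and c :: 'd
    using measurable_compose[OF measurable_component_singleton[OF that(2), of "\<lambda>_. \<mu>"] measurable_permuton_coord[OF that(1)]] .
  have w_meas: "tie_weight k \<delta> \<in> borel_measurable (PiM {1..k} (\<lambda>_. \<mu>))" if \<mu>: "\<mu> \<in> permutons" for \<mu> :: "(real ^ 'd) measure"
    unfolding tie_weight_def[abs_def] case_prod_beta
    by (intro borel_measurable_prod borel_measurable_min borel_measurable_const borel_measurable_divide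
        borel_measurable_abs borel_measurable_diff coord[OF \<mu>]) auto
  have intH: "integrable (PiM {1..k} (\<lambda>_. \<mu>)) H" if \<mu>: "\<mu> \<in> permutons" for \<mu>
  proof -
    interpret prob_space "PiM {1..k} (\<lambda>_. \<mu>)" by (rule prob_space_PiM_const[OF permuton_prob_space[OF \<mu>]])
    have "\<bar>H x\<bar> \<le> B" for x
      using mult_mono[OF B[of x], of "tie_weight k \<delta> x" 1] tie_weight_range[OF \<delta>, of k x] \<open>B \<ge> 0\<close>
      by (simp add: H_def abs_mult)
    then show ?thesis
      unfolding H_def using order_invariant_measurable[OF G \<mu>] w_meas[OF \<mu>]
      by (intro integrable_const_bound[where B = B]) auto
  qed
  have "\<bar>(LINT x|PiM {1..k} (\<lambda>_. \<mu>). G x) - (LINT x|PiM {1..k} (\<lambda>_. \<mu>). H x)\<bar> \<le> \<epsilon>" if \<mu>: "\<mu> \<in> permutons" for \<mu>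
  proof -
    let ?P = "PiM {1..k} (\<lambda>_. \<mu>)"
    interpret prob_space ?P by (rule prob_space_PiM_const[OF permuton_prob_space[OF \<mu>]])
    define near where "near t = {x \<in> space ?P. \<bar>x (fst t) $ snd (snd t) - x (fst (snd t)) $ snd (snd t)\<bar> < \<delta>}"
      for t :: "nat \<times> nat \<times> 'd"
    have near_meas: "near t \<in> events" if "t \<in> T" for t
      unfolding near_def using that unfolding T_def
      by (intro borel_measurable_less borel_measurable_abs borel_measurable_diff borel_measurable_const coord[OF \<mu>]) auto
    have near_le: "prob (near t) \<le> 2 * \<delta>" if "t \<in> T" for t
      unfolding near_def using that \<delta> unfolding T_def
      by (intro measure_PiM_permuton_near[OF \<mu>]) auto
    have int_near: "integrable ?P (\<lambda>x. B * (\<Sum>t\<in>T. indicator (near t) x))"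
      by (intro integrable_mult_right Bochner_Integration.integrable_sum integrable_real_indicator near_meas)
        (auto simp: emeasure_eq_measure)
    have le: "\<bar>G x - H x\<bar> \<le> B * (\<Sum>t\<in>T. indicator (near t) x)" if x: "x \<in> space ?P" for x
    proof (cases "\<exists>t\<in>T. x \<in> near t")
      case True
      then obtain t where t: "t \<in> T" "x \<in> near t" by blast
      have "1 = (indicator (near t) x :: real)" using t by simp
      also have "\<dots> \<le> (\<Sum>t\<in>T. indicator (near t) x)"
        using t finT by (intro member_le_sum) auto
      finally have one: "1 \<le> (\<Sum>t\<in>T. indicator (near t) x :: real)" .
      have "G x - H x = G x * (1 - tie_weight k \<delta> x)" by (simp add: H_def right_diff_distrib)
      then have "\<bar>G x - H x\<bar> = \<bar>G x\<bar> * (1 - tie_weight k \<delta> x)"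
        using tie_weight_range[OF \<delta>, of k x] by (simp add: abs_mult)
      also have "\<dots> \<le> B * 1" using B tie_weight_range[OF \<delta>, of k x] \<open>B \<ge> 0\<close> by (intro mult_mono) auto
      also have "\<dots> \<le> B * (\<Sum>t\<in>T. indicator (near t) x)" using one \<open>B \<ge> 0\<close> by (rule mult_left_mono)
      finally show ?thesis .
    next
      case False
      have "tie_weight k \<delta> x = (\<Prod>t\<in>T. 1)"
        unfolding tie_weight_def T_def
      proof (rule prod.cong[OF refl])
        fix t :: "nat \<times> nat \<times> 'd" assume t: "t \<in> tie_indices k"
        obtain a b c where t': "t = (a, b, c)" by (cases t)
        have "x \<notin> near t" using False t unfolding T_def by blast
        then have "\<delta> \<le> \<bar>x a $ c - x b $ c\<bar>" using x by (simp add: near_def t')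
        then have "1 \<le> \<bar>x a $ c - x b $ c\<bar> / \<delta>" using \<delta> by simp
        then show "(case t of (a, b, c) \<Rightarrow> min 1 (\<bar>x a $ c - x b $ c\<bar> / \<delta>)) = 1" by (simp add: t')
      qed
      then have "G x - H x = 0" by (simp add: H_def)
      then show ?thesis using \<open>B \<ge> 0\<close> by (simp add: sum_nonneg)
    qed
    note intG = order_invariant_integrable[OF G \<mu>]
    have "\<bar>(LINT x|?P. G x) - (LINT x|?P. H x)\<bar> = \<bar>LINT x|?P. G x - H x\<bar>"
      using intG intH[OF \<mu>] by simp
    also have "\<dots> \<le> (LINT x|?P. \<bar>G x - H x\<bar>)" by (rule integral_abs_bound)
    also have "\<dots> \<le> (LINT x|?P. B * (\<Sum>t\<in>T. indicator (near t) x))"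
      by (rule integral_mono[OF _ int_near le]) (use intG intH[OF \<mu>] in auto)
    also have "\<dots> = B * (\<Sum>t\<in>T. prob (near t))"
      using near_meas by (simp add: Bochner_Integration.integral_sum emeasure_eq_measure)
    also have "\<dots> \<le> B * (\<Sum>t\<in>T. 2 * \<delta>)" using near_le \<open>B \<ge> 0\<close> by (intro mult_left_mono sum_mono)
    also have "\<dots> \<le> \<epsilon>" using \<delta>_le by simp
    finally show ?thesis .
  qed
  moreover have "continuous_map permuton_topology euclideanreal (\<lambda>\<mu>. LINT x|PiM {1..k} (\<lambda>_. \<mu>). H x)"
    by (rule continuous_map_integral_power[OF contH intH])
  ultimately show "\<exists>F'. continuous_map permuton_topology euclideanreal F' \<and>
      (\<forall>\<mu>\<in>topspace permuton_topology. \<bar>(LINT x|PiM {1..k} (\<lambda>_. \<mu>). G x) - F' \<mu>\<bar> \<le> \<epsilon>)"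
    by (auto simp: topspace_permuton_topology)
qed

lemma continuous_map_freq_permuton:
  "continuous_map permuton_topology euclideanreal (freq_permuton (\<tau> :: 'e::finite dperm))"
  using continuous_map_order_invariant_integral[OF order_invariant_comp[OF order_invariant_perm_of],
      of "psize \<tau>" "\<lambda>\<rho>. of_bool (\<rho> = \<tau>)"]
  by (simp add: freq_permuton_def[abs_def])

section \<open>Compactness of the space of permutons\<close>

text \<open>Permutons carry the trace sigma-algebra of the cube; pushing them forward to the Borel
  sets of the whole space gives access to \<open>prob_space_eqI_continuous\<close>.\<close>

lemma permuton_eqI_integral:
  assumes \<mu>: "\<mu> \<in> permutons" and \<nu>: "\<nu> \<in> permutons"
    and eq: "\<And>g :: real ^ 'd::finite \<Rightarrow> real. continuous_on (cbox 0 1) g \<Longrightarrow> (LINT x|\<mu>. g x) = (LINT x|\<nu>. g x)"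
  shows "\<mu> = \<nu>"
proof (rule measure_eqI)
  show "sets \<mu> = sets \<nu>" using permuton_sets[OF \<mu>] permuton_sets[OF \<nu>] by simp
  have id_meas: "(\<lambda>x. x) \<in> borel_measurable \<kappa>" if "\<kappa> \<in> permutons" for \<kappa> :: "(real ^ 'd) measure"
    by (rule measurable_permuton[OF that]) simp
  have "distr \<mu> borel (\<lambda>x. x) = distr \<nu> borel (\<lambda>x. x)"
  proof (rule prob_space_eqI_continuous)
    fix f :: "real ^ 'd \<Rightarrow> real" assume f: "continuous_on UNIV f"
    have "continuous_on (cbox 0 1) f" by (rule continuous_on_subset[OF f]) simp
    from eq[OF this] show "(LINT x|distr \<mu> borel (\<lambda>x. x). f x) = (LINT x|distr \<nu> borel (\<lambda>x. x). f x)"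
      using borel_measurable_continuous_onI[OF f]
      by (simp add: integral_distr[OF id_meas[OF \<mu>]] integral_distr[OF id_meas[OF \<nu>]])
  qed (simp_all add: prob_space.prob_space_distr[OF permuton_prob_space id_meas] \<mu> \<nu>)
  then have eq': "emeasure (distr \<mu> borel (\<lambda>x. x)) A = emeasure (distr \<nu> borel (\<lambda>x. x)) A" for A by simp
  fix A assume "A \<in> sets \<mu>"
  then have A: "A \<in> sets borel" "A \<subseteq> cbox 0 1"
    by (auto simp: permuton_sets[OF \<mu>] sets_restrict_space_iff)
  then show "emeasure \<mu> A = emeasure \<nu> A"
    using eq'[of A] by (simp add: emeasure_distr[OF id_meas[OF \<mu>]] emeasure_distr[OF id_meas[OF \<nu>]]
        permuton_space[OF \<mu>] permuton_space[OF \<nu>] Int_absorb2)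
qed

text \<open>Convergence of integrals gives eventual membership in subbasic neighbourhoods, and this
  passes to finite intersections and to unions.\<close>

lemma limitin_permuton_topology:
  assumes "\<mu> \<in> permutons" "\<And>n. \<mu>s n \<in> permutons"
    and lim: "\<And>g :: real ^ 'd::finite \<Rightarrow> real. continuous_on (cbox 0 1) g \<Longrightarrow>
      (\<lambda>n. LINT x|\<mu>s n. g x) \<longlonglongrightarrow> (LINT x|\<mu>. g x)"
  shows "limitin permuton_topology \<mu>s \<mu> sequentially"
  unfolding limitin_def
proof (intro conjI allI impI)
  show "\<mu> \<in> topspace permuton_topology" using assms(1) by (simp add: topspace_permuton_topology)
  fix U assume "openin permuton_topology U \<and> \<mu> \<in> U"
  then have "generate_topology_on {{\<mu> \<in> permutons. (LINT x|\<mu>. f x) \<in> U} |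
      (f :: real ^ 'd \<Rightarrow> real) U. continuous_on (cbox 0 1) f \<and> open (U :: real set)} U" "\<mu> \<in> U"
    unfolding permuton_topology_def openin_topology_generated_by_iff by blast+
  then show "\<forall>\<^sub>F n in sequentially. \<mu>s n \<in> U"
  proof induction
    case (Int A B)
    then have "\<forall>\<^sub>F n in sequentially. \<mu>s n \<in> A \<and> \<mu>s n \<in> B" by (intro eventually_conj) auto
    then show ?case by simp
  next
    case (UN K)
    then obtain k where k: "k \<in> K" "\<mu> \<in> k" by blast
    from UN.IH[OF this] show ?case by eventually_elim (use k in blast)
  next
    case (Basis B)
    then obtain f :: "real ^ 'd \<Rightarrow> real" and V where f: "continuous_on (cbox 0 1) f" "open V"
      and B: "B = {\<mu> \<in> permutons. (LINT x|\<mu>. f x) \<in> V}" by blast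
    have "\<forall>\<^sub>F n in sequentially. (LINT x|\<mu>s n. f x) \<in> V"
      using lim[OF f(1)] f(2) Basis.prems unfolding B by (auto dest: topological_tendstoD)
    then show ?case by eventually_elim (use assms(2) in \<open>simp add: B\<close>)
  qed simp
qed

text \<open>Read as functions on the finite index type, the points lie in a product of intervals, so
  \<open>compact_laws_on_cube\<close> yields a limit law. It remains to carry it back to the cube
  and to check its marginals.\<close>

lemma permutons_sequentially_compact:
  fixes \<mu>s :: "nat \<Rightarrow> (real ^ 'd::finite) measure"
  assumes \<mu>s: "\<And>n. \<mu>s n \<in> permutons"
  obtains r \<mu> where "strict_mono r" "\<mu> \<in> permutons" "limitin permuton_topology (\<mu>s \<circ> r) \<mu> sequentially"
proof -
  define M where "M n = distr (\<mu>s n) borel (\<lambda>x i. x $ i)" for n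
  have "continuous_on UNIV (\<lambda>(x :: real ^ 'd) i. x $ i)"
    by (intro continuous_on_coordinatewise_then_product continuous_intros)
  then have meas: "(\<lambda>x i. x $ i) \<in> borel_measurable (\<mu>s n)" for n
    by (intro measurable_permuton[OF \<mu>s] borel_measurable_continuous_onI)
  have M: "prob_space (M n)" "sets (M n) = sets borel" for n
    unfolding M_def by (simp_all add: prob_space.prob_space_distr[OF permuton_prob_space[OF \<mu>s] meas])
  have cube: "AE x in M n. \<forall>i. x i \<in> {0..1}" for n
  proof -
    have "{x :: 'd \<Rightarrow> real. \<forall>i. x i \<in> {0..1}} = Pi\<^sub>E UNIV (\<lambda>_. {0..1})" by (auto simp: PiE_iff)
    moreover have "closed (Pi\<^sub>E UNIV (\<lambda>_ :: 'd. {0..1::real}))"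
      by (intro compact_imp_closed compact_PiE_UNIV) simp
    ultimately have "{x :: 'd \<Rightarrow> real. \<forall>i. x i \<in> {0..1}} \<in> sets borel" by simp
    then show ?thesis
      unfolding M_def by (subst AE_distr_iff[OF meas])
        (auto simp: permuton_space[OF \<mu>s] mem_box_cart intro!: AE_I2)
  qed
  obtain r N where r: "strict_mono r" and N: "prob_space N" "sets N = sets borel"
    and conv: "\<And>f :: ('d \<Rightarrow> real) \<Rightarrow> real. continuous_on UNIV f \<Longrightarrow> bounded (range f) \<Longrightarrow>
      (\<lambda>n. LINT x|M (r n). f x) \<longlonglongrightarrow> (LINT x|N. f x)"
    using compact_laws_on_cube[of M, OF M cube] by blast
  interpret N: prob_space N by (rule N(1))
  \<comment> \<open>Clamping is continuous, fixes the cube and maps everything into it. The image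
    law is thus a measure on the cube even before \<open>N\<close> is known to be concentrated
    there.\<close>
  define cl :: "('d \<Rightarrow> real) \<Rightarrow> real ^ 'd" where "cl f = (\<chi> i. max 0 (min 1 (f i)))" for f
  have cont_cl: "continuous_on UNIV cl"
    unfolding cl_def
    by (intro continuous_on_vec_lambda continuous_on_max continuous_on_min continuous_on_const
        continuous_on_product_coordinates)
  have cl_in: "cl f \<in> cbox 0 1" for f by (simp add: cl_def mem_box_cart)
  have cl_id: "cl (\<lambda>i. x $ i) = x" if "x \<in> cbox 0 1" for x
    using that by (simp add: cl_def mem_box_cart vec_eq_iff)
  have meas_cl: "cl \<in> N \<rightarrow>\<^sub>M restrict_space borel (cbox 0 1)"
    using cl_in borel_measurable_continuous_onI[OF cont_cl]
    by (intro measurable_restrict_space2) (simp_all add: measurable_cong_sets[OF N(2) refl])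
  define \<mu> where "\<mu> = distr N (restrict_space borel (cbox 0 1)) cl"
  have lim: "(\<lambda>n. LINT x|\<mu>s (r n). g x) \<longlonglongrightarrow> (LINT x|\<mu>. g x)"
    if g: "continuous_on (cbox 0 1) g" for g :: "real ^ 'd \<Rightarrow> real"
  proof -
    have cont: "continuous_on UNIV (\<lambda>f. g (cl f))"
      by (rule continuous_on_compose2[OF g cont_cl]) (use cl_in in auto)
    have "bounded (g ` cbox 0 1)" by (intro compact_imp_bounded compact_continuous_image g compact_cbox)
    then have "bounded (range (\<lambda>f. g (cl f)))" by (rule bounded_subset) (use cl_in in auto)
    note conv[OF cont this]
    moreover have "(LINT f|M n. g (cl f)) = (LINT x|\<mu>s n. g x)" for n
    proof -
      have "(LINT f|M n. g (cl f)) = (LINT x|\<mu>s n. g (cl (\<lambda>i. x $ i)))"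
        unfolding M_def by (rule integral_distr[OF meas borel_measurable_continuous_onI[OF cont]])
      also have "\<dots> = (LINT x|\<mu>s n. g x)"
        by (rule Bochner_Integration.integral_cong) (simp_all add: permuton_space[OF \<mu>s] cl_id)
      finally show ?thesis .
    qed
    moreover have "(LINT x|\<mu>. g x) = (LINT f|N. g (cl f))"
      unfolding \<mu>_def by (rule integral_distr[OF meas_cl borel_measurable_continuous_on_restrict[OF g]])
    ultimately show ?thesis by simp
  qed
  have ps: "prob_space \<mu>" unfolding \<mu>_def by (rule N.prob_space_distr[OF meas_cl])
  have sets: "sets \<mu> = sets (restrict_space borel (cbox 0 1))" by (simp add: \<mu>_def)
  \<comment> \<open>A function of one coordinate is a valid test function, and its integrals along
    the sequence are constant because all marginals are uniform.\<close>
  have "distr \<mu> borel (\<lambda>x. x $ i) = uniform_measure lborel {0..1}" for i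
  proof (rule prob_space_eqI_continuous)
    have coord: "(\<lambda>x. x $ i) \<in> borel_measurable \<mu>"
      by (simp add: measurable_cong_sets[OF sets refl] measurable_restrict_space1)
    show "prob_space (distr \<mu> borel (\<lambda>x. x $ i))" by (rule prob_space.prob_space_distr[OF ps coord])
    show "prob_space (uniform_measure lborel {0..1::real})" by (rule prob_space_uniform_measure) auto
    fix f :: "real \<Rightarrow> real" assume f: "continuous_on UNIV f"
    have f': "f \<in> borel_measurable borel" by (rule borel_measurable_continuous_onI[OF f])
    have "(LINT x|\<mu>s (r n). f (x $ i)) = (LINT t|uniform_measure lborel {0..1}. f t)" for n
    proof -
      have "distr (\<mu>s (r n)) borel (\<lambda>x. x $ i) = uniform_measure lborel {0..1}"
        using \<mu>s[of "r n"] by (simp add: permutons_def)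
      then show ?thesis using integral_distr[OF measurable_permuton_coord[OF \<mu>s[of "r n"], of i] f'] by simp
    qed
    moreover have "continuous_on (cbox 0 1) (\<lambda>x :: real ^ 'd. f (x $ i))"
      by (rule continuous_on_compose2[OF f]) (auto intro!: continuous_intros)
    ultimately have "(LINT x|\<mu>. f (x $ i)) = (LINT t|uniform_measure lborel {0..1}. f t)"
      using lim[of "\<lambda>x. f (x $ i)"] by (simp add: LIMSEQ_const_iff)
    then show "(LINT t|distr \<mu> borel (\<lambda>x. x $ i). f t) = (LINT t|uniform_measure lborel {0..1}. f t)"
      by (simp add: integral_distr[OF coord f'])
  qed simp_all
  then have \<mu>: "\<mu> \<in> permutons" using ps sets by (simp add: permutons_def)
  show thesis
    by (rule that[OF r \<mu>], rule limitin_permuton_topology[OF \<mu>]) (use \<mu>s lim in auto)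
qed

section \<open>The vector of pattern densities\<close>

definition pattern_densities :: "(real ^ 'e::finite option) measure \<Rightarrow> 'e dperm \<Rightarrow> real" where
  "pattern_densities \<mu> \<tau> = freq_permuton \<tau> \<mu>"

abbreviation density_cube :: "('e::finite dperm \<Rightarrow> real) set" where
  "density_cube \<equiv> Pi\<^sub>E UNIV (\<lambda>_. {0..1})"

lemma compact_density_cube: "compact (density_cube :: ('e::finite dperm \<Rightarrow> real) set)"
  by (rule compact_PiE_UNIV) simp

lemma pattern_densities_in_cube: "\<mu> \<in> permutons \<Longrightarrow> pattern_densities \<mu> \<in> density_cube"
  by (intro PiE_I) (simp_all only: pattern_densities_def freq_permuton_range UNIV_I not_True_eq_False)

text \<open>A limit of density vectors is the density vector of a subsequential limit of the
  permutons. Sequences suffice to prove closedness because the countable product is first countable;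
  the surrounding cube is compact.\<close>

lemma compact_pattern_densities: "compact (pattern_densities ` permutons :: ('e::finite dperm \<Rightarrow> real) set)"
proof -
  have "closed (pattern_densities ` permutons :: ('e dperm \<Rightarrow> real) set)"
    unfolding closed_sequential_limits
  proof (intro allI impI, elim conjE)
    fix v :: "nat \<Rightarrow> 'e dperm \<Rightarrow> real" and l
    assume v: "\<forall>n. v n \<in> pattern_densities ` permutons" and lim: "v \<longlonglongrightarrow> l"
    from v have "\<forall>n. \<exists>\<mu>. \<mu> \<in> permutons \<and> v n = pattern_densities \<mu>"
      unfolding image_iff Bex_def .
    from choice[OF this] obtain \<mu>s where "\<forall>n. \<mu>s n \<in> permutons \<and> v n = pattern_densities (\<mu>s n)" ..
    then have \<mu>s: "\<And>n. \<mu>s n \<in> permutons" "\<And>n. v n = pattern_densities (\<mu>s n)" by simp_all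
    obtain r \<mu> where r: "strict_mono r" and \<mu>: "\<mu> \<in> permutons" and
      conv: "limitin permuton_topology (\<mu>s \<circ> r) \<mu> sequentially"
      by (rule permutons_sequentially_compact[OF \<mu>s(1)])
    have "l \<tau> = pattern_densities \<mu> \<tau>" for \<tau>
    proof (rule LIMSEQ_unique)
      have "(freq_permuton \<tau> \<circ> (\<mu>s \<circ> r)) \<longlonglongrightarrow> freq_permuton \<tau> \<mu>"
        using continuous_map_limit[OF continuous_map_freq_permuton conv, of \<tau>] by simp
      then show "(\<lambda>n. v (r n) \<tau>) \<longlonglongrightarrow> pattern_densities \<mu> \<tau>"
        by (simp add: \<mu>s(2) pattern_densities_def comp_def)
      have "isCont (\<lambda>x :: 'e dperm \<Rightarrow> real. x \<tau>) l"
        using continuous_on_interior[OF continuous_on_product_coordinates[of \<tau>], of l] by simp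
      then have "(\<lambda>n. v n \<tau>) \<longlonglongrightarrow> l \<tau>" using lim by (rule isCont_tendsto_compose)
      from LIMSEQ_subseq_LIMSEQ[OF this r] show "(\<lambda>n. v (r n) \<tau>) \<longlonglongrightarrow> l \<tau>" by (simp add: comp_def)
    qed
    then have "l = pattern_densities \<mu>" by (rule ext)
    with \<mu> show "l \<in> pattern_densities ` permutons" by blast
  qed
  then have "compact (density_cube \<inter> pattern_densities ` permutons :: ('e dperm \<Rightarrow> real) set)"
    by (intro compact_Int_closed compact_density_cube)
  moreover have "density_cube \<inter> pattern_densities ` permutons = (pattern_densities ` permutons :: ('e dperm \<Rightarrow> real) set)"
    using pattern_densities_in_cube by blast
  ultimately show ?thesis by simp
qed

section \<open>Polynomials in the pattern densities\<close>

inductive coord_polynomial :: "(('i \<Rightarrow> real) \<Rightarrow> real) \<Rightarrow> bool" where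
  coord: "coord_polynomial (\<lambda>v. v i)"
| const: "coord_polynomial (\<lambda>_. c)"
| add: "coord_polynomial p \<Longrightarrow> coord_polynomial q \<Longrightarrow> coord_polynomial (\<lambda>v. p v + q v)"
| mult: "coord_polynomial p \<Longrightarrow> coord_polynomial q \<Longrightarrow> coord_polynomial (\<lambda>v. p v * q v)"

lemma coord_polynomial_continuous: "coord_polynomial p \<Longrightarrow> continuous_on S p"
  by (induction rule: coord_polynomial.induct)
    (auto intro!: continuous_on_add continuous_on_mult continuous_on_subset[OF continuous_on_product_coordinates])

lemma coord_polynomial_dense:
  fixes f :: "('i::countable \<Rightarrow> real) \<Rightarrow> real"
  assumes S: "compact S" and f: "continuous_on S f" and "\<epsilon> > 0"
  obtains p where "coord_polynomial p" "\<And>v. v \<in> S \<Longrightarrow> \<bar>f v - p v\<bar> < \<epsilon>"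
proof -
  interpret function_ring_on "Collect coord_polynomial" S
  proof
    show "\<exists>f\<in>Collect coord_polynomial. f x \<noteq> f y" if "x \<noteq> y" for x y :: "'i \<Rightarrow> real"
    proof -
      have "\<exists>i. x i \<noteq> y i" using that by (simp add: fun_eq_iff)
      then obtain i where "x i \<noteq> y i" ..
      then show ?thesis by (intro bexI[of _ "\<lambda>v. v i"]) (simp_all add: coord_polynomial.coord)
    qed
  qed (simp_all only: mem_Collect_eq S coord_polynomial_continuous coord_polynomial.intros)
  show thesis using Stone_Weierstrass_basic[OF f \<open>\<epsilon> > 0\<close>] that by blast
qed

lemma freq_combination_polynomial:
  assumes "freq_combination F"
  shows "\<exists>p. coord_polynomial p \<and> (\<forall>\<mu>\<in>permutons. F \<mu> = p (pattern_densities \<mu>))"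
  using assms
proof induction
  case (freq \<tau>)
  show ?case by (rule exI[of _ "\<lambda>v. v \<tau>"]) (simp add: coord_polynomial.coord pattern_densities_def)
next
  case (add F F')
  then obtain p q where "coord_polynomial p" "coord_polynomial q"
    "\<forall>\<mu>\<in>permutons. F \<mu> = p (pattern_densities \<mu>)" "\<forall>\<mu>\<in>permutons. F' \<mu> = q (pattern_densities \<mu>)" by blast
  then show ?case by (intro exI[of _ "\<lambda>v. p v + q v"]) (simp add: coord_polynomial.add)
next
  case (scale F c)
  then obtain p where "coord_polynomial p" "\<forall>\<mu>\<in>permutons. F \<mu> = p (pattern_densities \<mu>)" by blast
  then show ?case by (intro exI[of _ "\<lambda>v. c * p v"]) (simp add: coord_polynomial.mult coord_polynomial.const)
next
  case (cong F F')
  then show ?case by metis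
qed

lemma polynomial_freq_combination:
  "coord_polynomial p \<Longrightarrow> freq_combination (\<lambda>\<mu>. p (pattern_densities \<mu>))"
proof (induction rule: coord_polynomial.induct)
  case (coord \<tau>)
  show ?case unfolding pattern_densities_def by (rule freq_combination.freq)
next
  case (const c)
  show ?case by (rule freq_combination_const)
next
  case (add p q)
  from freq_combination.add[OF add.IH] show ?case .
next
  case (mult p q)
  from freq_combination_mult[OF mult.IH] show ?case .
qed

section \<open>Recovering a permuton from its densities\<close>

lemma inj_on_pattern_densities: "inj_on pattern_densities (permutons :: (real ^ 'e::finite option) measure set)"
proof (rule inj_onI)
  fix \<mu> \<nu> :: "(real ^ 'e option) measure"
  assume \<mu>: "\<mu> \<in> permutons" and \<nu>: "\<nu> \<in> permutons" and eq: "pattern_densities \<mu> = pattern_densities \<nu>"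
  show "\<mu> = \<nu>"
  proof (rule permuton_eqI_integral[OF \<mu> \<nu>])
    fix g :: "real ^ 'e option \<Rightarrow> real" assume g: "continuous_on (cbox 0 1) g"
    have "\<bar>(LINT x|\<mu>. g x) - (LINT x|\<nu>. g x)\<bar> \<le> 0"
    proof (rule field_le_epsilon)
      fix e :: real assume "e > 0"
      then obtain F where F: "freq_combination F" "\<And>\<mu>. \<mu> \<in> permutons \<Longrightarrow> \<bar>(LINT x|\<mu>. g x) - F \<mu>\<bar> \<le> e / 2"
        using integral_approx_freq_combination[OF g, of "e / 2"] by (metis half_gt_zero)
      have "F \<mu> = F \<nu>" using freq_combination_polynomial[OF F(1)] eq \<mu> \<nu> by metis
      with F(2)[OF \<mu>] F(2)[OF \<nu>] show "\<bar>(LINT x|\<mu>. g x) - (LINT x|\<nu>. g x)\<bar> \<le> 0 + e" by linarith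
    qed
    then show "(LINT x|\<mu>. g x) = (LINT x|\<nu>. g x)" by simp
  qed
qed

definition permuton_of_densities :: "('e::finite dperm \<Rightarrow> real) \<Rightarrow> (real ^ 'e option) measure" where
  "permuton_of_densities = the_inv_into permutons pattern_densities"

lemma permuton_of_densities_inverse:
  "\<mu> \<in> permutons \<Longrightarrow> permuton_of_densities (pattern_densities \<mu>) = \<mu>"
  unfolding permuton_of_densities_def by (rule the_inv_into_f_f[OF inj_on_pattern_densities])

text \<open>Subbasic open sets are given by integrals of continuous functions, and on the image
  these are uniform limits of polynomials in the density vector. Continuity of the inverse thus
  comes from explicit approximants.\<close>

lemma continuous_map_permuton_of_densities:
  "continuous_map (top_of_set (pattern_densities ` permutons)) permuton_topology permuton_of_densities"
  unfolding permuton_topology_def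
proof (rule continuous_on_generated_topo)
  let ?K = "pattern_densities ` permutons :: ('a dperm \<Rightarrow> real) set"
  show "permuton_of_densities ` topspace (top_of_set ?K) \<subseteq> \<Union>{{\<mu> \<in> permutons. (LINT x|\<mu>. f x) \<in> U} |
      (f :: real ^ 'a option \<Rightarrow> real) U. continuous_on (cbox 0 1) f \<and> open (U :: real set)}"
    using topspace_permuton_topology[where 'd = "'a option"]
    unfolding permuton_topology_def topology_generated_by_topspace
    by (auto simp: permuton_of_densities_inverse)
  fix W assume "W \<in> {{\<mu> \<in> permutons. (LINT x|\<mu>. f x) \<in> U} |
      (f :: real ^ 'a option \<Rightarrow> real) U. continuous_on (cbox 0 1) f \<and> open (U :: real set)}"
  then obtain g :: "real ^ 'a option \<Rightarrow> real" and U where g: "continuous_on (cbox 0 1) g" and U: "open U"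
    and W: "W = {\<mu> \<in> permutons. (LINT x|\<mu>. g x) \<in> U}" by blast
  have "continuous_map (top_of_set ?K) euclideanreal (\<lambda>v. LINT x|permuton_of_densities v. g x)"
  proof (rule continuous_map_real_uniform_approx)
    fix e :: real assume "e > 0"
    obtain F where F: "freq_combination F" "\<And>\<mu>. \<mu> \<in> permutons \<Longrightarrow> \<bar>(LINT x|\<mu>. g x) - F \<mu>\<bar> \<le> e"
      using integral_approx_freq_combination[OF g \<open>e > 0\<close>] by blast
    obtain p where p: "coord_polynomial p" "\<And>\<mu>. \<mu> \<in> permutons \<Longrightarrow> F \<mu> = p (pattern_densities \<mu>)"
      using freq_combination_polynomial[OF F(1)] by blast
    have "\<bar>(LINT x|permuton_of_densities v. g x) - p v\<bar> \<le> e" if "v \<in> ?K" for v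
      using that F(2) p(2) by (auto simp: permuton_of_densities_inverse)
    then show "\<exists>p. continuous_map (top_of_set ?K) euclideanreal p \<and>
        (\<forall>v\<in>topspace (top_of_set ?K). \<bar>(LINT x|permuton_of_densities v. g x) - p v\<bar> \<le> e)"
      using coord_polynomial_continuous[OF p(1)] by (intro exI[of _ p]) simp
  qed
  then have "openin (top_of_set ?K) {v \<in> topspace (top_of_set ?K). (LINT x|permuton_of_densities v. g x) \<in> U}"
    by (rule openin_continuous_map_preimage) (use U in simp)
  moreover have "permuton_of_densities -` W \<inter> topspace (top_of_set ?K)
      = {v \<in> topspace (top_of_set ?K). (LINT x|permuton_of_densities v. g x) \<in> U}"
    unfolding W by (auto simp: permuton_of_densities_inverse)
  ultimately show "openin (top_of_set ?K) (permuton_of_densities -` W \<inter> topspace (top_of_set ?K))" by simp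
qed

section \<open>Convergence of random permutations\<close>

lemma sets_borel_of: "sets (borel_of T) = sigma_sets (topspace T) {U. openin T U}"
  unfolding borel_of_def by (rule sets_measure_of) (auto dest: openin_subset)

lemma space_borel_of: "space (borel_of T) = topspace T"
  by (simp add: borel_of_def space_measure_of_conv)

lemma borel_measurable_borel_of:
  assumes "continuous_map T euclideanreal f"
  shows "f \<in> borel_measurable (borel_of T)"
proof (rule borel_measurableI)
  fix S :: "real set" assume "open S"
  then have "openin T {x \<in> topspace T. f x \<in> S}"
    using assms by (intro openin_continuous_map_preimage) auto
  moreover have "f -` S \<inter> space (borel_of T) = {x \<in> topspace T. f x \<in> S}"
    by (auto simp: space_borel_of)
  ultimately show "f -` S \<inter> space (borel_of T) \<in> sets (borel_of T)"
    by (simp add: sets_borel_of sigma_sets.Basic)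
qed

lemma vec_topology_euclidean: "vec_topology = (euclidean :: ('e::finite dperm \<Rightarrow> real) topology)"
  by (rule euclidean_product_topology)

text \<open>Links \<open>borel_of\<close>, used for abstract topologies, with the type class
  \<open>borel\<close>, in which the compactness results are stated.\<close>

lemma sets_borel_of_vec: "sets (borel_of vec_topology) = sets (borel :: ('e::finite dperm \<Rightarrow> real) measure)"
  unfolding vec_topology_euclidean sets_borel_of by (simp add: borel_def)

lemma measurable_borel_ofI:
  assumes "\<And>x. x \<in> space N \<Longrightarrow> f x \<in> topspace T"
    and "\<And>U. openin T U \<Longrightarrow> {x \<in> space N. f x \<in> U} \<in> sets N"
  shows "f \<in> N \<rightarrow>\<^sub>M borel_of T"
proof (rule measurable_sigma_sets[OF sets_borel_of])
  show "{U. openin T U} \<subseteq> Pow (topspace T)" by (auto dest: openin_subset)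
  show "f \<in> space N \<rightarrow> topspace T" using assms(1) by blast
  fix U assume "U \<in> {U. openin T U}"
  then have "{x \<in> space N. f x \<in> U} \<in> sets N" using assms(2) by blast
  moreover have "f -` U \<inter> space N = {x \<in> space N. f x \<in> U}" by blast
  ultimately show "f -` U \<inter> space N \<in> sets N" by simp
qed

section \<open>Frequencies and densities of large permutations\<close>

definition perm_freqs :: "'e::finite dperm \<Rightarrow> 'e dperm \<Rightarrow> real" where
  "perm_freqs \<sigma> \<tau> = freq \<tau> \<sigma>"

lemma perm_freqs_in_cube: "perm_freqs \<sigma> \<in> density_cube"
  by (intro PiE_I) (simp_all only: perm_freqs_def freq_range UNIV_I not_True_eq_False)

abbreviation perm_densities :: "'e::finite dperm \<Rightarrow> 'e dperm \<Rightarrow> real" where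
  "perm_densities \<sigma> \<equiv> pattern_densities (permuton_of \<sigma>)"

lemma perm_densities_in_cube: "perm_densities \<sigma> \<in> density_cube"
  by (rule pattern_densities_in_cube[OF permuton_of_in_permutons])

lemma continuous_bounded_on_density_cube:
  fixes f :: "('e::finite dperm \<Rightarrow> real) \<Rightarrow> real"
  assumes "continuous_on density_cube f"
  obtains B where "B \<ge> 0" "\<And>v. v \<in> density_cube \<Longrightarrow> \<bar>f v\<bar> \<le> B"
proof -
  have "bounded (f ` density_cube)"
    by (rule compact_imp_bounded[OF compact_continuous_image[OF assms compact_density_cube]])
  then obtain B where B: "\<forall>y\<in>f ` density_cube. norm y \<le> B" unfolding bounded_iff ..
  have le: "\<bar>f v\<bar> \<le> max 0 B" if "v \<in> density_cube" for v
    using bspec[OF B imageI[OF that]] by simp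
  show thesis by (rule that[OF max.cobounded1 le])
qed

text \<open>The filter expresses that only the size grows: the error for a single pattern is bounded
  in terms of the size, and products are controlled because both vectors stay in the compact
  cube.\<close>

lemma coord_polynomial_freqs_densities:
  fixes p :: "('e::finite dperm \<Rightarrow> real) \<Rightarrow> real"
  assumes "coord_polynomial p"
  shows "((\<lambda>\<sigma>. p (perm_freqs \<sigma>) - p (perm_densities \<sigma>)) \<longlongrightarrow> 0) (filtercomap psize at_top)"
  using assms
proof induction
  case (coord \<tau>)
  have "filterlim (\<lambda>\<sigma> :: 'e dperm. real (psize \<sigma>)) at_top (filtercomap psize at_top)"
    by (rule filterlim_compose[OF filterlim_real_sequentially filterlim_filtercomap])
  then have "((\<lambda>\<sigma> :: 'e dperm. 2 * (real (psize \<tau>))\<^sup>2 / real (psize \<sigma>)) \<longlongrightarrow> 0) (filtercomap psize at_top)"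
    by (intro tendsto_divide_0[OF tendsto_const] filterlim_at_top_imp_at_infinity)
  then show ?case
    by (rule Lim_null_comparison[rotated])
      (unfold perm_freqs_def pattern_densities_def real_norm_def, intro always_eventually allI freq_permuton_of)
next
  case (const c)
  show ?case by simp
next
  case (add p q)
  have "(a - b) + (c - d) = (a + c) - (b + d)" for a b c d :: real by simp
  with tendsto_add[OF add.IH] show ?case by (simp only: add_0)
next
  case (mult p q)
  obtain Bp where Bp: "Bp \<ge> 0" "\<And>v. v \<in> density_cube \<Longrightarrow> \<bar>p v\<bar> \<le> Bp"
    using continuous_bounded_on_density_cube[OF coord_polynomial_continuous[OF mult.hyps(1)]] by blast
  obtain Bq where Bq: "Bq \<ge> 0" "\<And>v. v \<in> density_cube \<Longrightarrow> \<bar>q v\<bar> \<le> Bq"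
    using continuous_bounded_on_density_cube[OF coord_polynomial_continuous[OF mult.hyps(2)]] by blast
  let ?dp = "\<lambda>\<sigma>. p (perm_freqs \<sigma>) - p (perm_densities \<sigma>)" and ?dq = "\<lambda>\<sigma>. q (perm_freqs \<sigma>) - q (perm_densities \<sigma>)"
  have lim: "((\<lambda>\<sigma>. \<bar>?dp \<sigma>\<bar> * Bq + Bp * \<bar>?dq \<sigma>\<bar>) \<longlongrightarrow> 0) (filtercomap psize at_top)"
    using tendsto_add[OF tendsto_mult[OF tendsto_rabs[OF mult.IH(1)] tendsto_const[of Bq]]
        tendsto_mult[OF tendsto_const[of Bp] tendsto_rabs[OF mult.IH(2)]]]
    by (simp only: abs_zero mult_zero_left mult_zero_right add_0)
  have prod_diff: "\<bar>a * b - c * d\<bar> \<le> \<bar>a - c\<bar> * \<bar>b\<bar> + \<bar>c\<bar> * \<bar>b - d\<bar>" for a b c d :: real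
  proof -
    have "a * b - c * d = (a - c) * b + c * (b - d)" by (simp add: algebra_simps)
    then show ?thesis using abs_triangle_ineq[of "(a - c) * b" "c * (b - d)"] by (simp add: abs_mult)
  qed
  show ?case
  proof (rule Lim_null_comparison[OF always_eventually lim], rule allI)
    fix \<sigma> :: "'e dperm"
    have "\<bar>p (perm_freqs \<sigma>) * q (perm_freqs \<sigma>) - p (perm_densities \<sigma>) * q (perm_densities \<sigma>)\<bar>
      \<le> \<bar>?dp \<sigma>\<bar> * \<bar>q (perm_freqs \<sigma>)\<bar> + \<bar>p (perm_densities \<sigma>)\<bar> * \<bar>?dq \<sigma>\<bar>"
      by (rule prod_diff)
    also have "\<dots> \<le> \<bar>?dp \<sigma>\<bar> * Bq + Bp * \<bar>?dq \<sigma>\<bar>"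
    proof (rule add_mono)
      show "\<bar>?dp \<sigma>\<bar> * \<bar>q (perm_freqs \<sigma>)\<bar> \<le> \<bar>?dp \<sigma>\<bar> * Bq"
        by (rule mult_left_mono[OF Bq(2)[OF perm_freqs_in_cube[of \<sigma>]] abs_ge_zero])
      show "\<bar>p (perm_densities \<sigma>)\<bar> * \<bar>?dq \<sigma>\<bar> \<le> Bp * \<bar>?dq \<sigma>\<bar>"
        by (rule mult_right_mono[OF Bp(2)[OF perm_densities_in_cube[of \<sigma>]] abs_ge_zero])
    qed
    finally show "norm (p (perm_freqs \<sigma>) * q (perm_freqs \<sigma>) - p (perm_densities \<sigma>) * q (perm_densities \<sigma>))
      \<le> \<bar>?dp \<sigma>\<bar> * Bq + Bp * \<bar>?dq \<sigma>\<bar>" unfolding real_norm_def .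
  qed
qed

text \<open>The threshold \<open>n0\<close> serves all permutations of large size, so the estimate
  survives taking expectations of random permutations.\<close>

lemma continuous_freqs_densities:
  fixes f :: "('e::finite dperm \<Rightarrow> real) \<Rightarrow> real"
  assumes f: "continuous_on density_cube f" and "\<epsilon> > 0"
  obtains n0 where "\<And>\<sigma>. psize \<sigma> \<ge> n0 \<Longrightarrow> \<bar>f (perm_freqs \<sigma>) - f (perm_densities \<sigma>)\<bar> < \<epsilon>"
proof -
  have "\<epsilon> / 3 > 0" using \<open>\<epsilon> > 0\<close> by simp
  obtain p where p: "coord_polynomial p" and close: "\<And>v. v \<in> density_cube \<Longrightarrow> \<bar>f v - p v\<bar> < \<epsilon> / 3"
    using coord_polynomial_dense[OF compact_density_cube f \<open>\<epsilon> / 3 > 0\<close>] by blast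
  have "\<forall>\<^sub>F \<sigma> in filtercomap psize at_top. \<bar>p (perm_freqs \<sigma>) - p (perm_densities \<sigma>)\<bar> < \<epsilon> / 3"
    using tendstoD[OF coord_polynomial_freqs_densities[OF p] \<open>\<epsilon> / 3 > 0\<close>] by (simp add: dist_real_def)
  then obtain n0 where n0: "\<And>\<sigma>. psize \<sigma> \<ge> n0 \<Longrightarrow> \<bar>p (perm_freqs \<sigma>) - p (perm_densities \<sigma>)\<bar> < \<epsilon> / 3"
    by (auto simp: eventually_filtercomap_at_top_linorder)
  show thesis
  proof (rule that)
    fix \<sigma> :: "'e dperm" assume "psize \<sigma> \<ge> n0"
    from n0[OF this] close[OF perm_freqs_in_cube, of \<sigma>] close[OF perm_densities_in_cube, of \<sigma>]
    show "\<bar>f (perm_freqs \<sigma>) - f (perm_densities \<sigma>)\<bar> < \<epsilon>" by linarith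
  qed
qed

text \<open>Sizes start at 1, so \<open>M 0\<close> is arbitrary; later arguments pass to
  \<open>Suc n\<close> or hold eventually.\<close>

locale random_permutations =
  fixes M :: "nat \<Rightarrow> 'a measure" and \<sigma> :: "nat \<Rightarrow> 'a \<Rightarrow> 'e::finite dperm"
  assumes prob_space_M: "\<And>n. n \<ge> 1 \<Longrightarrow> prob_space (M n)"
    and measurable_\<sigma>: "\<And>n. n \<ge> 1 \<Longrightarrow> \<sigma> n \<in> M n \<rightarrow>\<^sub>M count_space UNIV"
    and psize_\<sigma>: "\<And>n \<omega>. n \<ge> 1 \<Longrightarrow> \<omega> \<in> space (M n) \<Longrightarrow> psize (\<sigma> n \<omega>) = n"
begin

lemma measurable_fun_\<sigma>:
  assumes "n \<ge> 1" "\<And>\<tau>. h \<tau> \<in> space L"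
  shows "(\<lambda>\<omega>. h (\<sigma> n \<omega>)) \<in> M n \<rightarrow>\<^sub>M L"
  by (rule measurable_compose[OF measurable_\<sigma>[OF assms(1)]]) (use assms(2) in \<open>simp add: Pi_iff\<close>)

lemma integrable_fun_\<sigma>:
  fixes h :: "'e dperm \<Rightarrow> real"
  assumes "n \<ge> 1" "\<And>\<tau>. \<bar>h \<tau>\<bar> \<le> B"
  shows "integrable (M n) (\<lambda>\<omega>. h (\<sigma> n \<omega>))"
proof -
  interpret prob_space "M n" by (rule prob_space_M[OF assms(1)])
  show ?thesis
    by (rule integrable_const_bound[where B = B]) (use assms measurable_fun_\<sigma>[of n h borel] in auto)
qed

lemma integral_le_fun_\<sigma>:
  fixes h h' :: "'e dperm \<Rightarrow> real"
  assumes n: "n \<ge> 1" and h: "\<And>\<tau>. \<bar>h \<tau>\<bar> \<le> B" and h': "\<And>\<tau>. \<bar>h' \<tau>\<bar> \<le> B'"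
    and le: "\<And>\<tau>. psize \<tau> = n \<Longrightarrow> \<bar>h \<tau> - h' \<tau>\<bar> \<le> \<epsilon>"
  shows "\<bar>(LINT \<omega>|M n. h (\<sigma> n \<omega>)) - (LINT \<omega>|M n. h' (\<sigma> n \<omega>))\<bar> \<le> \<epsilon>"
proof -
  interpret prob_space "M n" by (rule prob_space_M[OF n])
  note int = integrable_fun_\<sigma>[where h = h, OF n h] integrable_fun_\<sigma>[where h = h', OF n h']
  have "\<bar>(LINT \<omega>|M n. h (\<sigma> n \<omega>)) - (LINT \<omega>|M n. h' (\<sigma> n \<omega>))\<bar> = \<bar>LINT \<omega>|M n. h (\<sigma> n \<omega>) - h' (\<sigma> n \<omega>)\<bar>"
    using int by simp
  also have "\<dots> \<le> (LINT \<omega>|M n. \<bar>h (\<sigma> n \<omega>) - h' (\<sigma> n \<omega>)\<bar>)" by (rule integral_abs_bound)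
  also have "\<dots> \<le> (LINT \<omega>|M n. \<epsilon>)"
    by (rule integral_mono) (use int le psize_\<sigma>[OF n] in auto)
  finally show ?thesis by (simp add: prob_space)
qed

lemma freqs_densities_diff:
  fixes f :: "('e dperm \<Rightarrow> real) \<Rightarrow> real"
  assumes f: "continuous_on density_cube f"
  shows "(\<lambda>n. (LINT \<omega>|M n. f (perm_freqs (\<sigma> n \<omega>))) - (LINT \<omega>|M n. f (perm_densities (\<sigma> n \<omega>)))) \<longlonglongrightarrow> 0"
proof (rule LIMSEQ_I)
  fix e :: real assume "e > 0"
  then have "e / 2 > 0" by simp
  obtain n0 where n0: "\<And>\<sigma>. psize \<sigma> \<ge> n0 \<Longrightarrow> \<bar>f (perm_freqs \<sigma>) - f (perm_densities \<sigma>)\<bar> < e / 2"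
    using continuous_freqs_densities[OF f \<open>e / 2 > 0\<close>] by blast
  obtain B where B: "\<And>v. v \<in> density_cube \<Longrightarrow> \<bar>f v\<bar> \<le> B"
    using continuous_bounded_on_density_cube[OF f] by blast
  show "\<exists>no. \<forall>n\<ge>no. norm ((LINT \<omega>|M n. f (perm_freqs (\<sigma> n \<omega>))) - (LINT \<omega>|M n. f (perm_densities (\<sigma> n \<omega>))) - 0) < e"
  proof (intro exI allI impI)
    fix n assume n: "max n0 1 \<le> n"
    have "\<bar>(LINT \<omega>|M n. f (perm_freqs (\<sigma> n \<omega>))) - (LINT \<omega>|M n. f (perm_densities (\<sigma> n \<omega>)))\<bar> \<le> e / 2"
    proof (rule integral_le_fun_\<sigma>)
      show "\<bar>f (perm_freqs \<tau>) - f (perm_densities \<tau>)\<bar> \<le> e / 2" if "psize \<tau> = n" for \<tau> :: "'e dperm"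
        using n0[of \<tau>] n that by simp
    qed (use n B[OF perm_freqs_in_cube] B[OF perm_densities_in_cube] in auto)
    with \<open>e > 0\<close> show "norm ((LINT \<omega>|M n. f (perm_freqs (\<sigma> n \<omega>))) - (LINT \<omega>|M n. f (perm_densities (\<sigma> n \<omega>))) - 0) < e"
      by simp
  qed
qed

lemma freqs_limit_iff:
  fixes f :: "('e dperm \<Rightarrow> real) \<Rightarrow> real"
  assumes f: "continuous_on density_cube f"
  shows "(\<lambda>n. LINT \<omega>|M n. f (perm_freqs (\<sigma> n \<omega>))) \<longlonglongrightarrow> l \<longleftrightarrow>
    (\<lambda>n. LINT \<omega>|M n. f (perm_densities (\<sigma> n \<omega>))) \<longlonglongrightarrow> l"
proof
  assume "(\<lambda>n. LINT \<omega>|M n. f (perm_freqs (\<sigma> n \<omega>))) \<longlonglongrightarrow> l"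
  from tendsto_diff[OF this freqs_densities_diff[OF f]]
  show "(\<lambda>n. LINT \<omega>|M n. f (perm_densities (\<sigma> n \<omega>))) \<longlonglongrightarrow> l" by simp
next
  assume "(\<lambda>n. LINT \<omega>|M n. f (perm_densities (\<sigma> n \<omega>))) \<longlonglongrightarrow> l"
  from tendsto_add[OF this freqs_densities_diff[OF f]]
  show "(\<lambda>n. LINT \<omega>|M n. f (perm_freqs (\<sigma> n \<omega>))) \<longlonglongrightarrow> l" by simp
qed

lemma mean_freq_limit_iff:
  "mean_freq_limit M \<sigma> c \<longleftrightarrow> (\<forall>\<tau>. (\<lambda>n. LINT \<omega>|M n. freq_permuton \<tau> (permuton_of (\<sigma> n \<omega>))) \<longlonglongrightarrow> c \<tau>)"
proof -
  have "(\<lambda>n. LINT \<omega>|M n. freq \<tau> (\<sigma> n \<omega>)) \<longlonglongrightarrow> c \<tau> \<longleftrightarrow>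
      (\<lambda>n. LINT \<omega>|M n. freq_permuton \<tau> (permuton_of (\<sigma> n \<omega>))) \<longlonglongrightarrow> c \<tau>" for \<tau>
    using freqs_limit_iff[OF coord_polynomial_continuous[OF coord_polynomial.coord[of \<tau>]], of "c \<tau>"]
    by (simp only: perm_freqs_def pattern_densities_def)
  then show ?thesis by (simp add: mean_freq_limit_def)
qed

text \<open>Supplies the integrability without which the expectation of a sum does not
  split.\<close>

lemma freq_combination_bounded:
  fixes F :: "(real ^ 'e option) measure \<Rightarrow> real"
  assumes "freq_combination F"
  obtains B where "\<And>\<tau>. \<bar>F (permuton_of \<tau>)\<bar> \<le> B"
proof -
  obtain p where p: "coord_polynomial p" "\<forall>\<mu>\<in>permutons. F \<mu> = p (pattern_densities \<mu>)"
    using freq_combination_polynomial[OF assms] by blast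
  obtain B where "\<And>v. v \<in> density_cube \<Longrightarrow> \<bar>p v\<bar> \<le> B"
    using continuous_bounded_on_density_cube[OF coord_polynomial_continuous[OF p(1)]] by blast
  then have "\<bar>p (perm_densities \<tau>)\<bar> \<le> B" for \<tau> using perm_densities_in_cube .
  moreover have "F (permuton_of \<tau>) = p (perm_densities \<tau>)" for \<tau>
    using p(2) permuton_of_in_permutons by (rule bspec)
  ultimately show thesis by (intro that[of B]) simp
qed

lemma freq_combination_convergent:
  fixes F :: "(real ^ 'e option) measure \<Rightarrow> real"
  assumes c: "mean_freq_limit M \<sigma> c" and "freq_combination F"
  shows "convergent (\<lambda>n. LINT \<omega>|M n. F (permuton_of (\<sigma> n \<omega>)))"
  using assms(2)
proof induction
  case (freq \<tau>)
  show ?case using c unfolding mean_freq_limit_iff convergent_def by blast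
next
  case (add F F')
  obtain B where B: "\<And>\<tau>. \<bar>F (permuton_of \<tau>)\<bar> \<le> B" using freq_combination_bounded[OF add.hyps(1)] by blast
  obtain B' where B': "\<And>\<tau>. \<bar>F' (permuton_of \<tau>)\<bar> \<le> B'" using freq_combination_bounded[OF add.hyps(2)] by blast
  have "\<forall>\<^sub>F n in sequentially. (LINT \<omega>|M n. F (permuton_of (\<sigma> n \<omega>))) + (LINT \<omega>|M n. F' (permuton_of (\<sigma> n \<omega>)))
      = (LINT \<omega>|M n. F (permuton_of (\<sigma> n \<omega>)) + F' (permuton_of (\<sigma> n \<omega>)))"
    using eventually_ge_at_top[of 1]
  proof eventually_elim
    case (elim n)
    show ?case
      using integrable_fun_\<sigma>[where h = "\<lambda>\<tau>. F (permuton_of \<tau>)", OF elim B]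
        integrable_fun_\<sigma>[where h = "\<lambda>\<tau>. F' (permuton_of \<tau>)", OF elim B'] by simp
  qed
  then show ?case
    using convergent_add[OF add.IH] by (rule convergent_cong[THEN iffD1])
next
  case (scale F c)
  show ?case using convergent_mult[OF convergent_const[of c] scale.IH] by simp
next
  case (cong F F')
  then show ?case by (simp add: permuton_of_in_permutons)
qed

end

section \<open>From convergence of means to a limiting random permuton\<close>

context random_permutations
begin

text \<open>A subsequence of the laws of density vectors has a limit \<open>\<nu>\<close>, and its
  image under the inverse map is the law of the limiting permuton. Polynomials have convergent
  expectations along the full sequence with limits read off from \<open>\<nu>\<close>, and they
  approximate every test function uniformly on the image of the permutons.\<close>

theorem permuton_limit_exists:
  assumes c: "mean_freq_limit M \<sigma> c"
  shows "\<exists>(N :: (real ^ 'e option) measure measure) \<mu>. permuton_limit M \<sigma> N \<mu>"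
proof -
  let ?K = "pattern_densities ` permutons :: ('e dperm \<Rightarrow> real) set"
  define X where "X n \<omega> = perm_densities (\<sigma> n \<omega>)" for n \<omega>
  define L where "L n = distr (M (Suc n)) borel (X (Suc n))" for n
  have X_meas: "X (Suc n) \<in> M (Suc n) \<rightarrow>\<^sub>M borel" for n
    unfolding X_def by (rule measurable_fun_\<sigma>) simp_all
  have closedK: "closed ?K" by (rule compact_imp_closed[OF compact_pattern_densities])
  have L: "prob_space (L n)" "sets (L n) = sets borel" for n
    unfolding L_def by (rule prob_space.prob_space_distr[OF prob_space_M X_meas]) simp_all
  have L_K: "AE v in L n. v \<in> ?K" for n
    unfolding L_def
  proof (subst AE_distr_iff[OF X_meas])
    show "{v \<in> space borel. v \<in> ?K} \<in> sets borel" using borel_closed[OF closedK] by simp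
    show "AE \<omega> in M (Suc n). X (Suc n) \<omega> \<in> ?K"
      unfolding X_def by (intro AE_I2 imageI permuton_of_in_permutons)
  qed
  have L_cube: "AE v in L n. \<forall>\<tau>. v \<tau> \<in> {0..1}" for n
    using L_K[of n]
  proof eventually_elim
    case (elim v)
    then have "v \<in> density_cube" using pattern_densities_in_cube by (elim imageE) (simp only:)
    then show ?case by (intro allI PiE_mem[of v UNIV]) simp_all
  qed
  obtain r \<nu> where r: "strict_mono r" and \<nu>: "prob_space \<nu>" "sets \<nu> = sets borel"
    and conv: "\<And>f :: ('e dperm \<Rightarrow> real) \<Rightarrow> real. continuous_on UNIV f \<Longrightarrow> bounded (range f) \<Longrightarrow>
      (\<lambda>n. LINT v|L (r n). f v) \<longlonglongrightarrow> (LINT v|\<nu>. f v)"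
    using compact_laws_on_cube[of L, OF L L_cube] by blast
  interpret \<nu>: prob_space \<nu> by (rule \<nu>(1))
  have \<nu>_K: "AE v in \<nu>. v \<in> ?K"
    by (rule AE_closed_weak_limit[OF \<nu> closedK L_K conv])
  \<comment> \<open>A default value for vectors that are no density vectors. Permutons exist because
    the probability \<open>\<nu>\<close> is concentrated on the image of the set of
    permutons.\<close>
  define \<pi> where "\<pi> = (SOME \<mu>. \<mu> \<in> (permutons :: (real ^ 'e option) measure set))"
  have "AE v in \<nu>. \<exists>\<mu>. \<mu> \<in> (permutons :: (real ^ 'e option) measure set)"
    using \<nu>_K by eventually_elim blast
  then have "\<exists>\<mu>. \<mu> \<in> (permutons :: (real ^ 'e option) measure set)" by simp
  then have \<pi>: "\<pi> \<in> permutons" unfolding \<pi>_def by (rule someI_ex)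
  define \<Psi> where "\<Psi> v = (if v \<in> ?K then permuton_of_densities v else \<pi>)" for v
  have \<Psi>_permutons: "\<Psi> v \<in> permutons" for v
    using \<pi> by (auto simp: \<Psi>_def permuton_of_densities_inverse)
  have \<Psi>_dens: "\<Psi> (pattern_densities \<mu>) = \<mu>" if "\<mu> \<in> permutons" for \<mu>
    using that by (simp add: \<Psi>_def permuton_of_densities_inverse)
  have \<Psi>_meas: "\<Psi> \<in> \<nu> \<rightarrow>\<^sub>M borel_of permuton_topology"
  proof (rule measurable_borel_ofI)
    show "\<Psi> v \<in> topspace permuton_topology" for v by (simp add: topspace_permuton_topology \<Psi>_permutons)
    fix U :: "(real ^ 'e option) measure set" assume "openin permuton_topology U"
    from openin_continuous_map_preimage[OF continuous_map_permuton_of_densities this]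
    obtain V where V: "open V" "{v \<in> topspace (top_of_set ?K). permuton_of_densities v \<in> U} = ?K \<inter> V"
      unfolding openin_open by blast
    \<comment> \<open>On the closed set \<open>?K\<close> the preimage is relatively open; off it
      \<open>\<Psi>\<close> is constant.\<close>
    have "{v \<in> space \<nu>. \<Psi> v \<in> U} = (?K \<inter> V) \<union> (if \<pi> \<in> U then - ?K else {})"
      unfolding V(2)[symmetric] using sets_eq_imp_space_eq[OF \<nu>(2)] by (auto simp: \<Psi>_def)
    also have "\<dots> \<in> sets borel" using V(1) borel_closed[OF closedK] by auto
    finally show "{v \<in> space \<nu>. \<Psi> v \<in> U} \<in> sets \<nu>" by (simp add: \<nu>(2))
  qed
  define N where "N = distr \<nu> (borel_of permuton_topology) \<Psi>"
  have "random_element permuton_topology N (\<lambda>\<mu>. \<mu>)"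
    unfolding random_element_def N_def using \<nu>.prob_space_distr[OF \<Psi>_meas] by simp
  moreover have "conv_in_distr permuton_topology M (\<lambda>n \<omega>. permuton_of (\<sigma> n \<omega>)) N (\<lambda>\<mu>. \<mu>)"
    unfolding conv_in_distr_def
  proof (intro allI impI, elim conjE)
    fix f :: "(real ^ 'e option) measure \<Rightarrow> real"
    assume f: "continuous_map permuton_topology euclideanreal f"
      and "bounded (f ` topspace permuton_topology)"
    then obtain B where B: "\<And>\<mu>. \<mu> \<in> permutons \<Longrightarrow> \<bar>f \<mu>\<bar> \<le> B"
      by (auto simp: bounded_iff topspace_permuton_topology)
    have f\<Psi>_meas: "(\<lambda>v. f (\<Psi> v)) \<in> borel_measurable \<nu>"
      by (rule measurable_compose[OF \<Psi>_meas borel_measurable_borel_of[OF f]])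
    have int_f: "(LINT \<mu>|N. f \<mu>) = (LINT v|\<nu>. f (\<Psi> v))"
      unfolding N_def by (rule integral_distr[OF \<Psi>_meas borel_measurable_borel_of[OF f]])
    have "continuous_map (top_of_set ?K) euclideanreal (f \<circ> permuton_of_densities)"
      by (rule continuous_map_compose[OF continuous_map_permuton_of_densities f])
    then have cont: "continuous_on ?K (f \<circ> permuton_of_densities)" by simp
    show "(\<lambda>n. LINT \<omega>|M n. f (permuton_of (\<sigma> n \<omega>))) \<longlonglongrightarrow> (LINT \<mu>|N. f \<mu>)"
      unfolding int_f
    proof (rule LIMSEQ_I)
      fix e :: real assume "e > 0"
      \<comment> \<open>Three errors occur: \<open>f\<close> against \<open>p\<close> at finite
        \<open>n\<close>, the convergence of the expectations of \<open>p\<close>, and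
        \<open>p\<close> against \<open>f\<close> in the limit.\<close>
      then have e4: "e / 4 > 0" by simp
      obtain p where p: "coord_polynomial p" "\<And>v. v \<in> ?K \<Longrightarrow> \<bar>(f \<circ> permuton_of_densities) v - p v\<bar> < e / 4"
        using coord_polynomial_dense[OF compact_pattern_densities cont e4] by blast
      have fp: "\<bar>f \<mu> - p (pattern_densities \<mu>)\<bar> \<le> e / 4" if "\<mu> \<in> permutons" for \<mu>
        using p(2)[OF imageI[OF that]] by (simp add: permuton_of_densities_inverse[OF that])
      \<comment> \<open>Weak convergence needs a test function bounded on the whole space. Clamping
        the arguments achieves this without changing values on the cube.\<close>
      define p' where "p' v = p (\<lambda>\<tau>. max 0 (min 1 (v \<tau>)))" for v
      have p'_eq: "p' v = p v" if "v \<in> density_cube" for v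
      proof -
        have "max 0 (min 1 (v \<tau>)) = v \<tau>" for \<tau> using PiE_mem[OF that, of \<tau>] by simp
        then show ?thesis by (simp add: p'_def)
      qed
      have clamp_cube: "(\<lambda>\<tau>. max 0 (min 1 (v \<tau>))) \<in> density_cube" for v :: "'e dperm \<Rightarrow> real"
        by (rule PiE_I) auto
      obtain Bp where Bp: "\<And>v. v \<in> density_cube \<Longrightarrow> \<bar>p v\<bar> \<le> Bp"
        using continuous_bounded_on_density_cube[OF coord_polynomial_continuous[OF p(1)]] by blast
      have p'_bdd: "\<bar>p' v\<bar> \<le> Bp" for v unfolding p'_def by (rule Bp[OF clamp_cube])
      have p'_cont: "continuous_on UNIV p'"
        unfolding p'_def
        by (rule continuous_on_compose2[OF coord_polynomial_continuous[OF p(1), of UNIV]])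
          (auto intro!: continuous_on_coordinatewise_then_product continuous_on_max continuous_on_min
            continuous_on_const continuous_on_product_coordinates)
      have p'_meas: "p' \<in> borel_measurable borel" by (rule borel_measurable_continuous_onI[OF p'_cont])
      have Lp: "(LINT v|L n. p' v) = (LINT \<omega>|M (Suc n). p (perm_densities (\<sigma> (Suc n) \<omega>)))" for n
        unfolding L_def integral_distr[OF X_meas p'_meas] X_def p'_eq[OF perm_densities_in_cube] ..
      obtain b where b: "(\<lambda>n. LINT \<omega>|M n. p (perm_densities (\<sigma> n \<omega>))) \<longlonglongrightarrow> b"
        using freq_combination_convergent[OF c polynomial_freq_combination[OF p(1)]]
        unfolding convergent_def by blast
      \<comment> \<open>\<open>b\<close> is the limit along the whole sequence; the subsequence
        serves only to identify it as an integral against \<open>\<nu>\<close>.\<close>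
      have "strict_mono (\<lambda>n. Suc (r n))" using r by (simp add: strict_mono_def)
      from LIMSEQ_subseq_LIMSEQ[OF b this] have "(\<lambda>n. LINT v|L (r n). p' v) \<longlonglongrightarrow> b"
        by (simp add: comp_def Lp)
      moreover have "bounded (range p')" using p'_bdd by (intro boundedI[where B = Bp]) auto
      ultimately have b_eq: "b = (LINT v|\<nu>. p' v)"
        using conv[OF p'_cont] LIMSEQ_unique by blast
      have p'\<nu>: "p' \<in> borel_measurable \<nu>" using p'_meas by (simp add: measurable_cong_sets[OF \<nu>(2) refl])
      have int\<nu>: "integrable \<nu> (\<lambda>v. f (\<Psi> v))" "integrable \<nu> p'"
        by (rule \<nu>.integrable_const_bound[where B = B], use B \<Psi>_permutons f\<Psi>_meas in auto)
          (rule \<nu>.integrable_const_bound[where B = Bp], use p'_bdd p'\<nu> in auto)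
      have "AE v in \<nu>. \<bar>p' v - f (\<Psi> v)\<bar> \<le> e / 4"
        using \<nu>_K
      proof eventually_elim
        case (elim v)
        then obtain \<mu> where \<mu>: "\<mu> \<in> permutons" "v = pattern_densities \<mu>" by blast
        show ?case using fp[OF \<mu>(1)]
          unfolding \<mu>(2) p'_eq[OF pattern_densities_in_cube[OF \<mu>(1)]] \<Psi>_dens[OF \<mu>(1)]
          by (simp add: abs_minus_commute)
      qed
      then have "(LINT v|\<nu>. \<bar>p' v - f (\<Psi> v)\<bar>) \<le> (LINT v|\<nu>. e / 4)"
        using int\<nu> by (intro integral_mono_AE) auto
      moreover have "\<bar>(LINT v|\<nu>. p' v) - (LINT v|\<nu>. f (\<Psi> v))\<bar> \<le> (LINT v|\<nu>. \<bar>p' v - f (\<Psi> v)\<bar>)"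
        using int\<nu> integral_abs_bound[of \<nu> "\<lambda>v. p' v - f (\<Psi> v)"] by simp
      ultimately have b_close: "\<bar>b - (LINT v|\<nu>. f (\<Psi> v))\<bar> \<le> e / 4"
        by (simp add: b_eq \<nu>.prob_space)
      obtain n0 where n0: "\<And>n. n \<ge> n0 \<Longrightarrow> \<bar>(LINT \<omega>|M n. p (perm_densities (\<sigma> n \<omega>))) - b\<bar> < e / 4"
        using LIMSEQ_D[OF b e4] by auto
      show "\<exists>no. \<forall>n\<ge>no. norm ((LINT \<omega>|M n. f (permuton_of (\<sigma> n \<omega>))) - (LINT v|\<nu>. f (\<Psi> v))) < e"
      proof (intro exI allI impI)
        fix n assume n: "max 1 n0 \<le> n"
        have "\<bar>(LINT \<omega>|M n. f (permuton_of (\<sigma> n \<omega>))) - (LINT \<omega>|M n. p (perm_densities (\<sigma> n \<omega>)))\<bar> \<le> e / 4"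
          by (rule integral_le_fun_\<sigma>[where B = B and B' = Bp])
            (use n B[OF permuton_of_in_permutons] Bp[OF perm_densities_in_cube] fp[OF permuton_of_in_permutons] in auto)
        moreover have "\<bar>(LINT \<omega>|M n. p (perm_densities (\<sigma> n \<omega>))) - b\<bar> < e / 4" using n0[of n] n by simp
        ultimately show "norm ((LINT \<omega>|M n. f (permuton_of (\<sigma> n \<omega>))) - (LINT v|\<nu>. f (\<Psi> v))) < e"
          using b_close e4 unfolding real_norm_def by linarith
      qed
    qed
  qed
  ultimately show ?thesis unfolding permuton_limit_def by blast
qed

section \<open>Implications between the modes of convergence\<close>

lemma continuous_map_pattern_densities:
  "continuous_map permuton_topology vec_topology (pattern_densities :: (real ^ 'd::finite option) measure \<Rightarrow> _)"
  unfolding continuous_map_componentwise_UNIV pattern_densities_def by (intro allI continuous_map_freq_permuton)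

text \<open>A continuous function of the density vector is a bounded continuous function of the
  permuton, as density vectors stay in a compact cube. Replacing densities by frequencies does not
  change the limit.\<close>

lemma permuton_limit_densities:
  assumes "permuton_limit M \<sigma> N \<mu>"
  shows "prob_space N" "\<mu> \<in> N \<rightarrow>\<^sub>M borel_of permuton_topology"
    "\<And>\<omega>. \<omega> \<in> space N \<Longrightarrow> \<mu> \<omega> \<in> permutons"
    "(\<lambda>\<omega>. pattern_densities (\<mu> \<omega>)) \<in> borel_measurable N"
    "\<And>f :: ('e dperm \<Rightarrow> real) \<Rightarrow> real. continuous_on UNIV f \<Longrightarrow>
      (\<lambda>n. LINT \<omega>|M n. f (perm_freqs (\<sigma> n \<omega>))) \<longlonglongrightarrow> (LINT \<omega>|N. f (pattern_densities (\<mu> \<omega>)))"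
proof -
  show ps: "prob_space N" and meas: "\<mu> \<in> N \<rightarrow>\<^sub>M borel_of permuton_topology"
    using assms by (simp_all add: permuton_limit_def random_element_def)
  show "\<mu> \<omega> \<in> permutons" if "\<omega> \<in> space N" for \<omega>
    using measurable_space[OF meas that] by (simp add: space_borel_of topspace_permuton_topology)
  have "pattern_densities \<in> borel_of permuton_topology \<rightarrow>\<^sub>M borel_of (vec_topology :: ('e dperm \<Rightarrow> real) topology)"
  proof (rule measurable_borel_ofI)
    fix U :: "('e dperm \<Rightarrow> real) set" assume "openin vec_topology U"
    from openin_continuous_map_preimage[OF continuous_map_pattern_densities this]
    show "{x \<in> space (borel_of permuton_topology). pattern_densities x \<in> U} \<in> sets (borel_of permuton_topology)"
      by (simp add: space_borel_of sets_borel_of sigma_sets.Basic)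
  qed simp
  from measurable_compose[OF meas this] show "(\<lambda>\<omega>. pattern_densities (\<mu> \<omega>)) \<in> borel_measurable N"
    by (simp add: measurable_cong_sets[OF refl sets_borel_of_vec])
  fix f :: "('e dperm \<Rightarrow> real) \<Rightarrow> real" assume f: "continuous_on UNIV f"
  have fcube: "continuous_on density_cube f" by (rule continuous_on_subset[OF f]) simp
  obtain B where B: "\<And>v. v \<in> density_cube \<Longrightarrow> \<bar>f v\<bar> \<le> B"
    using continuous_bounded_on_density_cube[OF fcube] by blast
  have "continuous_map vec_topology euclideanreal f"
    unfolding vec_topology_euclidean using f by simp
  from continuous_map_compose[OF continuous_map_pattern_densities this]
  have "continuous_map permuton_topology euclideanreal (\<lambda>\<mu>. f (pattern_densities \<mu>))" by (simp add: comp_def)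
  moreover have "bounded ((\<lambda>\<mu>. f (pattern_densities \<mu>)) ` topspace permuton_topology)"
    using B pattern_densities_in_cube by (intro boundedI[where B = B]) (auto simp: topspace_permuton_topology)
  ultimately have "(\<lambda>n. LINT \<omega>|M n. f (perm_densities (\<sigma> n \<omega>))) \<longlonglongrightarrow> (LINT \<omega>|N. f (pattern_densities (\<mu> \<omega>)))"
    using assms unfolding permuton_limit_def conv_in_distr_def by blast
  then show "(\<lambda>n. LINT \<omega>|M n. f (perm_freqs (\<sigma> n \<omega>))) \<longlonglongrightarrow> (LINT \<omega>|N. f (pattern_densities (\<mu> \<omega>)))"
    using freqs_limit_iff[OF fcube] by simp
qed

text \<open>The limit vector is realised as the identity on its own law, so the probability space
  has the type required in the existential statement.\<close>

lemma permuton_limit_imp_freq_limit: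
  assumes "permuton_limit M \<sigma> N \<mu>"
  shows "freq_limit M \<sigma> (distr N (borel_of vec_topology) (\<lambda>\<omega>. pattern_densities (\<mu> \<omega>))) (\<lambda>v. v)"
proof -
  note pl = permuton_limit_densities[OF assms]
  have meas: "(\<lambda>\<omega>. pattern_densities (\<mu> \<omega>)) \<in> N \<rightarrow>\<^sub>M borel_of vec_topology"
    using pl(4) by (simp add: measurable_cong_sets[OF refl sets_borel_of_vec])
  show ?thesis
    unfolding freq_limit_def random_element_def conv_in_distr_def
  proof (intro conjI allI impI)
    show "prob_space (distr N (borel_of vec_topology) (\<lambda>\<omega>. pattern_densities (\<mu> \<omega>)))"
      by (rule prob_space.prob_space_distr[OF pl(1) meas])
    show "(\<lambda>v. v) \<in> distr N (borel_of vec_topology) (\<lambda>\<omega>. pattern_densities (\<mu> \<omega>)) \<rightarrow>\<^sub>M borel_of vec_topology"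
      by simp
    fix f :: "('e dperm \<Rightarrow> real) \<Rightarrow> real"
    assume f: "continuous_map vec_topology euclideanreal f \<and> bounded (f ` topspace vec_topology)"
    then have "continuous_on UNIV f" unfolding vec_topology_euclidean by simp
    from pl(5)[OF this] have "(\<lambda>n. LINT \<omega>|M n. f (\<lambda>\<tau>. freq \<tau> (\<sigma> n \<omega>))) \<longlonglongrightarrow> (LINT \<omega>|N. f (pattern_densities (\<mu> \<omega>)))"
      by (simp only: perm_freqs_def[abs_def])
    moreover have "(LINT v|distr N (borel_of vec_topology) (\<lambda>\<omega>. pattern_densities (\<mu> \<omega>)). f v)
        = (LINT \<omega>|N. f (pattern_densities (\<mu> \<omega>)))"
      using f by (intro integral_distr[OF meas] borel_measurable_borel_of) simp
    ultimately show "(\<lambda>n. LINT \<omega>|M n. f (\<lambda>\<tau>. freq \<tau> (\<sigma> n \<omega>)))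
        \<longlonglongrightarrow> (LINT v|distr N (borel_of vec_topology) (\<lambda>\<omega>. pattern_densities (\<mu> \<omega>)). f v)"
      by simp
  qed
qed

lemma freq_limit_conv:
  assumes "freq_limit M \<sigma> N v"
  shows "prob_space N" "v \<in> borel_measurable N"
    "\<And>f :: ('e dperm \<Rightarrow> real) \<Rightarrow> real. continuous_on UNIV f \<Longrightarrow> bounded (range f) \<Longrightarrow>
      (\<lambda>n. LINT \<omega>|M n. f (perm_freqs (\<sigma> n \<omega>))) \<longlonglongrightarrow> (LINT \<omega>|N. f (v \<omega>))"
proof -
  show "prob_space N" using assms by (simp add: freq_limit_def random_element_def)
  have "v \<in> N \<rightarrow>\<^sub>M borel_of vec_topology" using assms by (simp add: freq_limit_def random_element_def)
  then show "v \<in> borel_measurable N" by (simp only: measurable_cong_sets[OF refl sets_borel_of_vec])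
  fix f :: "('e dperm \<Rightarrow> real) \<Rightarrow> real" assume f: "continuous_on UNIV f" "bounded (range f)"
  then have "continuous_map vec_topology euclideanreal f \<and> bounded (f ` topspace vec_topology)"
    unfolding vec_topology_euclidean by simp
  then show "(\<lambda>n. LINT \<omega>|M n. f (perm_freqs (\<sigma> n \<omega>))) \<longlonglongrightarrow> (LINT \<omega>|N. f (v \<omega>))"
    using assms unfolding freq_limit_def conv_in_distr_def perm_freqs_def[abs_def] by blast
qed

text \<open>A coordinate is not a bounded test function, so it is clamped to [0,1]. Frequencies are
  unaffected, and neither is \<open>v\<close>, which lies almost surely in the cube because weak
  limits preserve closed supports.\<close>

lemma freq_limit_imp_mean_freq_limit:
  assumes "freq_limit M \<sigma> N v"
  shows "mean_freq_limit M \<sigma> (\<lambda>\<tau>. LINT \<omega>|N. v \<omega> \<tau>)"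
  unfolding mean_freq_limit_def
proof
  fix \<tau> :: "'e dperm"
  note fl = freq_limit_conv[OF assms]
  define f where "f w = max 0 (min 1 (w \<tau>))" for w :: "'e dperm \<Rightarrow> real"
  have f: "continuous_on UNIV f" unfolding f_def
    by (intro continuous_on_max continuous_on_min continuous_on_const continuous_on_product_coordinates)
  have bf: "bounded (range f)" unfolding f_def by (intro boundedI[where B = 1]) auto
  have "f (perm_freqs \<rho>) = freq \<tau> \<rho>" for \<rho> using freq_range[of \<tau> \<rho>] by (simp add: f_def perm_freqs_def)
  with fl(3)[OF f bf] have lim: "(\<lambda>n. LINT \<omega>|M n. freq \<tau> (\<sigma> n \<omega>)) \<longlonglongrightarrow> (LINT \<omega>|N. f (v \<omega>))" by simp
  have closed: "closed (density_cube :: ('e dperm \<Rightarrow> real) set)"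
    by (rule compact_imp_closed[OF compact_density_cube])
  have meas: "(\<lambda>\<omega>. perm_freqs (\<sigma> (Suc n) \<omega>)) \<in> borel_measurable (M (Suc n))" for n
    by (rule measurable_fun_\<sigma>) simp_all
  have "AE w in distr N borel v. w \<in> density_cube"
  proof (rule AE_closed_weak_limit[where M = "\<lambda>n. distr (M (Suc n)) borel (\<lambda>\<omega>. perm_freqs (\<sigma> (Suc n) \<omega>))"])
    show "prob_space (distr N borel v)" by (rule prob_space.prob_space_distr[OF fl(1,2)])
    show "AE w in distr (M (Suc n)) borel (\<lambda>\<omega>. perm_freqs (\<sigma> (Suc n) \<omega>)). w \<in> density_cube" for n
    proof (subst AE_distr_iff[OF meas])
      show "{w \<in> space borel. w \<in> (density_cube :: ('e dperm \<Rightarrow> real) set)} \<in> sets borel"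
        using borel_closed[OF closed] by simp
      show "AE \<omega> in M (Suc n). perm_freqs (\<sigma> (Suc n) \<omega>) \<in> density_cube"
        by (intro AE_I2 perm_freqs_in_cube)
    qed
    fix h :: "('e dperm \<Rightarrow> real) \<Rightarrow> real" assume h: "continuous_on UNIV h" "bounded (range h)"
    show "(\<lambda>n. LINT w|distr (M (Suc n)) borel (\<lambda>\<omega>. perm_freqs (\<sigma> (Suc n) \<omega>)). h w) \<longlonglongrightarrow> (LINT w|distr N borel v. h w)"
      using LIMSEQ_Suc[OF fl(3)[OF h]] borel_measurable_continuous_onI[OF h(1)]
      by (simp add: integral_distr[OF meas] integral_distr[OF fl(2)])
  qed (simp_all only: sets_distr closed)
  then have "AE \<omega> in N. v \<omega> \<in> density_cube" by (rule AE_distrD[OF fl(2)])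
  then have "(LINT \<omega>|N. f (v \<omega>)) = (LINT \<omega>|N. v \<omega> \<tau>)"
  proof (intro integral_cong_AE)
    assume "AE \<omega> in N. v \<omega> \<in> density_cube"
    then show "AE \<omega> in N. f (v \<omega>) = v \<omega> \<tau>"
    proof eventually_elim
      case (elim \<omega>)
      from PiE_mem[OF elim, of \<tau>] show ?case by (simp add: f_def)
    qed
    show "(\<lambda>\<omega>. f (v \<omega>)) \<in> borel_measurable N"
      by (rule measurable_compose[OF fl(2) borel_measurable_continuous_onI[OF f]])
    show "(\<lambda>\<omega>. v \<omega> \<tau>) \<in> borel_measurable N"
      by (rule measurable_compose[OF fl(2) borel_measurable_product_coordinate])
  qed
  with lim show "(\<lambda>n. LINT \<omega>|M n. freq \<tau> (\<sigma> n \<omega>)) \<longlonglongrightarrow> (LINT \<omega>|N. v \<omega> \<tau>)" by simp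
qed

end

section \<open>Patterns on uniform random subsets\<close>

lemma freq_eq_sum:
  assumes "psize \<sigma> = n" "psize \<tau> = k" "k \<le> n"
  shows "freq \<tau> \<sigma> = (\<Sum>I | I \<subseteq> {1..n} \<and> card I = k. of_bool (pat I \<sigma> = \<tau>)) / (n choose k)"
proof -
  have "(\<Sum>I | I \<subseteq> {1..n} \<and> card I = k. of_bool (pat I \<sigma> = \<tau>) :: real)
      = card ({I. I \<subseteq> {1..n} \<and> card I = k} \<inter> {I. pat I \<sigma> = \<tau>})"
    by (rule sum_of_bool_eq) (rule finite_subset[of _ "Pow {1..n}"], auto)
  also have "{I. I \<subseteq> {1..n} \<and> card I = k} \<inter> {I. pat I \<sigma> = \<tau>} = {I. I \<subseteq> {1..n} \<and> card I = k \<and> \<tau> = pat I \<sigma>}"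
    by blast
  finally show ?thesis using assms by (simp add: freq_def)
qed

text \<open>Every k-subset has exactly one pattern, and that pattern has size k.\<close>

lemma sum_freq:
  assumes "1 \<le> k" "k \<le> psize (\<sigma> :: 'e::finite dperm)"
  shows "(\<Sum>\<tau> | psize \<tau> = k. freq \<tau> \<sigma>) = 1"
proof -
  let ?n = "psize \<sigma>"
  let ?A = "{I. I \<subseteq> {1..?n} \<and> card I = k}"
  have "(\<Sum>\<tau> | psize \<tau> = k. freq \<tau> \<sigma>) = (\<Sum>\<tau> | psize \<tau> = k. \<Sum>I\<in>?A. of_bool (pat I \<sigma> = \<tau>) / (?n choose k))"
  proof (rule sum.cong[OF refl])
    fix \<tau> :: "'e dperm" assume "\<tau> \<in> {\<tau>. psize \<tau> = k}"
    then have "psize \<tau> = k" by simp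
    from freq_eq_sum[OF refl this assms(2)]
    show "freq \<tau> \<sigma> = (\<Sum>I\<in>?A. of_bool (pat I \<sigma> = \<tau>) / (?n choose k))"
      by (simp only: sum_divide_distrib)
  qed
  also have "\<dots> = (\<Sum>I\<in>?A. \<Sum>\<tau> | psize \<tau> = k. of_bool (pat I \<sigma> = \<tau>) / (?n choose k))"
    by (rule sum.swap)
  also have "\<dots> = (\<Sum>I\<in>?A. 1 / (?n choose k))"
  proof (rule sum.cong[OF refl])
    fix I assume I: "I \<in> ?A"
    then have "psize (pat I \<sigma>) = k"
      using pat_same_order[of I \<sigma>] assms(1) by (simp add: same_order_def)
    have "(\<Sum>\<tau> | psize \<tau> = k. of_bool (pat I \<sigma> = \<tau>) / (?n choose k) :: real)
        = (\<Sum>\<tau> | psize \<tau> = k. if \<tau> = pat I \<sigma> then 1 / (?n choose k) else 0)"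
      by (rule sum.cong) auto
    then show "(\<Sum>\<tau> | psize \<tau> = k. of_bool (pat I \<sigma> = \<tau>) / (?n choose k) :: real) = 1 / (?n choose k)"
      using \<open>psize (pat I \<sigma>) = k\<close> by (simp add: finite_dperms)
  qed
  also have "\<dots> = 1"
    using n_subsets[of "{1..?n}" k] assms(2) by (simp add: zero_less_binomial_iff)
  finally show ?thesis .
qed

lemma emeasure_perm_law:
  assumes \<mu>: "\<mu> \<in> permutons"
  shows "emeasure (perm_law k \<mu>) A = ennreal (LINT x|PiM {1..k} (\<lambda>_. \<mu>). of_bool (perm_of k x \<in> A))"
proof -
  let ?P = "PiM {1..k} (\<lambda>_. \<mu>)"
  interpret prob_space ?P by (rule prob_space_PiM_const[OF permuton_prob_space[OF \<mu>]])
  have meas: "perm_of k \<in> ?P \<rightarrow>\<^sub>M count_space UNIV"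
    by (rule order_invariant_measurable_count_space[OF order_invariant_perm_of measurable_permuton_coord[OF \<mu>]])
  have "(LINT x|?P. of_bool (perm_of k x \<in> A)) = (LINT x|?P. indicator (perm_of k -` A) x)"
    by (rule Bochner_Integration.integral_cong) (auto simp: indicator_def)
  also have "\<dots> = prob (perm_of k -` A \<inter> space ?P)" by simp
  finally show ?thesis
    unfolding perm_law_def by (subst emeasure_distr[OF meas]) (simp_all only: emeasure_eq_measure sets_count_space Pow_UNIV UNIV_I)
qed

text \<open>At ties \<open>perm_of\<close> may have the wrong size, so patterns of size other than k
  have probability 0 only because ties are null.\<close>

lemma emeasure_perm_law_singleton:
  assumes \<mu>: "\<mu> \<in> permutons" and k: "k \<ge> 1"
  shows "emeasure (perm_law k \<mu>) {\<tau>} = (if psize \<tau> = k then ennreal (freq_permuton \<tau> \<mu>) else 0)"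
proof (cases "psize \<tau> = k")
  case True
  then show ?thesis unfolding emeasure_perm_law[OF \<mu>] freq_permuton_def by simp
next
  case False
  have "(LINT x|PiM {1..k} (\<lambda>_. \<mu>). of_bool (perm_of k x \<in> {\<tau>})) = 0"
  proof (rule integral_eq_zero_AE)
    show "AE x in PiM {1..k} (\<lambda>_. \<mu>). of_bool (perm_of k x \<in> {\<tau>}) = 0"
      using AE_tie_free[OF \<mu>]
    proof eventually_elim
      case (elim x)
      show ?case using perm_of_spec(1)[OF elim k] False by auto
    qed
  qed
  with False show ?thesis unfolding emeasure_perm_law[OF \<mu>] by simp
qed

context random_permutations
begin

lemma pattern_prob_eq_mean_freq:
  assumes n: "n \<ge> 1" and kn: "k \<le> n" and \<tau>: "psize \<tau> = k"
  shows "\<P>(p in M n \<Otimes>\<^sub>M uniform_count_measure {I. I \<subseteq> {1..n} \<and> card I = k}. pat (snd p) (\<sigma> n (fst p)) = \<tau>)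
    = (LINT \<omega>|M n. freq \<tau> (\<sigma> n \<omega>))"
proof -
  define A where "A = {I. I \<subseteq> {1..n} \<and> card I = k}"
  let ?U = "uniform_count_measure A"
  have A: "finite A" "card A = n choose k" unfolding A_def using n_subsets[of "{1..n}" k] by simp_all
  then have "card A > 0" using kn by simp
  then have "A \<noteq> {}" by auto
  interpret M: prob_space "M n" by (rule prob_space_M[OF n])
  interpret U: prob_space ?U by (rule prob_space_uniform_count_measure[OF A(1) \<open>A \<noteq> {}\<close>])
  interpret MU: pair_prob_space "M n" ?U by unfold_locales
  define E where "E I = {\<omega> \<in> space (M n). pat I (\<sigma> n \<omega>) = \<tau>}" for I
  have E_meas: "E I \<in> M.events" for I
  proof -
    have "(\<lambda>\<omega>. pat I (\<sigma> n \<omega>)) \<in> M n \<rightarrow>\<^sub>M count_space UNIV" by (rule measurable_fun_\<sigma>[OF n]) simp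
    then show ?thesis unfolding E_def by measurable
  qed
  \<comment> \<open>There are finitely many subsets, so the event is a finite disjoint union of
    rectangles.\<close>
  have "{p \<in> space (M n \<Otimes>\<^sub>M ?U). pat (snd p) (\<sigma> n (fst p)) = \<tau>} = (\<Union>I\<in>A. E I \<times> {I})"
    by (auto simp: space_pair_measure E_def space_uniform_count_measure)
  also have "measure (M n \<Otimes>\<^sub>M ?U) \<dots> = (\<Sum>I\<in>A. measure (M n \<Otimes>\<^sub>M ?U) (E I \<times> {I}))"
    by (rule MU.finite_measure_finite_Union[OF A(1)])
      (auto simp: disjoint_family_on_def sets_uniform_count_measure intro!: pair_measureI E_meas)
  also have "\<dots> = (\<Sum>I\<in>A. M.prob (E I) / card A)"
  proof (rule sum.cong[OF refl])
    fix I assume I: "I \<in> A"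
    have "emeasure (M n \<Otimes>\<^sub>M ?U) (E I \<times> {I}) = emeasure (M n) (E I) * emeasure ?U {I}"
      using I by (intro U.emeasure_pair_measure_Times E_meas) (simp add: sets_uniform_count_measure)
    also have "emeasure ?U {I} = ennreal (1 / card A)"
      using I A(1) \<open>card A > 0\<close> emeasure_uniform_count_measure[OF A(1), of "{I}"] by simp
    finally show "measure (M n \<Otimes>\<^sub>M ?U) (E I \<times> {I}) = M.prob (E I) / card A"
      by (simp add: measure_def enn2real_mult)
  qed
  also have "\<dots> = (\<Sum>I\<in>A. (LINT \<omega>|M n. of_bool (pat I (\<sigma> n \<omega>) = \<tau>)) / (n choose k))"
  proof (rule sum.cong[OF refl])
    fix I assume "I \<in> A"
    have "(LINT \<omega>|M n. of_bool (pat I (\<sigma> n \<omega>) = \<tau>)) = (LINT \<omega>|M n. indicator (E I) \<omega>)"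
      by (rule Bochner_Integration.integral_cong) (auto simp: indicator_def E_def)
    also have "\<dots> = M.prob (E I)" using sets.sets_into_space[OF E_meas] by (simp add: Int_absorb2)
    finally show "M.prob (E I) / card A = (LINT \<omega>|M n. of_bool (pat I (\<sigma> n \<omega>) = \<tau>)) / (n choose k)"
      by (simp add: A(2))
  qed
  also have "\<dots> = (LINT \<omega>|M n. (\<Sum>I\<in>A. of_bool (pat I (\<sigma> n \<omega>) = \<tau>)) / (n choose k))"
  proof -
    have "integrable (M n) (\<lambda>\<omega>. of_bool (pat I (\<sigma> n \<omega>) = \<tau>) :: real)" for I
      by (rule integrable_fun_\<sigma>[OF n, where B = 1]) simp
    then show ?thesis
      by (simp only: integral_divide_zero Bochner_Integration.integral_sum sum_divide_distrib[symmetric])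
  qed
  also have "\<dots> = (LINT \<omega>|M n. freq \<tau> (\<sigma> n \<omega>))"
    by (rule Bochner_Integration.integral_cong[OF refl])
      (simp only: freq_eq_sum[OF psize_\<sigma>[OF n] \<tau> kn] A_def)
  finally show ?thesis by (simp only: A_def)
qed

lemma pattern_prob_limit_iff:
  assumes \<tau>: "psize \<tau> = k"
  shows "(\<lambda>n. \<P>(p in M n \<Otimes>\<^sub>M uniform_count_measure {I. I \<subseteq> {1..n} \<and> card I = k}. pat (snd p) (\<sigma> n (fst p)) = \<tau>)) \<longlonglongrightarrow> l
    \<longleftrightarrow> (\<lambda>n. LINT \<omega>|M n. freq \<tau> (\<sigma> n \<omega>)) \<longlonglongrightarrow> l"
proof (rule tendsto_cong)
  show "\<forall>\<^sub>F n in sequentially. \<P>(p in M n \<Otimes>\<^sub>M uniform_count_measure {I. I \<subseteq> {1..n} \<and> card I = k}. pat (snd p) (\<sigma> n (fst p)) = \<tau>)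
    = (LINT \<omega>|M n. freq \<tau> (\<sigma> n \<omega>))"
    using eventually_ge_at_top[of "max 1 k"]
    by eventually_elim (rule pattern_prob_eq_mean_freq[OF _ _ \<tau>], simp_all)
qed

text \<open>Only finitely many patterns have size k and their frequencies sum to 1 once n is at
  least k. Hence no mass escapes in the limit, and \<open>c\<close> restricted to size k is a
  probability vector.\<close>

lemma mean_freq_limit_imp_pattern_limit:
  assumes c: "mean_freq_limit M \<sigma> c" and k: "k \<ge> 1"
  shows "\<exists>(N :: 'e dperm measure) \<rho>. pattern_limit M \<sigma> k N \<rho>"
proof -
  let ?A = "{\<tau> :: 'e dperm. psize \<tau> = k}"
  have lim: "(\<lambda>n. LINT \<omega>|M n. freq \<tau> (\<sigma> n \<omega>)) \<longlonglongrightarrow> c \<tau>" for \<tau>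
    using c by (simp add: mean_freq_limit_def)
  have int: "integrable (M n) (\<lambda>\<omega>. freq \<tau> (\<sigma> n \<omega>))" if "n \<ge> 1" for n \<tau>
    by (rule integrable_fun_\<sigma>[OF that, where B = 1]) (use freq_range[of \<tau>] in auto)
  have c0: "c \<tau> \<ge> 0" for \<tau>
  proof (rule LIMSEQ_le_const[OF lim])
    show "\<exists>N. \<forall>n\<ge>N. 0 \<le> (LINT \<omega>|M n. freq \<tau> (\<sigma> n \<omega>))"
      using freq_range[of \<tau>] by (intro exI allI impI Bochner_Integration.integral_nonneg) auto
  qed
  have "(\<lambda>n. \<Sum>\<tau>\<in>?A. LINT \<omega>|M n. freq \<tau> (\<sigma> n \<omega>)) \<longlonglongrightarrow> (\<Sum>\<tau>\<in>?A. c \<tau>)"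
    by (intro tendsto_sum lim)
  moreover have "\<forall>\<^sub>F n in sequentially. (\<Sum>\<tau>\<in>?A. LINT \<omega>|M n. freq \<tau> (\<sigma> n \<omega>)) = 1"
    using eventually_ge_at_top[of "max 1 k"]
  proof eventually_elim
    case (elim n)
    then have n: "n \<ge> 1" by simp
    interpret prob_space "M n" by (rule prob_space_M[OF n])
    have "(\<Sum>\<tau>\<in>?A. LINT \<omega>|M n. freq \<tau> (\<sigma> n \<omega>)) = (LINT \<omega>|M n. (\<Sum>\<tau>\<in>?A. freq \<tau> (\<sigma> n \<omega>)))"
      by (rule Bochner_Integration.integral_sum[symmetric]) (rule int[OF n])
    also have "\<dots> = (LINT \<omega>|M n. 1)"
    proof (rule Bochner_Integration.integral_cong[OF refl])
      fix \<omega> assume "\<omega> \<in> space (M n)"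
      then show "(\<Sum>\<tau>\<in>?A. freq \<tau> (\<sigma> n \<omega>)) = 1"
        using elim by (intro sum_freq[OF k]) (simp add: psize_\<sigma>[OF n])
    qed
    finally show ?case by (simp add: prob_space)
  qed
  ultimately have "(\<lambda>_. 1) \<longlonglongrightarrow> (\<Sum>\<tau>\<in>?A. c \<tau>)" by (rule Lim_transform_eventually)
  then have sum_c: "(\<Sum>\<tau>\<in>?A. c \<tau>) = 1" by (simp add: LIMSEQ_const_iff)
  define N where "N = point_measure ?A (\<lambda>\<tau>. ennreal (c \<tau>))"
  have em: "emeasure N X = (\<Sum>\<tau>\<in>X. ennreal (c \<tau>))" if "X \<subseteq> ?A" for X
    unfolding N_def by (rule emeasure_point_measure_finite[OF finite_dperms that])
  have sp: "space N = ?A" by (simp add: N_def space_point_measure)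
  have "emeasure N (space N) = 1"
    using em[of ?A] sum_c c0 by (simp add: sp sum_ennreal)
  then interpret N: prob_space N by (rule prob_spaceI)
  have "\<P>(\<omega> in N. \<omega> = \<tau>) = c \<tau>" if "psize \<tau> = k" for \<tau>
  proof -
    have "{\<omega> \<in> space N. \<omega> = \<tau>} = {\<tau>}" using that by (auto simp: sp)
    then show ?thesis using em[of "{\<tau>}"] that c0 by (simp add: measure_def)
  qed
  moreover have "(\<lambda>\<omega>. \<omega>) \<in> N \<rightarrow>\<^sub>M count_space UNIV" by (simp add: N_def measurable_def sets_point_measure space_point_measure)
  ultimately have "pattern_limit M \<sigma> k N (\<lambda>\<omega>. \<omega>)"
    unfolding pattern_limit_def using pattern_prob_limit_iff lim N.prob_space_axioms sp by simp
  then show ?thesis by blast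
qed

lemma pattern_limits_imp_mean_freq_limit:
  assumes "\<And>k. k \<ge> 1 \<Longrightarrow> \<exists>(N :: 'd measure) \<rho>. pattern_limit M \<sigma> k N \<rho>"
  shows "\<exists>c. mean_freq_limit M \<sigma> c"
proof -
  have "\<exists>l. (\<lambda>n. LINT \<omega>|M n. freq \<tau> (\<sigma> n \<omega>)) \<longlonglongrightarrow> l" for \<tau>
  proof -
    obtain N :: "'d measure" and \<rho> where "pattern_limit M \<sigma> (psize \<tau>) N \<rho>"
      using assms[OF psize_ge_1[of \<tau>]] by blast
    then show ?thesis using pattern_prob_limit_iff[OF refl, of \<tau>] unfolding pattern_limit_def by blast
  qed
  then have "\<forall>\<tau>. \<exists>l. (\<lambda>n. LINT \<omega>|M n. freq \<tau> (\<sigma> n \<omega>)) \<longlonglongrightarrow> l" ..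
  from choice[OF this] show ?thesis unfolding mean_freq_limit_def .
qed

text \<open>Both vectors are limits of the same frequency vectors, and continuous functions with
  values in [0,1] determine a law.\<close>

lemma distr_freq_limit_eq:
  assumes \<mu>: "permuton_limit M \<sigma> N\<^sub>1 \<mu>" and v: "freq_limit M \<sigma> N\<^sub>2 v"
  shows "distr N\<^sub>2 (borel_of vec_topology) v
    = distr N\<^sub>1 (borel_of vec_topology) (\<lambda>\<omega> \<tau>. freq_permuton \<tau> (\<mu> \<omega>))"
proof -
  note pl = permuton_limit_densities[OF \<mu>] and fl = freq_limit_conv[OF v]
  have "distr N\<^sub>2 borel v = distr N\<^sub>1 borel (\<lambda>\<omega>. pattern_densities (\<mu> \<omega>))"
  proof (rule prob_space_eqI_continuous)
    fix f :: "('e dperm \<Rightarrow> real) \<Rightarrow> real"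
    assume f: "continuous_on UNIV f" and f01: "\<And>x. 0 \<le> f x \<and> f x \<le> 1"
    have "bounded (range f)" using f01 by (intro boundedI[where B = 1]) auto
    with fl(3)[OF f] pl(5)[OF f] have "(LINT \<omega>|N\<^sub>2. f (v \<omega>)) = (LINT \<omega>|N\<^sub>1. f (pattern_densities (\<mu> \<omega>)))"
      using LIMSEQ_unique by blast
    then show "(LINT w|distr N\<^sub>2 borel v. f w) = (LINT w|distr N\<^sub>1 borel (\<lambda>\<omega>. pattern_densities (\<mu> \<omega>)). f w)"
      using borel_measurable_continuous_onI[OF f]
      by (simp add: integral_distr[OF fl(2)] integral_distr[OF pl(4)])
  qed (simp_all add: prob_space.prob_space_distr[OF fl(1,2)] prob_space.prob_space_distr[OF pl(1,4)])
  moreover have "distr N\<^sub>2 (borel_of vec_topology) v = distr N\<^sub>2 borel v"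
    by (rule distr_cong) (simp_all only: sets_borel_of_vec)
  moreover have "distr N\<^sub>1 (borel_of vec_topology) (\<lambda>\<omega> \<tau>. freq_permuton \<tau> (\<mu> \<omega>))
      = distr N\<^sub>1 borel (\<lambda>\<omega>. pattern_densities (\<mu> \<omega>))"
    by (rule distr_cong) (simp_all only: sets_borel_of_vec pattern_densities_def[abs_def])
  ultimately show ?thesis by simp
qed

text \<open>The \<open>bind\<close> averages the law of the sampled pattern over the random
  permuton, so it is the law of a sample drawn conditionally on it. Both sides are laws on a
  countable set, compared on singletons.\<close>

lemma distr_pattern_limit_eq:
  assumes \<mu>: "permuton_limit M \<sigma> N\<^sub>1 \<mu>" and \<rho>: "pattern_limit M \<sigma> k N\<^sub>3 \<rho>" and k: "k \<ge> 1"
    and eq: "\<And>\<tau>. psize \<tau> = k \<Longrightarrow> (LINT \<omega>|N\<^sub>1. freq_permuton \<tau> (\<mu> \<omega>)) = \<P>(\<omega> in N\<^sub>3. \<rho> \<omega> = \<tau>)"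
  shows "distr N\<^sub>3 (count_space UNIV) \<rho> = N\<^sub>1 \<bind> (\<lambda>\<omega>. perm_law k (\<mu> \<omega>))"
proof (rule measure_eqI_countable[OF _ _ countable_UNIV_dperm])
  note pl = permuton_limit_densities[OF \<mu>]
  interpret N1: prob_space N\<^sub>1 by (rule pl(1))
  have ps3: "prob_space N\<^sub>3" and \<rho>_meas: "\<rho> \<in> N\<^sub>3 \<rightarrow>\<^sub>M count_space UNIV"
    and \<rho>_size: "\<And>\<omega>. \<omega> \<in> space N\<^sub>3 \<Longrightarrow> psize (\<rho> \<omega>) = k"
    using \<rho> by (simp_all add: pattern_limit_def)
  interpret N3: prob_space N\<^sub>3 by (rule ps3)
  have law: "(\<lambda>\<omega>. perm_law k (\<mu> \<omega>)) \<in> N\<^sub>1 \<rightarrow>\<^sub>M subprob_algebra (count_space UNIV)"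
  proof (rule measurable_subprob_algebra)
    fix \<omega> assume "\<omega> \<in> space N\<^sub>1"
    note \<mu>\<omega> = pl(3)[OF this]
    show "subprob_space (perm_law k (\<mu> \<omega>))"
      unfolding perm_law_def
      by (intro prob_space_imp_subprob_space prob_space.prob_space_distr
          prob_space_PiM_const[OF permuton_prob_space[OF \<mu>\<omega>]]
          order_invariant_measurable_count_space[OF order_invariant_perm_of measurable_permuton_coord[OF \<mu>\<omega>]])
    show "sets (perm_law k (\<mu> \<omega>)) = sets (count_space UNIV)" by (simp add: perm_law_def)
  next
    fix A :: "'e dperm set"
    \<comment> \<open>Measurability of the kernel follows from continuity of sampling probabilities
      in the permuton.\<close>
    have "continuous_map permuton_topology euclideanreal
        (\<lambda>\<mu>. LINT x|PiM {1..k} (\<lambda>_. \<mu>). of_bool (perm_of k x \<in> A))"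
      by (rule continuous_map_order_invariant_integral[OF order_invariant_comp[OF order_invariant_perm_of]])
    from measurable_compose[OF pl(2) borel_measurable_borel_of[OF this]]
    have "(\<lambda>\<omega>. ennreal (LINT x|PiM {1..k} (\<lambda>_. \<mu> \<omega>). of_bool (perm_of k x \<in> A))) \<in> borel_measurable N\<^sub>1"
      by (rule measurable_compose[OF _ measurable_ennreal])
    then show "(\<lambda>\<omega>. emeasure (perm_law k (\<mu> \<omega>)) A) \<in> borel_measurable N\<^sub>1"
      by (rule measurable_cong[THEN iffD1, rotated]) (simp only: emeasure_perm_law[OF pl(3)])
  qed
  show "sets (distr N\<^sub>3 (count_space UNIV) \<rho>) = Pow UNIV" by simp
  show "sets (N\<^sub>1 \<bind> (\<lambda>\<omega>. perm_law k (\<mu> \<omega>))) = Pow UNIV"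
    by (subst sets_bind[where N = "count_space UNIV"]) (simp_all add: perm_law_def N1.not_empty)
  fix \<tau> :: "'e dperm"
  have "emeasure (N\<^sub>1 \<bind> (\<lambda>\<omega>. perm_law k (\<mu> \<omega>))) {\<tau>} = (\<integral>\<^sup>+\<omega>. emeasure (perm_law k (\<mu> \<omega>)) {\<tau>} \<partial>N\<^sub>1)"
    by (rule emeasure_bind[OF N1.not_empty law]) simp
  also have "\<dots> = (\<integral>\<^sup>+\<omega>. (if psize \<tau> = k then ennreal (freq_permuton \<tau> (\<mu> \<omega>)) else 0) \<partial>N\<^sub>1)"
    by (rule nn_integral_cong) (simp only: emeasure_perm_law_singleton[OF pl(3) k])
  also have "\<dots> = emeasure (distr N\<^sub>3 (count_space UNIV) \<rho>) {\<tau>}"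
  proof (cases "psize \<tau> = k")
    case True
    have meas: "(\<lambda>\<omega>. freq_permuton \<tau> (\<mu> \<omega>)) \<in> borel_measurable N\<^sub>1"
      by (rule measurable_compose[OF pl(2) borel_measurable_borel_of[OF continuous_map_freq_permuton]])
    have range: "freq_permuton \<tau> (\<mu> \<omega>) \<in> {0..1}" if "\<omega> \<in> space N\<^sub>1" for \<omega>
      by (rule freq_permuton_range[OF pl(3)[OF that]])
    have "integrable N\<^sub>1 (\<lambda>\<omega>. freq_permuton \<tau> (\<mu> \<omega>))"
      by (rule N1.integrable_const_bound[where B = 1, OF AE_I2 meas]) (use range in auto)
    then have "(\<integral>\<^sup>+\<omega>. ennreal (freq_permuton \<tau> (\<mu> \<omega>)) \<partial>N\<^sub>1) = ennreal (LINT \<omega>|N\<^sub>1. freq_permuton \<tau> (\<mu> \<omega>))"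
      by (rule nn_integral_eq_integral) (use range in \<open>auto intro!: AE_I2\<close>)
    also have "\<dots> = ennreal (\<P>(\<omega> in N\<^sub>3. \<rho> \<omega> = \<tau>))" by (simp only: eq[OF True])
    also have "\<dots> = emeasure (distr N\<^sub>3 (count_space UNIV) \<rho>) {\<tau>}"
      by (subst emeasure_distr[OF \<rho>_meas])
        (simp_all add: N3.emeasure_eq_measure vimage_def Int_def conj_commute)
    finally show ?thesis using True by simp
  next
    case False
    then have "\<rho> -` {\<tau>} \<inter> space N\<^sub>3 = {}" using \<rho>_size by auto
    then show ?thesis using False by (subst emeasure_distr[OF \<rho>_meas]) simp_all
  qed
  finally show "emeasure (distr N\<^sub>3 (count_space UNIV) \<rho>) {\<tau>} = emeasure (N\<^sub>1 \<bind> (\<lambda>\<omega>. perm_law k (\<mu> \<omega>))) {\<tau>}" ..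
qed

lemma limit_means:
  assumes "permuton_limit M \<sigma> N\<^sub>1 \<mu>" "mean_freq_limit M \<sigma> c"
  shows "(LINT \<omega>|N\<^sub>1. freq_permuton \<tau> (\<mu> \<omega>)) = c \<tau>"
proof (rule LIMSEQ_unique)
  show "(\<lambda>n. LINT \<omega>|M n. freq \<tau> (\<sigma> n \<omega>)) \<longlonglongrightarrow> c \<tau>" using assms(2) by (simp add: mean_freq_limit_def)
  show "(\<lambda>n. LINT \<omega>|M n. freq \<tau> (\<sigma> n \<omega>)) \<longlonglongrightarrow> (LINT \<omega>|N\<^sub>1. freq_permuton \<tau> (\<mu> \<omega>))"
    using permuton_limit_densities(5)[OF assms(1) continuous_on_product_coordinates, of \<tau>]
    by (simp only: perm_freqs_def pattern_densities_def)
qed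

end

theorem theorem1p5:
  fixes M :: "nat \<Rightarrow> 'a measure"
    and \<sigma> :: "nat \<Rightarrow> 'a \<Rightarrow> 'e::finite dperm"
  assumes "\<And>n. n \<ge> 1 \<Longrightarrow> prob_space (M n)"
    and "\<And>n. n \<ge> 1 \<Longrightarrow> \<sigma> n \<in> M n \<rightarrow>\<^sub>M count_space UNIV"
    and "\<And>n \<omega>. n \<ge> 1 \<Longrightarrow> \<omega> \<in> space (M n) \<Longrightarrow> psize (\<sigma> n \<omega>) = n"
  shows
    "((\<exists>(N :: (real ^ 'e option) measure measure) \<mu>. permuton_limit M \<sigma> N \<mu>)
        \<longleftrightarrow> (\<exists>(N :: ('e dperm \<Rightarrow> real) measure) v. freq_limit M \<sigma> N v)) \<and>
     ((\<exists>(N :: ('e dperm \<Rightarrow> real) measure) v. freq_limit M \<sigma> N v)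
        \<longleftrightarrow> (\<exists>c. mean_freq_limit M \<sigma> c)) \<and>
     ((\<exists>c. mean_freq_limit M \<sigma> c)
        \<longleftrightarrow> (\<forall>k\<ge>1. \<exists>(N :: 'e dperm measure) \<rho>. pattern_limit M \<sigma> k N \<rho>)) \<and>
     (\<forall>(N\<^sub>1 :: 'b measure) \<mu> (N\<^sub>2 :: 'c measure) v c (N\<^sub>3 :: nat \<Rightarrow> 'f measure) \<rho>.
        permuton_limit M \<sigma> N\<^sub>1 \<mu> \<and> freq_limit M \<sigma> N\<^sub>2 v \<and> mean_freq_limit M \<sigma> c \<and>
        (\<forall>k\<ge>1. pattern_limit M \<sigma> k (N\<^sub>3 k) (\<rho> k)) \<longrightarrow>
          (\<forall>k\<ge>1. \<forall>\<tau>. psize \<tau> = k \<longrightarrow>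
             (LINT \<omega>|N\<^sub>1. freq_permuton \<tau> (\<mu> \<omega>)) = (LINT \<omega>|N\<^sub>2. v \<omega> \<tau>) \<and>
             (LINT \<omega>|N\<^sub>2. v \<omega> \<tau>) = c \<tau> \<and>
             c \<tau> = \<P>(\<omega> in N\<^sub>3 k. \<rho> k \<omega> = \<tau>)) \<and>
          distr N\<^sub>2 (borel_of vec_topology) v
            = distr N\<^sub>1 (borel_of vec_topology) (\<lambda>\<omega> \<tau>. freq_permuton \<tau> (\<mu> \<omega>)) \<and>
          (\<forall>k\<ge>1. distr (N\<^sub>3 k) (count_space UNIV) (\<rho> k) = N\<^sub>1 \<bind> (\<lambda>\<omega>. perm_law k (\<mu> \<omega>))))"
proof -
  interpret random_permutations M \<sigma> by (rule random_permutations.intro) (fact assms)+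
  \<comment> \<open>The modes (1), (2), (3) are linked in a cycle; (4) is linked to (3) alone, as
    both concern the same expectations for large n.\<close>
  have c12: "\<exists>(N :: ('e dperm \<Rightarrow> real) measure) v. freq_limit M \<sigma> N v"
    if "\<exists>(N :: (real ^ 'e option) measure measure) \<mu>. permuton_limit M \<sigma> N \<mu>"
    using that permuton_limit_imp_freq_limit by blast
  have c23: "\<exists>c. mean_freq_limit M \<sigma> c" if "\<exists>(N :: ('e dperm \<Rightarrow> real) measure) v. freq_limit M \<sigma> N v"
    using that freq_limit_imp_mean_freq_limit by blast
  have c31: "\<exists>(N :: (real ^ 'e option) measure measure) \<mu>. permuton_limit M \<sigma> N \<mu>"
    if "\<exists>c. mean_freq_limit M \<sigma> c"
    using that permuton_limit_exists by blast
  have c34: "(\<exists>c. mean_freq_limit M \<sigma> c) \<longleftrightarrow> (\<forall>k\<ge>1. \<exists>(N :: 'e dperm measure) \<rho>. pattern_limit M \<sigma> k N \<rho>)"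
    using mean_freq_limit_imp_pattern_limit pattern_limits_imp_mean_freq_limit by blast
  have further: "(\<forall>k\<ge>1. \<forall>\<tau>. psize \<tau> = k \<longrightarrow>
             (LINT \<omega>|N\<^sub>1. freq_permuton \<tau> (\<mu> \<omega>)) = (LINT \<omega>|N\<^sub>2. v \<omega> \<tau>) \<and>
             (LINT \<omega>|N\<^sub>2. v \<omega> \<tau>) = c \<tau> \<and>
             c \<tau> = \<P>(\<omega> in N\<^sub>3 k. \<rho> k \<omega> = \<tau>)) \<and>
          distr N\<^sub>2 (borel_of vec_topology) v
            = distr N\<^sub>1 (borel_of vec_topology) (\<lambda>\<omega> \<tau>. freq_permuton \<tau> (\<mu> \<omega>)) \<and>
          (\<forall>k\<ge>1. distr (N\<^sub>3 k) (count_space UNIV) (\<rho> k) = N\<^sub>1 \<bind> (\<lambda>\<omega>. perm_law k (\<mu> \<omega>)))"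
    if \<mu>: "permuton_limit M \<sigma> N\<^sub>1 \<mu>" and v: "freq_limit M \<sigma> N\<^sub>2 v" and c: "mean_freq_limit M \<sigma> c"
      and \<rho>: "\<And>k. k \<ge> 1 \<Longrightarrow> pattern_limit M \<sigma> k (N\<^sub>3 k) (\<rho> k)"
    for N\<^sub>1 :: "'b measure" and \<mu> and N\<^sub>2 :: "'c measure" and v c and N\<^sub>3 :: "nat \<Rightarrow> 'f measure" and \<rho>
  proof -
    have m1: "(LINT \<omega>|N\<^sub>1. freq_permuton \<tau> (\<mu> \<omega>)) = c \<tau>" for \<tau> by (rule limit_means[OF \<mu> c])
    have m2: "(LINT \<omega>|N\<^sub>2. v \<omega> \<tau>) = c \<tau>" for \<tau>
      using freq_limit_imp_mean_freq_limit[OF v] c LIMSEQ_unique unfolding mean_freq_limit_def by blast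
    have m3: "c \<tau> = \<P>(\<omega> in N\<^sub>3 k. \<rho> k \<omega> = \<tau>)" if "k \<ge> 1" "psize \<tau> = k" for k \<tau>
    proof (rule LIMSEQ_unique)
      show "(\<lambda>n. LINT \<omega>|M n. freq \<tau> (\<sigma> n \<omega>)) \<longlonglongrightarrow> c \<tau>" using c by (simp add: mean_freq_limit_def)
      show "(\<lambda>n. LINT \<omega>|M n. freq \<tau> (\<sigma> n \<omega>)) \<longlonglongrightarrow> \<P>(\<omega> in N\<^sub>3 k. \<rho> k \<omega> = \<tau>)"
        using \<rho>[OF that(1)] that(2) pattern_prob_limit_iff[OF that(2)] unfolding pattern_limit_def by blast
    qed
    have "distr (N\<^sub>3 k) (count_space UNIV) (\<rho> k) = N\<^sub>1 \<bind> (\<lambda>\<omega>. perm_law k (\<mu> \<omega>))" if "k \<ge> 1" for k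
      by (rule distr_pattern_limit_eq[OF \<mu> \<rho>[OF that] that]) (simp only: m1 m3[OF that])
    with m1 m2 m3 distr_freq_limit_eq[OF \<mu> v] show ?thesis by simp
  qed
  have e12: "(\<exists>(N :: (real ^ 'e option) measure measure) \<mu>. permuton_limit M \<sigma> N \<mu>)
      \<longleftrightarrow> (\<exists>(N :: ('e dperm \<Rightarrow> real) measure) v. freq_limit M \<sigma> N v)"
    by (rule iffI) (erule c12, erule c31[OF c23])
  have e23: "(\<exists>(N :: ('e dperm \<Rightarrow> real) measure) v. freq_limit M \<sigma> N v) \<longleftrightarrow> (\<exists>c. mean_freq_limit M \<sigma> c)"
    by (rule iffI) (erule c23, erule c12[OF c31])
  show ?thesis
    by (rule conjI[OF e12 conjI[OF e23 conjI[OF c34]]], intro allI impI, elim conjE, rule further)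
      (assumption+, blast)
qed

end
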